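(* Let $w$ be a doubling weight, $0<p<1$, and let $r\in\mathbb{N}$ be such that $r>1/p$. Then there exists a positive constant $\vartheta$, depending only on $r$, $p$ and the doubling constant of $w$, such that for every $f\in L_p[-1,1]$ and every $n\in\mathbb{N}$, $$\omega_\varphi^r(f,\vartheta n^{-1})_{p,w_n}\le\frac{c}{n^{r-1/p}}\left(\sum_{k=1}^n k^{rp-2}E_k(f)_{p,w_k}^p\right)^{1/p},$$ where the constant $c$ depends only on $r$, $p$ and the doubling constant of $w$.
   Context: A doubling weight is a nonnegative $w\in L_1[-1,1]$, extended by $0$ outside $[-1,1]$, for which there is a constant $L$ (the doubling constant of $w$) with $\int_{2I}w\le L\int_I w$ for all intervals $I\subset[-1,1]$, where $2I$ is the interval with the same center as $I$ and twice its length. Let $\varphi(x)=\sqrt{1-x^2}$, $\rho_n(x)=n^{-1}\sqrt{1-x^2}+n^{-2}$, and $w_n(x)=\frac{1}{\rho_n(x)}\int_{x-\rho_n(x)}^{x+\rho_n(x)}w(u)\,du$. For a weight $v$ on $[-1,1]$: $\|g\|_{p,v}=\left(\int_{-1}^1|g|^p v\right)^{1/p}$. $\Pi_n$ is the set of algebraic polynomials of degree $\le n-1$ and $E_n(f)_{p,v}=\inf_{P\in\Pi_n}\|f-P\|_{p,v}$. Symmetric difference: $\Delta_h^r(f,x)=\sum_{i=0}^r\binom ri(-1)^{r-i}f(x-rh/2+ih)$ if $x\pm rh/2\in[-1,1]$, and $0$ otherwise. Modulus: $\omega_\varphi^r(f,t)_{p,v}=\sup_{0<h\le t}\|\Delta_{h\varphi(\cdot)}^r(f,\cdot)\|_{p,v}$.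 *)

theory Defs
  imports "HOL-Analysis.Analysis" "HOL-Computational_Algebra.Polynomial"
begin

text \<open>
  A weight on \<open>[-1,1]\<close>, extended by \<open>0\<close>, is a function on the real line that vanishes
  outside \<open>[-1,1]\<close>. In the last conjunct the interval \<open>I\<close> is \<open>[a,b]\<close>; the interval of
  integration on the left is \<open>2I\<close>, which may stick out of \<open>[-1,1]\<close>.
\<close>

definition doubling_weight :: "(real \<Rightarrow> real) \<Rightarrow> real \<Rightarrow> bool" where
  "doubling_weight w L \<longleftrightarrow>
     (\<forall>x. 0 \<le> w x) \<and>
     (\<forall>x. x \<notin> {-1..1} \<longrightarrow> w x = 0) \<and>
     set_integrable lebesgue {-1..1} w \<and>
     (\<forall>a b. -1 \<le> a \<and> a < b \<and> b \<le> 1 \<longrightarrow>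
        (LINT u:{(a + b) / 2 - (b - a)..(a + b) / 2 + (b - a)}|lebesgue. w u)
          \<le> L * (LINT u:{a..b}|lebesgue. w u))"

definition phi :: "real \<Rightarrow> real" where
  "phi x = sqrt (1 - x\<^sup>2)"

definition rho :: "nat \<Rightarrow> real \<Rightarrow> real" where
  "rho n x = sqrt (1 - x\<^sup>2) / real n + 1 / (real n)\<^sup>2"

definition wavg :: "(real \<Rightarrow> real) \<Rightarrow> nat \<Rightarrow> real \<Rightarrow> real" where
  "wavg w n x = (1 / rho n x) * (LINT u:{x - rho n x..x + rho n x}|lebesgue. w u)"

definition in_Lp :: "real \<Rightarrow> (real \<Rightarrow> real) \<Rightarrow> bool" where
  "in_Lp p f \<longleftrightarrow>
     f \<in> borel_measurable (lebesgue_on {-1..1}) \<and>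
     integrable (lebesgue_on {-1..1}) (\<lambda>x. \<bar>f x\<bar> powr p)"

text \<open>
  Quasi-norms, best approximation errors and moduli take values in \<open>[0,\<infinity>]\<close>, so that divergent
  integrals and unbounded suprema are \<open>\<infinity>\<close> rather than an arbitrary real number.
  The exponent below is meant to be positive.
\<close>

definition ennpowr :: "ennreal \<Rightarrow> real \<Rightarrow> ennreal" where
  "ennpowr x a = (if x = \<infinity> then \<infinity> else ennreal (enn2real x powr a))"

definition wnorm :: "real \<Rightarrow> (real \<Rightarrow> real) \<Rightarrow> (real \<Rightarrow> real) \<Rightarrow> ennreal" where
  "wnorm p v g =
     ennpowr (\<integral>\<^sup>+ x. ennreal (\<bar>g x\<bar> powr p * v x) \<partial>lebesgue_on {-1..1}) (1 / p)"

definition best_approx :: "nat \<Rightarrow> real \<Rightarrow> (real \<Rightarrow> real) \<Rightarrow> (real \<Rightarrow> real) \<Rightarrow> ennreal" where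
  "best_approx n p v f =
     (INF P \<in> {P :: real poly. degree P \<le> n - 1}. wnorm p v (\<lambda>x. f x - poly P x))"

definition sym_diff :: "nat \<Rightarrow> real \<Rightarrow> (real \<Rightarrow> real) \<Rightarrow> real \<Rightarrow> real" where
  "sym_diff r h f x =
     (if x - real r * h / 2 \<in> {-1..1} \<and> x + real r * h / 2 \<in> {-1..1}
      then \<Sum>i=0..r. real (r choose i) * (- 1) ^ (r - i) * f (x - real r * h / 2 + real i * h)
      else 0)"

definition modulus ::
  "nat \<Rightarrow> (real \<Rightarrow> real) \<Rightarrow> real \<Rightarrow> real \<Rightarrow> (real \<Rightarrow> real) \<Rightarrow> ennreal" where
  "modulus r f t p v = (SUP h \<in> {0<..t}. wnorm p v (\<lambda>x. sym_diff r (h * phi x) f x))"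

end

theory Submission
  imports Defs
begin

text \<open>
  With \<open>P_j\<close> a nearly best approximation of degree below \<open>2 ^ j\<close>, telescope
  \<open>f = (f - P_J) + (P_J - P_(J-1)) + \<dots> + P_0\<close>, where \<open>2 ^ J \<le> n < 2 ^ (J + 1)\<close>. The first term is handled by
  the substitution \<open>x \<mapsto> x + c * phi x\<close>, whose derivative is at least \<open>1 / 2\<close> wherever the difference is
  not zero by convention, and \<open>\<bar>\<cdot>\<bar> powr p\<close> is subadditive. For a polynomial \<open>Q\<close> of degree at most \<open>m\<close> the
  difference at \<open>x\<close> is estimated by the maximum of \<open>\<bar>Q\<bar>\<close> on a complex disc around \<open>x\<close> of radius comparable to
  \<open>rho m x\<close>. The Joukowski substitution and multiplication by a power of a normalised geometric sum turn
  this maximum, via a Nikolskii inequality on the unit circle, into an average of \<open>\<bar>Q\<bar> powr p\<close> against a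
  kernel decaying as fast as desired in \<open>\<bar>x - u\<bar> / rho m u\<close>. Since \<open>w_m\<close> varies at most polynomially in
  that quantity, Tonelli's theorem gives the weighted estimate with the factor \<open>(m / n) powr (r * p - 1)\<close>,
  and the sum over the dyadic levels is compared with the sum over all degrees.
\<close>

section \<open>Finite differences of polynomials\<close>

text \<open>For \<open>p < 1\<close> Minkowski's inequality and duality fail, so the smoothness of
  polynomials enters as a pointwise bound with the power \<open>p\<close> already inside an
  integral; exchanging two integrals then suffices. The obstacle is that \<open>wavg w n\<close> and
  \<open>wavg w m\<close> are not comparable when \<open>m\<close> is much smaller than
  \<open>n\<close>: the first may be larger by \<open>rho m x / rho n x\<close>. With \<tau> =
  \<open>phi x / (n * rho m x)\<close> a difference of order \<open>r\<close> gains
  \<open>\<tau> powr (r * p)\<close>, the change of weight costs at most \<open>1 / \<tau>\<close>,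
  and \<tau> is at most \<open>m / n\<close>. This is the origin of the exponent
  \<open>r * p - 1\<close>, which is positive because \<open>r > 1 / p\<close>; since a dyadic block
  has about \<open>2 ^ j\<close> members, the same exponent becomes \<open>r * p - 2\<close> in the
  sum over all degrees. Three parameters recur. \<open>D\<close> is a growth exponent of the weight,
  with \<open>L^2\<close> at most \<open>2 ^ D\<close>. The kernel power \<open>s\<close> satisfies
  \<open>s * p \<ge> D + 3\<close>, which beats the growth \<open>D + 1\<close> of the averages and
  leaves an integrable square. The step constant decreases with \<open>s\<close>, because the
  multiplier must stay bounded below at the preimages of a whole disc around
  \<open>x\<close>.\<close>

lemma powr_add_le_add_powr:
  fixes a b p :: real
  assumes "0 \<le> a" "0 \<le> b" "0 < p" "p \<le> 1"
  shows "(a + b) powr p \<le> a powr p + b powr p"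
proof (cases "a + b = 0")
  case True
  then show ?thesis using assms by auto
next
  case False
  define s where "s = a + b"
  have s: "s > 0" using False assms by (simp add: s_def)
  \<comment> \<open>After scaling to total 1, a number in [0,1] is at most its own power
    \<open>p\<close>.\<close>
  have *: "x / s \<le> (x / s) powr p" if "0 \<le> x" "x \<le> s" for x
  proof (cases "x = 0")
    case False
    have "(x / s) powr 1 \<le> (x / s) powr p"
      using that s False assms by (intro powr_mono') auto
    then show ?thesis using that s by simp
  qed simp
  have "1 = a / s + b / s" using s by (simp add: s_def add_divide_distrib [symmetric])
  also have "\<dots> \<le> (a / s) powr p + (b / s) powr p"
    using assms by (intro add_mono *) (auto simp: s_def)
  finally have "s powr p * 1 \<le> s powr p * ((a / s) powr p + (b / s) powr p)"
    by (intro mult_left_mono) auto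
  also have "\<dots> = a powr p + b powr p"
    using s assms by (simp add: powr_divide field_simps)
  finally show ?thesis by (simp add: s_def)
qed

lemma powr_abs_sum_le:
  fixes f :: "'a \<Rightarrow> real"
  assumes "finite A" "0 < p" "p \<le> 1"
  shows "\<bar>\<Sum>i\<in>A. f i\<bar> powr p \<le> (\<Sum>i\<in>A. \<bar>f i\<bar> powr p)"
  using assms(1)
proof (induction A rule: finite_induct)
  case (insert x A)
  have "\<bar>\<Sum>i\<in>insert x A. f i\<bar> powr p \<le> (\<bar>f x\<bar> + \<bar>\<Sum>i\<in>A. f i\<bar>) powr p"
    using insert assms by (intro powr_mono2) auto
  also have "\<dots> \<le> \<bar>f x\<bar> powr p + \<bar>\<Sum>i\<in>A. f i\<bar> powr p"
    using assms by (intro powr_add_le_add_powr) auto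
  finally show ?case using insert by simp
qed (use assms in auto)

lemma degree_shift_diff_less:
  fixes q :: "'a::idom poly"
  assumes "degree q > 0"
  shows "degree (pcompose q [:h, 1:] - q) < degree q"
proof (cases "h = 0")
  case True
  then show ?thesis using assms by (simp add: pcompose_idR)
next
  case False
  let ?q = "pcompose q [:h, 1:]"
  have d: "degree ?q = degree q" by (simp add: degree_pcompose)
  have l: "lead_coeff ?q = lead_coeff q" by (subst lead_coeff_comp) auto
  have "coeff (?q - q) (degree q) = 0" using l d by simp
  moreover have "degree (?q - q) \<le> degree q"
    using degree_diff_le[of ?q "degree q" q] d by simp
  ultimately show ?thesis
    using assms by (metis degree_0 le_neq_implies_less leading_coeff_0_iff)
qed

text \<open>Pascal's rule splits every coefficient, and the two halves are differences of order
  \<open>r\<close> of the shifted and of the original sequence.\<close>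

lemma binomial_diff_Suc:
  fixes f :: "nat \<Rightarrow> 'a::comm_ring_1"
  shows "(\<Sum>i=0..Suc r. of_nat (Suc r choose i) * (-1)^(Suc r - i) * f i) =
         (\<Sum>i=0..r. of_nat (r choose i) * (-1)^(r - i) * (f (Suc i) - f i))"
proof -
  have "(\<Sum>i=0..Suc r. of_nat (Suc r choose i) * (-1)^(Suc r - i) * f i) =
        (-1)^(Suc r) * f 0 + (\<Sum>i=0..r. of_nat (Suc r choose Suc i) * (-1)^(r - i) * f (Suc i))"
    by (subst sum.atLeast0_atMost_Suc_shift) simp
  also have "(\<Sum>i=0..r. of_nat (Suc r choose Suc i) * (-1)^(r - i) * f (Suc i)) =
     (\<Sum>i=0..r. of_nat (r choose i) * (-1)^(r - i) * f (Suc i)) +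
     (\<Sum>i=0..r. of_nat (r choose Suc i) * (-1)^(r - i) * f (Suc i))"
    by (simp add: sum.distrib[symmetric] algebra_simps)
  also have "(\<Sum>i=0..r. of_nat (r choose Suc i) * (-1)^(r - i) * f (Suc i)) =
     (\<Sum>i=0..Suc r. of_nat (r choose i) * (-1)^(Suc r - i) * f i) - (-1)^(Suc r) * f 0"
    by (subst sum.atLeast0_atMost_Suc_shift) simp
  also have "(\<Sum>i=0..Suc r. of_nat (r choose i) * (-1)^(Suc r - i) * f i) =
     (\<Sum>i=0..r. of_nat (r choose i) * (-1)^(Suc r - i) * f i)"
    by (simp add: binomial_eq_0)
  also have "\<dots> = - (\<Sum>i=0..r. of_nat (r choose i) * (-1)^(r - i) * f i)"
    by (subst sum_negf[symmetric], rule sum.cong) (auto simp: Suc_diff_le)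
  finally show ?thesis by (simp add: sum_subtractf algebra_simps)
qed

text \<open>Each first difference lowers the degree, so the last ones act on a constant. An
  arbitrary integral domain is allowed since complex monomials and real constants both
  occur.\<close>

lemma binomial_diff_poly_eq_0:
  fixes q :: "'a::idom poly"
  assumes "degree q < r"
  shows "(\<Sum>i=0..r. of_nat (r choose i) * (-1)^(r - i) * poly q (a + of_nat i * h)) = 0"
  using assms
proof (induction r arbitrary: q)
  case (Suc r)
  let ?q = "pcompose q [:h, 1:] - q"
  have eq: "poly q (a + of_nat (Suc i) * h) - poly q (a + of_nat i * h) = poly ?q (a + of_nat i * h)" for i
    by (simp add: poly_pcompose algebra_simps)
  have "(\<Sum>i=0..Suc r. of_nat (Suc r choose i) * (-1)^(Suc r - i) * poly q (a + of_nat i * h)) =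
        (\<Sum>i=0..r. of_nat (r choose i) * (-1)^(r - i) * poly ?q (a + of_nat i * h))"
    by (subst binomial_diff_Suc) (simp only: eq)
  also have "\<dots> = 0"
  proof (cases "degree q = 0")
    case True
    then obtain c where "q = [:c:]" by (metis degree_eq_zeroE)
    then have "?q = 0" by simp
    then show ?thesis by simp
  next
    case False
    then show ?thesis using degree_shift_diff_less[of q h] Suc.prems by (intro Suc.IH) simp
  qed
  finally show ?case .
qed simp

section \<open>Coefficient bounds from orthogonality on the unit circle\<close>

lemma integral_cis_power:
  fixes n :: int
  assumes "n \<noteq> 0"
  shows "(LINT t:{-pi..pi}|lborel. cis (of_int n * t)) = 0"
proof -
  have "(LINT t:{-pi..pi}|lborel. cis (of_int n * t)) =
        cis (of_int n * pi) / (\<i> * of_int n) - cis (of_int n * (-pi)) / (\<i> * of_int n)"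
    unfolding set_lebesgue_integral_def
  proof (rule integral_FTC_Icc)
    show "continuous_on {-pi..pi} (\<lambda>t. cis (of_int n * t))"
      by (intro continuous_intros)
    fix t :: real
    have "((\<lambda>z. exp (\<i> * of_int n * z) / (\<i> * of_int n)) has_field_derivative
            exp (\<i> * of_int n * of_real t)) (at (of_real t))"
      using assms by (auto intro!: derivative_eq_intros)
    from has_vector_derivative_real_field[OF this, of "{-pi..pi}"]
    show "((\<lambda>t. cis (of_int n * t) / (\<i> * of_int n)) has_vector_derivative
            cis (of_int n * t)) (at t within {-pi..pi})"
      by (simp add: cis_conv_exp mult_ac)
  qed simp
  also have "cis (of_int n * (-pi)) = cis (of_int n * pi)"
    by (auto simp: complex_eq_iff mult.commute[of _ pi] sin_npi_int)
  finally show ?thesis by simp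
qed

lemma set_integrable_continuous_cis:
  fixes S :: "complex poly"
  shows "set_integrable lborel {-pi..pi} (\<lambda>t. poly S (cis t) * cis (c * t))"
  by (intro borel_integrable_atLeastAtMost' continuous_intros)

lemma coeff_eq_integral:
  fixes S :: "complex poly"
  shows "coeff S k = (LINT t:{-pi..pi}|lborel. poly S (cis t) * cis (- real k * t)) / (2 * pi)"
proof -
  have "(LINT t:{-pi..pi}|lborel. poly S (cis t) * cis (- real k * t)) =
        (LINT t:{-pi..pi}|lborel. \<Sum>j\<le>degree S. coeff S j * cis (of_int (int j - int k) * t))"
  proof -
    have "poly S (cis t) * cis (- real k * t) =
          (\<Sum>j\<le>degree S. coeff S j * cis (of_int (int j - int k) * t))" for t
      by (simp add: poly_altdef sum_distrib_right Complex.DeMoivre cis_mult mult.assoc)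
         (simp add: algebra_simps)
    then show ?thesis by simp
  qed
  also have "\<dots> = (\<Sum>j\<le>degree S. LINT t:{-pi..pi}|lborel. coeff S j * cis (of_int (int j - int k) * t))"
    unfolding set_lebesgue_integral_def scaleR_sum_right
    by (intro Bochner_Integration.integral_sum)
       (auto simp: set_integrable_def[symmetric] intro!: borel_integrable_atLeastAtMost' continuous_intros)
  also have "\<dots> = (\<Sum>j\<le>degree S. if j = k then coeff S k * (2 * pi) else 0)"
  proof (intro sum.cong refl)
    fix j
    show "(LINT t:{-pi..pi}|lborel. coeff S j * cis (of_int (int j - int k) * t)) =
          (if j = k then coeff S k * (2 * pi) else 0)"
    proof (cases "j = k")
      case False
      then show ?thesis using integral_cis_power[of "int j - int k"] by simp
    next
      case True
      then show ?thesis by (simp add: set_lebesgue_integral_def scaleR_conv_of_real)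
    qed
  qed
  also have "\<dots> = coeff S k * (2 * pi)"
    by (auto simp: sum.delta coeff_eq_0)
  finally show ?thesis by simp
qed

text \<open>The mean-value form serves the Nikolskii inequality; its consequence for the maximum is
  Cauchy's estimate in the expansion about a real point.\<close>

lemma norm_coeff_le_integral:
  fixes S :: "complex poly"
  shows "norm (coeff S k) \<le> (LINT t:{-pi..pi}|lborel. norm (poly S (cis t))) / (2 * pi)"
proof -
  have "norm (LINT t:{-pi..pi}|lborel. poly S (cis t) * cis (- real k * t))
      \<le> (LINT t:{-pi..pi}|lborel. norm (poly S (cis t) * cis (- real k * t)))"
    by (rule set_integral_norm_bound[OF set_integrable_continuous_cis])
  then show ?thesis
    by (subst coeff_eq_integral) (simp add: norm_divide norm_mult divide_right_mono)
qed

lemma norm_coeff_le: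
  fixes S :: "complex poly"
  assumes "\<And>z. norm z = 1 \<Longrightarrow> norm (poly S z) \<le> B"
  shows "norm (coeff S k) \<le> B"
proof -
  have "(LINT t:{-pi..pi}|lborel. norm (poly S (cis t))) \<le> (LINT t:{-pi..pi}|lborel. B)"
    by (intro set_integral_mono borel_integrable_atLeastAtMost' continuous_intros) (auto intro: assms)
  also have "\<dots> = 2 * pi * B" by (simp add: set_lebesgue_integral_def)
  finally have "(LINT t:{-pi..pi}|lborel. norm (poly S (cis t))) / (2 * pi) \<le> B"
    by (simp add: field_simps)
  then show ?thesis using norm_coeff_le_integral[of S k] by linarith
qed

abbreviation cpoly :: "real poly \<Rightarrow> complex poly" where
  "cpoly \<equiv> map_poly complex_of_real"

lemma poly_cpoly_of_real: "poly (cpoly Q) (complex_of_real x) = complex_of_real (poly Q x)"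
  by (induction Q) (auto simp: map_poly_pCons)

lemma degree_cpoly: "degree (cpoly Q) = degree Q"
  by (intro degree_map_poly) auto

lemma norm_binomial_diff_monom_le:
  fixes \<tau> :: real
  assumes "0 \<le> \<tau>"
  shows "norm (\<Sum>i=0..r. of_nat (r choose i) * (-1)^(r - i) * complex_of_real ((real i - real r / 2) * \<tau>) ^ k)
         \<le> 2 ^ r * (real r * \<tau> / 2) ^ k"
proof -
  have "norm (\<Sum>i=0..r. of_nat (r choose i) * (-1)^(r - i) * complex_of_real ((real i - real r / 2) * \<tau>) ^ k)
     \<le> (\<Sum>i=0..r. real (r choose i) * (real r * \<tau> / 2) ^ k)"
  proof (intro order_trans[OF norm_sum] sum_mono)
    fix i assume i: "i \<in> {0..r}"
    have "\<bar>real i - real r / 2\<bar> * \<tau> \<le> real r / 2 * \<tau>"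
      using i assms by (intro mult_right_mono) (auto simp: abs_le_iff field_simps)
    then have "\<bar>(real i - real r / 2) * \<tau>\<bar> ^ k \<le> (real r * \<tau> / 2) ^ k"
      using assms by (intro power_mono) (auto simp: abs_mult)
    then show "norm (of_nat (r choose i) * (-1)^(r - i) * complex_of_real ((real i - real r / 2) * \<tau>) ^ k)
      \<le> real (r choose i) * (real r * \<tau> / 2) ^ k"
      by (simp add: norm_mult norm_power mult_left_mono power_abs del: of_real_mult of_real_diff)
  qed
  also have "\<dots> = 2 ^ r * (real r * \<tau> / 2) ^ k"
    using choose_row_sum[of r] unfolding sum_distrib_right[symmetric]
    by (metis atLeast0AtMost of_nat_sum of_nat_power of_nat_numeral)
  finally show ?thesis .
qed

text \<open>Expand \<open>Q\<close> about \<open>x\<close> at scale \<open>R\<close>. Cauchy's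
  estimate bounds every coefficient by \<open>B\<close>, the difference kills all powers below
  \<open>r\<close>, and the others are dominated by a geometric series with ratio
  \<open>r * \<eta> / (2 * R) \<le> 1 / 2\<close>. The maximum on a disc thus replaces any bound on
  derivatives.\<close>

lemma abs_binomial_diff_poly_le:
  fixes Q :: "real poly"
  assumes bound: "\<And>y. norm (y - complex_of_real x) \<le> R \<Longrightarrow> norm (poly (cpoly Q) y) \<le> B"
    and "0 < R" "0 \<le> \<eta>" "real r * \<eta> \<le> R"
  shows "\<bar>\<Sum>i=0..r. real (r choose i) * (-1)^(r - i) * poly Q (x - real r * \<eta> / 2 + real i * \<eta>)\<bar>
         \<le> 2 * 2 ^ r * (real r * \<eta> / (2 * R)) ^ r * B"
proof -
  define g where "g = pcompose (cpoly Q) [:complex_of_real x, complex_of_real R:]"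
  define \<tau> where "\<tau> = \<eta> / R"
  define b where "b = real r * \<tau> / 2"
  have \<tau>: "0 \<le> \<tau>" using assms by (simp add: \<tau>_def)
  have b: "0 \<le> b" "b \<le> 1/2" using assms \<tau> by (auto simp: b_def \<tau>_def field_simps)
  have B: "norm (coeff g k) \<le> B" for k
    by (rule norm_coeff_le) (use assms in \<open>auto simp: g_def poly_pcompose norm_mult intro!: bound\<close>)
  define c where "c = (\<lambda>i. of_nat (r choose i) * (-1)^(r - i) :: complex)"
  define t where "t = (\<lambda>i. complex_of_real ((real i - real r / 2) * \<tau>))"
  define d where "d = (\<lambda>k. \<Sum>i=0..r. c i * t i ^ k)"
  have Qt: "complex_of_real (poly Q (x - real r * \<eta> / 2 + real i * \<eta>)) = poly g (t i)" for i
  proof -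
    have "complex_of_real x + complex_of_real R * t i = complex_of_real (x - real r * \<eta> / 2 + real i * \<eta>)"
      unfolding t_def \<tau>_def using assms(2) by (simp add: field_simps)
    then show ?thesis
      by (simp add: g_def poly_pcompose poly_cpoly_of_real[symmetric] mult.commute[of "t i"] del: of_real_add of_real_diff)
  qed
  have d0: "d k = 0" if "k < r" for k
  proof -
    have "poly (monom 1 k) (complex_of_real (- real r / 2 * \<tau>) + of_nat i * complex_of_real \<tau>) = t i ^ k" for i
      by (simp add: t_def poly_monom algebra_simps)
    with binomial_diff_poly_eq_0[of "monom 1 k :: complex poly" r "complex_of_real (- real r / 2 * \<tau>)" "complex_of_real \<tau>"] that
    show ?thesis by (simp add: d_def c_def degree_monom_eq)
  qed
  have d1: "norm (d k) \<le> 2 ^ r * b ^ k" for k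
    unfolding d_def c_def t_def b_def by (rule norm_binomial_diff_monom_le[OF \<tau>])
  have "complex_of_real (\<Sum>i=0..r. real (r choose i) * (-1)^(r - i) * poly Q (x - real r * \<eta> / 2 + real i * \<eta>))
       = (\<Sum>i=0..r. c i * poly g (t i))"
    by (simp add: Qt[symmetric] c_def)
  also have "\<dots> = (\<Sum>i=0..r. \<Sum>k\<le>degree g. coeff g k * (c i * t i ^ k))"
    by (simp add: poly_altdef sum_distrib_left mult_ac)
  also have "\<dots> = (\<Sum>k\<le>degree g. coeff g k * d k)"
    by (subst sum.swap) (simp add: d_def sum_distrib_left)
  finally have "norm (complex_of_real (\<Sum>i=0..r. real (r choose i) * (-1)^(r - i) *
      poly Q (x - real r * \<eta> / 2 + real i * \<eta>))) = norm (\<Sum>k\<le>degree g. coeff g k * d k)"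
    by (rule arg_cong)
  then have *: "\<bar>\<Sum>i=0..r. real (r choose i) * (-1)^(r - i) * poly Q (x - real r * \<eta> / 2 + real i * \<eta>)\<bar>
      = norm (\<Sum>k\<le>degree g. coeff g k * d k)"
    by (simp only: norm_of_real)
  have B0: "0 \<le> B" using B[of 0] norm_ge_zero order_trans by blast
  have "norm (\<Sum>k\<le>degree g. coeff g k * d k) \<le> (\<Sum>k\<le>degree g. if k < r then 0 else B * (2 ^ r * b ^ k))"
    using d0 d1 B B0 by (intro order_trans[OF norm_sum] sum_mono) (auto simp: norm_mult intro!: mult_mono)
  \<comment> \<open>The range is lengthened by \<open>r\<close> so that it can be split at
    \<open>r\<close> even when \<open>degree g < r\<close>.\<close>
  also have "\<dots> \<le> (\<Sum>k=0..<r + Suc (degree g). if k < r then 0 else B * (2 ^ r * b ^ k))"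
    using b B0 by (intro sum_mono2) auto
  also have "\<dots> = (\<Sum>k=0..<Suc (degree g). B * (2 ^ r * b ^ (k + r)))"
  proof -
    have split: "sum F {0..<r + n} = sum F {0..<r} + (\<Sum>k=0..<n. F (k + r))" for F :: "nat \<Rightarrow> real" and n
      using sum.atLeastLessThan_concat[of 0 r "r + n" F] sum.shift_bounds_nat_ivl[of F 0 r n]
      by (simp add: add.commute)
    show ?thesis by (subst split) (simp del: sum.op_ivl_Suc)
  qed
  also have "\<dots> = B * 2 ^ r * b ^ r * (\<Sum>k<Suc (degree g). b ^ k)"
    by (simp add: sum_distrib_left power_add mult_ac lessThan_atLeast0 del: sum.op_ivl_Suc sum.lessThan_Suc)
  also have "\<dots> \<le> B * 2 ^ r * b ^ r * 2"
  proof (rule mult_left_mono)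
    have "(\<Sum>k<Suc (degree g). b ^ k) \<le> (\<Sum>k<Suc (degree g). (1/2) ^ k)"
      using b by (intro sum_mono power_mono) auto
    also have "\<dots> \<le> 2"
      by (subst geometric_sum) (auto simp: field_simps)
    finally show "(\<Sum>k<Suc (degree g). b ^ k) \<le> 2" .
  qed (use B0 b in auto)
  also have "\<dots> = 2 * 2 ^ r * (real r * \<eta> / (2 * R)) ^ r * B"
    using assms(2) by (simp add: b_def \<tau>_def mult_ac)
  finally show ?thesis unfolding * .
qed

section \<open>A Nikolskii inequality on the unit circle\<close>

lemma pow_one_plus_inverse_le:
  fixes N k :: nat
  assumes "1 \<le> N" "k \<le> N"
  shows "(1 + 1 / real N) ^ k \<le> (3::real)"
proof -
  have "(1 + 1 / real N) ^ k \<le> (1 + 1 / real N) ^ N"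
    using assms by (intro power_increasing) auto
  also have "\<dots> \<le> exp (1 / real N) ^ N"
    by (intro power_mono exp_ge_add_one_self) auto
  also have "\<dots> = exp 1" using assms by (simp flip: exp_of_nat_mult)
  also have "\<dots> \<le> 3" by (rule exp_le)
  finally show ?thesis .
qed

text \<open>There are at most \<open>N + 1 \<le> 2 * N\<close> coefficients, and the radius
  \<open>1 + 1 / N\<close> costs a factor below 3. The larger disc is needed because preimages of
  non-real points lie off the circle.\<close>

lemma norm_poly_le_integral:
  fixes S :: "complex poly"
  assumes "degree S \<le> N" "1 \<le> N" "norm z \<le> 1 + 1 / real N"
  shows "norm (poly S z) \<le> 3 * real N / pi * (LINT t:{-pi..pi}|lborel. norm (poly S (cis t)))"
proof -
  define I where "I = (LINT t:{-pi..pi}|lborel. norm (poly S (cis t)))"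
  have I: "0 \<le> I" unfolding I_def set_lebesgue_integral_def by (intro Bochner_Integration.integral_nonneg) auto
  have "norm (poly S z) \<le> (\<Sum>k\<le>degree S. norm (coeff S k * z ^ k))"
    unfolding poly_altdef by (rule norm_sum)
  also have "\<dots> \<le> (\<Sum>k\<le>degree S. I / (2 * pi) * 3)"
  proof (rule sum_mono)
    fix k assume "k \<in> {..degree S}"
    then have "norm z ^ k \<le> (1 + 1 / real N) ^ k" "(1 + 1 / real N) ^ k \<le> 3"
      using assms pow_one_plus_inverse_le[of N k] by (auto intro: power_mono)
    then have "norm z ^ k \<le> 3" by simp
    then show "norm (coeff S k * z ^ k) \<le> I / (2 * pi) * 3"
      using norm_coeff_le_integral[of S k] I unfolding norm_mult norm_power I_def[symmetric]
      by (intro mult_mono) auto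
  qed
  also have "\<dots> = (real (degree S) + 1) * (I / (2 * pi) * 3)" by simp
  also have "\<dots> \<le> (2 * real N) * (I / (2 * pi) * 3)"
    using assms I by (intro mult_right_mono) auto
  finally show ?thesis by (simp add: I_def)
qed

definition inner_arc :: "real \<Rightarrow> real set" where
  "inner_arc \<eta> = {t. 2 * \<eta> \<le> \<bar>t\<bar> \<and> \<bar>t\<bar> \<le> pi - 2 * \<eta>}"

lemma inner_arc_borel [measurable]: "inner_arc \<eta> \<in> sets borel"
proof -
  have "closed (inner_arc \<eta>)" unfolding inner_arc_def
    by (intro closed_Collect_conj closed_Collect_le continuous_intros)
  then show ?thesis by simp
qed

lemma abs_sin_ge_inner_arc:
  assumes "t \<in> inner_arc \<eta>" "0 \<le> \<eta>" "\<eta> \<le> 1/2"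
  shows "\<eta> \<le> \<bar>sin t\<bar>"
proof -
  have pi3: "3 < pi" by (rule pi_gt3)
  have *: "\<eta> \<le> sin s" if s: "2 * \<eta> \<le> s" "s \<le> pi / 2" for s
  proof -
    have "2 * \<eta> / 2 \<le> sin (2 * \<eta>)"
    proof (cases "\<eta> = 0")
      case False
      \<comment> \<open>Since \<open>2 * \<eta> \<le> 1 < pi / 3\<close>, the cosine in the mean
        value theorem is at least 1/2.\<close>
      obtain c where c: "0 < c" "c < 2 * \<eta>" "sin (2 * \<eta>) - sin 0 = (2 * \<eta> - 0) * cos c"
        using MVT2[of 0 "2 * \<eta>" sin cos] False assms by (auto intro: derivative_eq_intros)
      have "cos (pi / 3) \<le> cos c" using c assms pi3 by (intro cos_monotone_0_pi_le) auto
      then show ?thesis using c assms by (simp add: cos_60 field_simps)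
    qed simp
    also have "sin (2 * \<eta>) \<le> sin s" using s assms pi3 by (intro sin_monotone_2pi_le) auto
    finally show ?thesis by simp
  qed
  have "\<eta> \<le> sin \<bar>t\<bar>"
  proof (cases "\<bar>t\<bar> \<le> pi / 2")
    case True
    then show ?thesis using * assms by (auto simp: inner_arc_def)
  next
    case False
    then have "\<eta> \<le> sin (pi - \<bar>t\<bar>)" using assms by (intro *) (auto simp: inner_arc_def)
    then show ?thesis by simp
  qed
  then show ?thesis by (auto simp: abs_if split: if_splits)
qed

text \<open>
  The real points of the circle can be left out of the integral because their neighbourhoods have small
  measure, so that their contribution is absorbed by the left-hand side. This is needed since near the
  endpoints the measure \<open>du / rho m u\<close> with \<open>u = cos t\<close> is much smaller than \<open>m dt\<close>.
\<close>

lemma nikolskii_circle: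
  fixes S :: "complex poly" and p :: real
  assumes "degree S \<le> N" "1 \<le> N" "norm z \<le> 1 + 1 / real N" and p: "0 < p" "p \<le> 1"
  shows "ennreal (norm (poly S z) powr p) \<le> ennreal (2 * real N) *
           (\<integral>\<^sup>+t\<in>inner_arc (1 / (16 * real N)). ennreal (norm (poly S (cis t)) powr p) \<partial>lborel)"
proof -
  let ?D = "cball 0 (1 + 1 / real N) :: complex set"
  have "0 \<le> 1 + 1 / real N" by (intro add_nonneg_nonneg) auto
  then have "?D \<noteq> {}" by (metis centre_in_cball empty_iff)
  \<comment> \<open>The maximum is taken over the whole disc so that it dominates \<open>z\<close>
    and the circle alike: \<open>M powr (1 - p)\<close> can then be pulled out of the mean of the
    modulus and cancelled at the end.\<close>
  then have "\<exists>z0\<in>?D. \<forall>z\<in>?D. norm (poly S z) \<le> norm (poly S z0)"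
    by (intro continuous_attains_sup continuous_intros compact_cball)
  then obtain z0 where z0: "norm z0 \<le> 1 + 1 / real N"
      and max: "\<And>z. norm z \<le> 1 + 1 / real N \<Longrightarrow> norm (poly S z) \<le> norm (poly S z0)"
    by auto
  define M where "M = norm (poly S z0)"
  have M0: "0 \<le> M" by (simp add: M_def)
  \<comment> \<open>The omitted parameters have total length \<open>8 * \<eta>\<close>, on which the
    modulus is at most \<open>M\<close>; multiplied by \<open>N\<close> this contributes exactly
    \<open>M / 2\<close>.\<close>
  define \<eta> where "\<eta> = 1 / (16 * real N)"
  have \<eta>: "0 < \<eta>" "\<eta> \<le> 1/16" using assms by (auto simp: \<eta>_def field_simps)
  define X where "X = (\<integral>\<^sup>+t\<in>inner_arc \<eta>. ennreal (norm (poly S (cis t)) powr p) \<partial>lborel)"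
  have meas [measurable]: "(\<lambda>t. poly S (cis t)) \<in> borel_measurable borel"
    by (intro borel_measurable_continuous_onI continuous_intros)
  define I where "I = (LINT t:{-pi..pi}|lborel. norm (poly S (cis t)))"
  have I: "0 \<le> I" unfolding I_def set_lebesgue_integral_def by (intro Bochner_Integration.integral_nonneg) auto
  have bM: "norm (poly S (cis t)) \<le> M" for t unfolding M_def by (rule max) simp
  have split_le: "norm (poly S (cis t)) \<le> M powr (1 - p) * norm (poly S (cis t)) powr p" for t
  proof (cases "poly S (cis t) = 0")
    case False
    let ?a = "norm (poly S (cis t))"
    have "?a = ?a powr (1 - p) * ?a powr p" using False by (simp flip: powr_add)
    also have "\<dots> \<le> M powr (1 - p) * ?a powr p"
      using bM p by (intro mult_right_mono powr_mono2) auto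
    finally show ?thesis .
  qed simp
  have "ennreal I = (\<integral>\<^sup>+t. ennreal (indicator {-pi..pi} t * norm (poly S (cis t))) \<partial>lborel)"
    unfolding I_def set_lebesgue_integral_def
    by (subst nn_integral_eq_integral)
       (auto intro!: borel_integrable_compact continuous_intros simp flip: real_scaleR_def,
        auto simp: indicator_def)
  also have "\<dots> \<le> (\<integral>\<^sup>+t. ennreal (M powr (1 - p)) * (ennreal (norm (poly S (cis t)) powr p) * indicator (inner_arc \<eta>) t)
      + ennreal M * (indicator {-pi..-pi+2*\<eta>} t + indicator {-2*\<eta>..2*\<eta>} t + indicator {pi-2*\<eta>..pi} t) \<partial>lborel)"
  proof (intro nn_integral_mono)
    fix t :: real
    consider "t \<notin> {-pi..pi}" | "t \<in> inner_arc \<eta>" |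
       "t \<in> {-pi..-pi+2*\<eta>} \<union> {-2*\<eta>..2*\<eta>} \<union> {pi-2*\<eta>..pi}"
    proof -
      have "(t < -pi \<or> pi < t) \<or> (2 * \<eta> \<le> \<bar>t\<bar> \<and> \<bar>t\<bar> \<le> pi - 2 * \<eta>) \<or>
          (-pi \<le> t \<and> t \<le> -pi+2*\<eta>) \<or> (-2*\<eta> \<le> t \<and> t \<le> 2*\<eta>) \<or> (pi-2*\<eta> \<le> t \<and> t \<le> pi)"
        by linarith
      then show thesis using that by (auto simp: inner_arc_def)
    qed
    then show "ennreal (indicator {-pi..pi} t * norm (poly S (cis t))) \<le>
       ennreal (M powr (1 - p)) * (ennreal (norm (poly S (cis t)) powr p) * indicator (inner_arc \<eta>) t)
      + ennreal M * (indicator {-pi..-pi+2*\<eta>} t + indicator {-2*\<eta>..2*\<eta>} t + indicator {pi-2*\<eta>..pi} t)"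
    proof cases
      case 2
      have "ennreal (indicator {-pi..pi} t * norm (poly S (cis t))) \<le> ennreal (M powr (1 - p) * norm (poly S (cis t)) powr p)"
        using split_le[of t] by (intro ennreal_leI) (auto split: split_indicator)
      also have "\<dots> = ennreal (M powr (1 - p)) * (ennreal (norm (poly S (cis t)) powr p) * indicator (inner_arc \<eta>) t)"
        using 2 by (simp add: ennreal_mult)
      finally show ?thesis by (rule add_increasing2[OF zero_le])
    next
      case 3
      then have "1 \<le> (indicator {-pi..-pi+2*\<eta>} t + indicator {-2*\<eta>..2*\<eta>} t + indicator {pi-2*\<eta>..pi} t :: ennreal)"
        by (auto simp: indicator_def)
      then have "ennreal M * 1 \<le> ennreal M * (indicator {-pi..-pi+2*\<eta>} t + indicator {-2*\<eta>..2*\<eta>} t + indicator {pi-2*\<eta>..pi} t)"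
        by (rule mult_left_mono) simp
      moreover have "ennreal (indicator {-pi..pi} t * norm (poly S (cis t))) \<le> ennreal M"
        using bM[of t] M0 by (intro ennreal_leI) (auto split: split_indicator)
      ultimately show ?thesis by (intro add_increasing[OF zero_le]) simp
    qed simp
  qed
  also have "\<dots> = ennreal (M powr (1 - p)) * X + ennreal M * (ennreal (2*\<eta>) + ennreal (4*\<eta>) + ennreal (2*\<eta>))"
    unfolding X_def using \<eta> by (simp add: nn_integral_add nn_integral_cmult)
  also have "ennreal M * (ennreal (2*\<eta>) + ennreal (4*\<eta>) + ennreal (2*\<eta>)) = ennreal (M * (8 * \<eta>))"
  proof -
    have "ennreal (2*\<eta>) + ennreal (4*\<eta>) = ennreal (2*\<eta> + 4*\<eta>)"
      using \<eta> by (intro ennreal_plus[symmetric]) auto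
    moreover have "ennreal (2*\<eta> + 4*\<eta>) + ennreal (2*\<eta>) = ennreal (2*\<eta> + 4*\<eta> + 2*\<eta>)"
      using \<eta> by (intro ennreal_plus[symmetric]) auto
    moreover have "2*\<eta> + 4*\<eta> + 2*\<eta> = 8 * \<eta>" by simp
    ultimately show ?thesis using M0 \<eta> by (simp only: ennreal_mult)
  qed
  finally have IX: "ennreal I \<le> ennreal (M powr (1 - p)) * X + ennreal (M * (8 * \<eta>))" .
  have N0: "real N > 0" using assms by simp
  have main: "ennreal (M powr p) \<le> ennreal (2 * real N) * X"
  proof (cases "X = \<infinity>")
    case True
    then show ?thesis using N0 by (simp add: ennreal_mult_top)
  next
    case False
    then obtain x where x: "X = ennreal x" "0 \<le> x" by (cases X) auto
    have "ennreal I \<le> ennreal (M powr (1 - p) * x + M * (8 * \<eta>))"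
      using IX x M0 \<eta> by (simp add: ennreal_mult ennreal_plus)
    then have I2: "I \<le> M powr (1 - p) * x + M * (8 * \<eta>)"
      using x M0 \<eta> by (subst (asm) ennreal_le_iff) auto
    have "M \<le> 3 * real N / pi * I"
      unfolding M_def I_def using norm_poly_le_integral[OF assms(1,2) z0] .
    also have "\<dots> \<le> real N * I"
      using I pi_gt3 N0 by (intro mult_right_mono) (auto simp: field_simps)
    also have "\<dots> \<le> real N * (M powr (1 - p) * x + M * (8 * \<eta>))"
      using I2 N0 by (intro mult_left_mono) auto
    also have "\<dots> = real N * (M powr (1 - p) * x) + M / 2"
      using N0 by (simp add: \<eta>_def field_simps)
    finally have le: "M \<le> 2 * real N * x * M powr (1 - p)" by (simp add: field_simps)
    have "M powr p \<le> 2 * real N * x"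
    proof (cases "M = 0")
      case False
      then have "M > 0" using M0 by simp
      then have "M powr p * M powr (1 - p) \<le> 2 * real N * x * M powr (1 - p)"
        using le by (simp flip: powr_add)
      then show ?thesis using \<open>M > 0\<close> by (simp add: mult_le_cancel_right)
    qed (use x N0 in auto)
    then show ?thesis using x N0 by (simp add: ennreal_leI flip: ennreal_mult)
  qed
  have "ennreal (norm (poly S z) powr p) \<le> ennreal (M powr p)"
    unfolding M_def using max[OF assms(3)] p by (intro ennreal_leI powr_mono2) auto
  also note main
  finally show ?thesis by (simp add: X_def \<eta>_def)
qed

section \<open>The Joukowski map and the decaying kernel\<close>

text \<open>Horner's scheme: each multiplication by \<open>(z + 1 / z) / 2\<close> consumes one
  factor \<open>z\<close> and becomes multiplication by the quadratic
  \<open>(1 + z * z) / 2\<close>.\<close>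

lemma exists_joukowski_poly:
  fixes Q :: "complex poly"
  assumes "degree Q \<le> m"
  shows "\<exists>R. degree R \<le> 2 * m \<and> (\<forall>z. z \<noteq> 0 \<longrightarrow> poly R z = z ^ m * poly Q ((z + 1 / z) / 2))"
  using assms
proof (induction Q arbitrary: m)
  case 0
  then show ?case by (intro exI[of _ 0]) auto
next
  case (pCons a Q)
  show ?case
  proof (cases "Q = 0")
    case True
    then show ?thesis
      by (intro exI[of _ "monom a m"]) (auto simp: poly_monom intro: order_trans[OF degree_monom_le])
  next
    case False
    then obtain m' where m': "m = Suc m'" "degree Q \<le> m'"
      using pCons.prems by (cases m) auto
    then obtain R where R: "degree R \<le> 2 * m'" "\<And>z. z \<noteq> 0 \<Longrightarrow> poly R z = z ^ m' * poly Q ((z + 1 / z) / 2)"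
      using pCons.IH by blast
    let ?R = "monom a m + [:1/2, 0, 1/2:] * R"
    have "degree ?R \<le> 2 * m"
    proof (rule degree_add_le)
      show "degree (monom a m) \<le> 2 * m" by (rule order_trans[OF degree_monom_le]) simp
      have "degree ([:1/2, 0, 1/2:] * R) \<le> 2 + degree R"
        by (rule order_trans[OF degree_mult_le]) simp
      then show "degree ([:1/2, 0, 1/2:] * R) \<le> 2 * m" using R m' by simp
    qed
    moreover have "poly ?R z = z ^ m * poly (pCons a Q) ((z + 1 / z) / 2)" if "z \<noteq> 0" for z
      using that R(2)[OF that] m' by (simp add: poly_monom field_simps)
    ultimately show ?thesis by blast
  qed
qed

lemma rho_pos: "\<lbrakk>1 \<le> m; \<bar>x\<bar> \<le> 1\<rbrakk> \<Longrightarrow> 0 < rho m x"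
  unfolding rho_def by (intro add_nonneg_pos) (auto simp: abs_square_le_1)

lemma rho_eq_phi: "rho m x = phi x / real m + 1 / (real m)\<^sup>2"
  by (simp add: rho_def phi_def)

lemma phi_nonneg: "\<bar>x\<bar> \<le> 1 \<Longrightarrow> 0 \<le> phi x"
  by (simp add: phi_def abs_square_le_1)

lemma phi_sq: "\<bar>x\<bar> \<le> 1 \<Longrightarrow> (phi x)\<^sup>2 = 1 - x\<^sup>2"
  by (simp add: phi_def abs_square_le_1)

text \<open>The preimages of \<open>y\<close> are the roots of a quadratic, and the product of their
  distances to the point above \<open>x\<close> is \<open>2 * norm (y - x)\<close>. If
  \<open>phi x \<le> 1 / m\<close>, the smaller distance is at most the square root of this.
  Otherwise the sum of the roots forces the farther one to distance at least
  \<open>phi x / 2\<close>, and dividing by it bounds the nearer one.\<close>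

lemma joukowski_root_close:
  fixes \<zeta>1 \<zeta>2 y :: complex
  assumes x: "\<bar>x\<bar> \<le> 1" and m: "1 \<le> m" and b: "0 < b" "b \<le> 1/4"
    and y: "norm (y - of_real x) \<le> b\<^sup>2 / 16 * rho m x"
    and \<zeta>: "\<zeta>1 + \<zeta>2 = 2 * y" "\<zeta>1 * \<zeta>2 = 1"
    and le: "norm (\<zeta>1 - Complex x (phi x)) \<le> norm (\<zeta>2 - Complex x (phi x))"
  shows "norm (\<zeta>1 - Complex x (phi x)) \<le> b / real m"
proof -
  define \<zeta>0 where "\<zeta>0 = Complex x (phi x)"
  define \<delta> where "\<delta> = norm (\<zeta>1 - \<zeta>0)"
  define d2 where "d2 = norm (\<zeta>2 - \<zeta>0)"
  define q where "q = norm (y - of_real x)"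
  have pos: "0 \<le> \<delta>" "0 \<le> q" "\<delta> \<le> d2" using le by (auto simp: \<delta>_def d2_def q_def \<zeta>0_def)
  have m0: "1 \<le> real m" using m by simp
  have \<zeta>0: "\<zeta>0\<^sup>2 + 1 = 2 * of_real x * \<zeta>0"
    using phi_sq[OF x] by (simp add: \<zeta>0_def complex_eq_iff power2_eq_square algebra_simps)
  have n0: "norm \<zeta>0 = 1" using phi_sq[OF x] by (simp add: \<zeta>0_def cmod_def)
  have "(\<zeta>1 - \<zeta>0) * (\<zeta>2 - \<zeta>0) = \<zeta>1 * \<zeta>2 - (\<zeta>1 + \<zeta>2) * \<zeta>0 + \<zeta>0\<^sup>2"
    by (simp add: algebra_simps power2_eq_square)
  also have "\<dots> = (\<zeta>0\<^sup>2 + 1) - 2 * y * \<zeta>0" unfolding \<zeta> by simp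
  also have "\<dots> = 2 * (of_real x - y) * \<zeta>0" unfolding \<zeta>0 by (simp add: algebra_simps)
  finally have "norm ((\<zeta>1 - \<zeta>0) * (\<zeta>2 - \<zeta>0)) = norm (2 * (of_real x - y) * \<zeta>0)" by (rule arg_cong)
  also have "\<dots> = 2 * q"
    by (simp only: norm_mult) (simp add: n0 q_def norm_minus_commute)
  finally have "norm ((\<zeta>1 - \<zeta>0) * (\<zeta>2 - \<zeta>0)) = 2 * q" .
  then have prod: "\<delta> * d2 = 2 * q" by (simp add: norm_mult \<delta>_def d2_def)
  have b2: "b\<^sup>2 \<le> b / 4" using b by (simp add: power2_eq_square mult_left_mono)
  have "\<delta> \<le> b / real m"
  proof (cases "phi x \<le> 1 / real m")
    case True
    have "\<delta>\<^sup>2 \<le> 2 * q" using prod pos mult_left_mono[of \<delta> d2 \<delta>] by (simp add: power2_eq_square)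
    also have "\<dots> \<le> 2 * (b\<^sup>2 / 16 * (2 / (real m)\<^sup>2))"
    proof -
      have "rho m x \<le> (1 / real m) / real m + 1 / (real m)\<^sup>2"
        unfolding rho_eq_phi using True by (intro add_mono divide_right_mono) auto
      then have "b\<^sup>2 / 16 * rho m x \<le> b\<^sup>2 / 16 * (2 / (real m)\<^sup>2)"
        by (intro mult_left_mono) (auto simp: power2_eq_square)
      then show ?thesis using y by (simp add: q_def)
    qed
    also have "\<dots> \<le> (b / real m)\<^sup>2"
      using m0 by (simp add: power_divide) (intro frac_le, auto)
    finally show ?thesis using b m0 by (intro power2_le_imp_le[of \<delta>]) auto
  next
    case False
    have phi0: "0 < phi x" using False m0 by (auto intro: less_le_trans[of 0 "1 / real m"])
    have "1 / (real m)\<^sup>2 \<le> phi x / real m"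
      using False m0 by (simp add: power2_eq_square field_simps)
    then have "rho m x \<le> 2 * (phi x / real m)" by (simp add: rho_eq_phi)
    then have "b\<^sup>2 / 16 * rho m x \<le> b\<^sup>2 / 16 * (2 * (phi x / real m))"
      by (intro mult_left_mono) auto
    also have "\<dots> = b\<^sup>2 / 8 * (phi x / real m)" by simp
    finally have q1: "q \<le> b\<^sup>2 / 8 * (phi x / real m)" using y unfolding q_def by linarith
    have "phi x / real m \<le> phi x" using m0 phi0 by (simp add: field_simps)
    then have "b\<^sup>2 / 8 * (phi x / real m) \<le> 1/8 * phi x" using b b2 phi0 by (intro mult_mono) auto
    then have q2: "q \<le> phi x / 8" using q1 by linarith
    have "norm (\<zeta>0 - of_real x) = phi x" using phi0 by (simp add: \<zeta>0_def cmod_def)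
    then have "2 * phi x = norm (2 * (\<zeta>0 - of_real x))" by (simp only: norm_mult) simp
    also have "2 * (\<zeta>0 - of_real x) = 2 * (y - of_real x) - (\<zeta>1 - \<zeta>0) - (\<zeta>2 - \<zeta>0)"
      using \<zeta>(1) by (simp add: algebra_simps)
    also have "norm \<dots> \<le> norm (2 * (y - of_real x)) + norm (\<zeta>1 - \<zeta>0) + norm (\<zeta>2 - \<zeta>0)"
      using norm_triangle_ineq4[of "2 * (y - of_real x) - (\<zeta>1 - \<zeta>0)" "\<zeta>2 - \<zeta>0"]
        norm_triangle_ineq4[of "2 * (y - of_real x)" "\<zeta>1 - \<zeta>0"] by linarith
    also have "\<dots> = 2 * q + \<delta> + d2" 
      by (simp only: q_def \<delta>_def d2_def norm_mult) simp
    finally have "phi x / 2 \<le> d2" using q2 pos by linarith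
    then have "\<delta> * (phi x / 2) \<le> 2 * q" using prod pos mult_left_mono[of "phi x / 2" d2 \<delta>] by simp
    also have "\<dots> \<le> b\<^sup>2 / 4 * (phi x / real m)" using q1 by simp
    finally have "\<delta> \<le> b\<^sup>2 / 2 / real m" using phi0 m0 by (simp add: field_simps)
    also have "\<dots> \<le> b / real m" using b2 b m0 by (intro divide_right_mono) auto
    finally show ?thesis .
  qed
  then show ?thesis by (simp add: \<delta>_def \<zeta>0_def)
qed

lemma exists_joukowski_preimage:
  fixes y :: complex
  assumes x: "\<bar>x\<bar> \<le> 1" and m: "1 \<le> m" and b: "0 < b" "b \<le> 1/4"
    and y: "norm (y - of_real x) \<le> b\<^sup>2 / 16 * rho m x"
  shows "\<exists>\<zeta>. norm (\<zeta> - Complex x (phi x)) \<le> b / real m \<and> \<zeta> \<noteq> 0 \<and> (\<zeta> + 1 / \<zeta>) / 2 = y"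
proof -
  define s where "s = csqrt (y\<^sup>2 - 1)"
  have s: "s * s = y\<^sup>2 - 1" using power2_csqrt[of "y\<^sup>2 - 1"] by (simp add: s_def power2_eq_square)
  have prod: "(y + s) * (y - s) = 1" using s by (simp add: algebra_simps power2_eq_square)
  have inv: "1 / (y + s) = y - s" "1 / (y - s) = y + s"
    using prod by (auto simp: divide_eq_eq mult.commute)
  have nz: "y + s \<noteq> 0" "y - s \<noteq> 0" using prod by auto
  show ?thesis
  proof (cases "norm ((y + s) - Complex x (phi x)) \<le> norm ((y - s) - Complex x (phi x))")
    case True
    have "norm ((y + s) - Complex x (phi x)) \<le> b / real m"
      by (rule joukowski_root_close[OF x m b y _ prod True]) simp
    then show ?thesis using nz inv by (intro exI[of _ "y + s"]) auto
  next
    case False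
    have "norm ((y - s) - Complex x (phi x)) \<le> b / real m"
      using False prod by (intro joukowski_root_close[OF x m b y, of "y - s" "y + s"]) (auto simp: mult.commute)
    then show ?thesis using nz inv by (intro exI[of _ "y - s"]) auto
  qed
qed

section \<open>The normalised geometric sum as a kernel\<close>

lemma norm_power_minus_1_le:
  fixes v :: complex
  shows "norm (v ^ j - 1) \<le> (1 + norm (v - 1)) ^ j - 1"
proof (induction j)
  case (Suc j)
  have v: "norm v \<le> 1 + norm (v - 1)" using norm_triangle_ineq[of 1 "v - 1"] by simp
  have "v ^ Suc j - 1 = v * (v ^ j - 1) + (v - 1)" by (simp add: algebra_simps)
  also have "norm \<dots> \<le> norm v * norm (v ^ j - 1) + norm (v - 1)"
    by (metis norm_mult norm_triangle_ineq)
  also have "\<dots> \<le> (1 + norm (v - 1)) * ((1 + norm (v - 1)) ^ j - 1) + norm (v - 1)"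
    using v Suc by (intro add_right_mono mult_mono) auto
  finally show ?case by (simp add: algebra_simps)
qed simp

text \<open>All powers below \<open>m\<close> stay within 1/2 of 1, because
  \<open>(1 + 1 / (4 * m)) ^ m \<le> exp (1 / 4) \<le> 3 / 2\<close>. This bounds the multiplier
  from below near its peak.\<close>

lemma norm_mean_powers_ge:
  fixes v :: complex
  assumes "1 \<le> m" "norm (v - 1) \<le> 1 / (4 * real m)"
  shows "1 / 2 \<le> norm ((\<Sum>j<m. v ^ j) / of_nat m)"
proof -
  have m: "real m > 0" using assms by simp
  have *: "norm (v ^ j - 1) \<le> 1 / 2" if "j < m" for j
  proof -
    have "(1 + norm (v - 1)) ^ j \<le> (1 + 1 / (4 * real m)) ^ j"
      using assms by (intro power_mono) auto
    also have "\<dots> \<le> (1 + 1 / (4 * real m)) ^ m"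
      using that by (intro power_increasing) auto
    also have "\<dots> \<le> exp (1 / (4 * real m)) ^ m"
      by (intro power_mono exp_ge_add_one_self) auto
    also have "\<dots> = exp (1 / 4)" using m by (simp flip: exp_of_nat_mult)
    also have "\<dots> \<le> 1 + 1/4 + (1/4)\<^sup>2" by (rule exp_bound) auto
    also have "\<dots> \<le> 3 / 2" by (simp add: power2_eq_square)
    finally show ?thesis using norm_power_minus_1_le[of v j] by simp
  qed
  have "norm ((\<Sum>j<m. v ^ j) / of_nat m - 1) = norm (\<Sum>j<m. v ^ j - 1) / real m"
    using m by (simp add: sum_subtractf field_simps norm_divide flip: norm_divide) (simp add: norm_divide)
  also have "\<dots> \<le> (\<Sum>j<m. 1 / 2) / real m"
    using * by (intro divide_right_mono order_trans[OF norm_sum] sum_mono) auto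
  also have "\<dots> = 1 / 2" using m by simp
  finally have "norm ((\<Sum>j<m. v ^ j) / of_nat m - 1) \<le> 1 / 2" .
  then show ?thesis
    using norm_triangle_ineq2[of 1 "1 - (\<Sum>j<m. v ^ j) / of_nat m"] by (simp add: norm_minus_commute)
qed

text \<open>The second bound is the closed form of the geometric sum, written as a product so that
  it also covers \<open>v = 1\<close>.\<close>

lemma norm_mean_powers_le:
  fixes v :: complex
  assumes "1 \<le> m" "norm v = 1"
  shows "norm ((\<Sum>j<m. v ^ j) / of_nat m) \<le> 1"
    and "norm ((\<Sum>j<m. v ^ j) / of_nat m) * (real m * norm (v - 1)) \<le> 2"
proof -
  have "norm (\<Sum>j<m. v ^ j) \<le> (\<Sum>j<m. 1)"
    using assms by (intro order_trans[OF norm_sum] sum_mono) (auto simp: norm_power)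
  then show "norm ((\<Sum>j<m. v ^ j) / of_nat m) \<le> 1"
    using assms by (simp add: norm_divide field_simps)
  have "(v - 1) * (\<Sum>j<m. v ^ j) = v ^ m - 1"
    by (simp add: power_diff_1_eq)
  then have "norm (\<Sum>j<m. v ^ j) * norm (v - 1) = norm (v ^ m - 1)"
    by (metis mult.commute norm_mult)
  also have "\<dots> \<le> 2" using norm_triangle_ineq4[of "v ^ m" 1] assms by (simp add: norm_power)
  finally show "norm ((\<Sum>j<m. v ^ j) / of_nat m) * (real m * norm (v - 1)) \<le> 2"
    using assms by (simp add: norm_divide)
qed

lemma exists_kernel_poly:
  fixes w :: complex
  shows "\<exists>G. degree G \<le> m * s \<and> (\<forall>z. poly G z = ((\<Sum>j<m. (z * w) ^ j) / of_nat m) ^ s)"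
proof -
  define H where "H = smult (1 / of_nat m) (\<Sum>j<m. monom (w ^ j) j)"
  have "degree H \<le> m"
    unfolding H_def
    by (intro order_trans[OF degree_smult_le] degree_sum_le order_trans[OF degree_monom_le]) auto
  then have "degree (H ^ s) \<le> m * s"
    by (intro order_trans[OF degree_power_le]) auto
  moreover have "poly (H ^ s) z = ((\<Sum>j<m. (z * w) ^ j) / of_nat m) ^ s" for z
    by (simp add: H_def poly_sum poly_monom power_mult_distrib mult_ac)
  ultimately show ?thesis by blast
qed

text \<open>Here \<open>d\<close> is the chord between the points of the upper half circle above
  \<open>x\<close> and \<open>u\<close>. The half-angle formulas amount to the identity
  \<open>(x - u)^2 * (4 - d^2) = d^2 * (a + b)^2\<close>, and \<open>a \<le> b + d\<close>. For long
  chords the trivial bound \<open>\<bar>x - u\<bar> \<le> 2\<close> is enough.\<close>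

lemma abs_diff_le_chord:
  fixes x u a b d :: real
  assumes x: "\<bar>x\<bar> \<le> 1" "\<bar>u\<bar> \<le> 1" and a: "0 \<le> a" "a\<^sup>2 = 1 - x\<^sup>2" and b: "0 \<le> b" "b\<^sup>2 = 1 - u\<^sup>2"
    and d: "0 \<le> d" "d\<^sup>2 = (x - u)\<^sup>2 + (a - b)\<^sup>2"
  shows "\<bar>x - u\<bar> \<le> d * (2 * b + d)"
proof (cases "2 \<le> d\<^sup>2")
  case True
  have "\<bar>x - u\<bar> \<le> 2" using x by linarith
  also have "\<dots> \<le> d * d" using True by (simp add: power2_eq_square)
  also have "\<dots> \<le> d * (2 * b + d)" using b d by (intro mult_left_mono) auto
  finally show ?thesis .
next
  case False
  have dd: "d\<^sup>2 = 2 - 2 * x * u - 2 * a * b" using d a b by (simp add: power2_diff)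
  have "(x - u)\<^sup>2 * (4 - d\<^sup>2) = d\<^sup>2 * (a + b)\<^sup>2"
    unfolding dd using a(2) b(2) by algebra
  moreover have "(x - u)\<^sup>2 * 1 \<le> (x - u)\<^sup>2 * (4 - d\<^sup>2)"
    using False by (intro mult_left_mono) auto
  ultimately have "\<bar>x - u\<bar>\<^sup>2 \<le> (d * (a + b))\<^sup>2" by (simp add: power_mult_distrib)
  then have 1: "\<bar>x - u\<bar> \<le> d * (a + b)"
    using a b d by (intro power2_le_imp_le[of "\<bar>x - u\<bar>"]) auto
  have "(a - b)\<^sup>2 \<le> d\<^sup>2" using d by simp
  then have "a - b \<le> d" using d by (meson abs_le_D1 abs_le_square_iff abs_of_nonneg order_trans power2_le_imp_le)
  then have "d * (a + b) \<le> d * (2 * b + d)" using d by (intro mult_left_mono) auto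
  with 1 show ?thesis by simp
qed

text \<open>In terms of the scaled chord \<open>T = m * norm (v - 1)\<close> the kernel is at most 1
  and at most \<open>2 / T\<close>, while \<open>\<bar>x - u\<bar>\<close> is at most
  \<open>max 4 (T^2)\<close> times \<open>rho m u\<close>. Near the endpoints the distance is
  quadratic in the chord, so it is the square of the kernel that decays to first order; hence the
  even power \<open>2 * s\<close> later. The 5 is 1 + 4.\<close>

lemma kernel_decay:
  fixes t x :: real
  assumes x: "\<bar>x\<bar> \<le> 1" and m: "1 \<le> m"
  defines "v \<equiv> cis t * cnj (Complex x (phi x))"
  shows "(norm ((\<Sum>j<m. v ^ j) / of_nat m))\<^sup>2 \<le> 5 / (1 + \<bar>x - cos t\<bar> / rho m (cos t))"
proof -
  define g where "g = norm ((\<Sum>j<m. v ^ j) / of_nat m)"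
  define u where "u = cos t"
  define T where "T = real m * norm (v - 1)"
  have m0: "1 \<le> real m" using m by simp
  have u: "\<bar>u\<bar> \<le> 1" by (simp add: u_def)
  have \<rho>: "0 < rho m u" by (rule rho_pos[OF m u])
  have n0: "norm (Complex x (phi x)) = 1" using phi_sq[OF x] by (simp add: cmod_def)
  then have v: "norm v = 1" by (simp add: v_def norm_mult)
  have n1: "Complex x (phi x) * cnj (Complex x (phi x)) = 1"
    by (simp add: n0 complex_norm_square[symmetric])
  have "v - 1 = (cis t - Complex x (phi x)) * cnj (Complex x (phi x))"
    using n1 by (simp add: v_def left_diff_distrib)
  then have vD: "norm (v - 1) = norm (cis t - Complex x (phi x))" using n0 by (simp add: norm_mult)
  define d where "d = sqrt ((x - u)\<^sup>2 + (phi x - phi u)\<^sup>2)"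
  have phiu: "phi u = \<bar>sin t\<bar>" by (simp add: u_def phi_def sin_squared_eq[symmetric])
  \<comment> \<open>Reflecting \<open>cis t\<close> into the upper half plane, where the point above
    \<open>x\<close> lies, can only shorten the chord.\<close>
  have "(phi x - \<bar>sin t\<bar>)\<^sup>2 \<le> (phi x - sin t)\<^sup>2"
    using mult_left_mono[OF abs_ge_self phi_nonneg[OF x], of "sin t"] by (simp add: power2_diff)
  then have "d \<le> sqrt ((x - u)\<^sup>2 + (phi x - sin t)\<^sup>2)"
    unfolding d_def phiu by simp
  also have "\<dots> = norm (cis t - Complex x (phi x))"
    by (simp add: cmod_def u_def power2_commute)
  finally have dD: "d \<le> norm (v - 1)" by (simp add: vD)
  have d0: "0 \<le> d" by (simp add: d_def)
  have "\<bar>x - u\<bar> \<le> d * (2 * phi u + d)"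
    by (rule abs_diff_le_chord[OF x u phi_nonneg[OF x] phi_sq[OF x] phi_nonneg[OF u] phi_sq[OF u] d0])
       (simp add: d_def)
  also have "\<dots> \<le> norm (v - 1) * (2 * phi u + norm (v - 1))"
    using dD d0 phi_nonneg[OF u] by (intro mult_mono) auto
  also have "\<dots> = 2 * T * (phi u / real m) + T\<^sup>2 * (1 / (real m)\<^sup>2)"
    using m0 by (simp add: T_def field_simps power2_eq_square)
  finally have xu: "\<bar>x - u\<bar> \<le> 2 * T * (phi u / real m) + T\<^sup>2 * (1 / (real m)\<^sup>2)" .
  have T0: "0 \<le> T" by (simp add: T_def)
  have ph: "0 \<le> phi u / real m" using phi_nonneg[OF u] by simp
  have g: "0 \<le> g" "g \<le> 1" "g * T \<le> 2"
    using norm_mean_powers_le[OF m v] by (auto simp: g_def T_def)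
  have g1: "g\<^sup>2 \<le> 1" using g by (simp add: power_le_one)
  have gxu: "g\<^sup>2 * \<bar>x - u\<bar> \<le> 4 * rho m u"
  proof (cases "T \<le> 2")
    case True
    have "T\<^sup>2 \<le> 2\<^sup>2" using True T0 by (intro power_mono) auto
    then have "2 * T * (phi u / real m) + T\<^sup>2 * (1 / (real m)\<^sup>2) \<le> 4 * (phi u / real m) + 4 * (1 / (real m)\<^sup>2)"
      using True ph by (intro add_mono mult_right_mono) auto
    also have "\<dots> = 4 * rho m u" by (simp add: rho_eq_phi)
    finally have "\<bar>x - u\<bar> \<le> 4 * rho m u" using xu by simp
    then have "g\<^sup>2 * \<bar>x - u\<bar> \<le> 1 * (4 * rho m u)" using g1 by (intro mult_mono) auto
    then show ?thesis by simp
  next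
    case False
    have "2 * T \<le> T\<^sup>2" using False by (simp add: power2_eq_square)
    then have "2 * T * (phi u / real m) + T\<^sup>2 * (1 / (real m)\<^sup>2) \<le> T\<^sup>2 * (phi u / real m) + T\<^sup>2 * (1 / (real m)\<^sup>2)"
      using ph by (intro add_mono mult_right_mono) auto
    also have "\<dots> = T\<^sup>2 * rho m u" by (simp add: rho_eq_phi algebra_simps)
    finally have "\<bar>x - u\<bar> \<le> T\<^sup>2 * rho m u" using xu by simp
    then have "g\<^sup>2 * \<bar>x - u\<bar> \<le> g\<^sup>2 * (T\<^sup>2 * rho m u)" by (intro mult_left_mono) auto
    also have "\<dots> = (g * T)\<^sup>2 * rho m u" by (simp add: power_mult_distrib)
    also have "(g * T)\<^sup>2 \<le> 2\<^sup>2" using g T0 by (intro power_mono) auto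
    finally show ?thesis using \<rho> by simp
  qed
  have "g\<^sup>2 * (1 + \<bar>x - u\<bar> / rho m u) \<le> 5"
    using add_mono[OF mult_right_mono[OF g1, of "rho m u"] gxu] \<rho> by (simp add: field_simps)
  moreover have "0 < 1 + \<bar>x - u\<bar> / rho m u" using \<rho> by (intro add_pos_nonneg) auto
  ultimately show ?thesis by (simp add: g_def u_def field_simps)
qed

section \<open>Local estimates for algebraic polynomials\<close>

lemma borel_measurable_phi [measurable]: "phi \<in> borel_measurable borel"
  unfolding phi_def by measurable

lemma borel_measurable_rho [measurable]: "rho m \<in> borel_measurable borel"
  unfolding rho_eq_phi[abs_def] by measurable

lemma borel_measurable_poly [measurable]: "(\<lambda>x::real. poly Q x) \<in> borel_measurable borel"
  by (intro borel_measurable_continuous_onI continuous_intros)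

lemma nn_integral_cos_sin_half:
  fixes F :: "real \<Rightarrow> ennreal"
  assumes [measurable]: "F \<in> borel_measurable borel"
  shows "(\<integral>\<^sup>+t\<in>{-pi..0}. F (cos t) * ennreal \<bar>sin t\<bar> \<partial>lborel) = (\<integral>\<^sup>+u\<in>{-1..1}. F u \<partial>lborel)"
proof -
  have "(\<integral>\<^sup>+u. F u * indicator {cos (-pi)..cos 0} u \<partial>lborel) =
        (\<integral>\<^sup>+t. F (cos t) * ennreal (- sin t) * indicator {-pi..0} t \<partial>lborel)"
  \<comment> \<open>The half \<open>[-pi, 0]\<close> is chosen because the cosine increases there,
    as the substitution rule demands; the other half follows by reflection.\<close>
  proof (rule nn_integral_substitution_aux)
    show "0 \<le> - sin t" if "t \<in> {-pi..0}" for t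
      using that sin_ge_zero[of "-t"] by auto
  qed (auto intro!: derivative_eq_intros continuous_intros)
  also have "\<dots> = (\<integral>\<^sup>+t\<in>{-pi..0}. F (cos t) * ennreal \<bar>sin t\<bar> \<partial>lborel)"
  proof (intro nn_integral_cong)
    fix t :: real
    show "F (cos t) * ennreal (- sin t) * indicator {-pi..0} t = F (cos t) * ennreal \<bar>sin t\<bar> * indicator {-pi..0} t"
      using sin_ge_zero[of "-t"] by (auto split: split_indicator simp: abs_if)
  qed
  finally show ?thesis by simp
qed

lemma nn_integral_cos_sin:
  fixes F :: "real \<Rightarrow> ennreal"
  assumes [measurable]: "F \<in> borel_measurable borel"
  shows "(\<integral>\<^sup>+t\<in>{-pi..pi}. F (cos t) * ennreal \<bar>sin t\<bar> \<partial>lborel) \<le> 2 * (\<integral>\<^sup>+u\<in>{-1..1}. F u \<partial>lborel)"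
proof -
  let ?f = "\<lambda>t. F (cos t) * ennreal \<bar>sin t\<bar>"
  have "(\<integral>\<^sup>+t\<in>{-pi..pi}. ?f t \<partial>lborel) \<le> (\<integral>\<^sup>+t. ?f t * indicator {-pi..0} t + ?f t * indicator {0..pi} t \<partial>lborel)"
    by (intro nn_integral_mono) (auto split: split_indicator)
  also have "\<dots> = (\<integral>\<^sup>+t\<in>{-pi..0}. ?f t \<partial>lborel) + (\<integral>\<^sup>+t\<in>{0..pi}. ?f t \<partial>lborel)"
    by (subst nn_integral_add) auto
  also have "(\<integral>\<^sup>+t\<in>{0..pi}. ?f t \<partial>lborel) = (\<integral>\<^sup>+t\<in>{-pi..0}. ?f t \<partial>lborel)"
    by (subst nn_integral_real_affine[where c = "-1" and t = 0])
       (auto intro!: nn_integral_cong split: split_indicator)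
  finally show ?thesis by (simp add: nn_integral_cos_sin_half mult_2)
qed

text \<open>The factors are, in order: folding the circle onto the interval, the inverse of the
  lower bound for the multiplier at the preimage, \<open>2 * N / m\<close> from the Nikolskii
  inequality, and the cost of replacing \<open>m dt\<close> by \<open>du / rho m u\<close>.\<close>

definition local_const :: "nat \<Rightarrow> real" where
  "local_const s = 2 * (2 * 2 ^ (2 * s)) * (4 * (real s + 1)) * (1 + 32 * (real s + 1))"

lemma local_const_pos: "0 < local_const s"
  unfolding local_const_def by (intro mult_pos_pos) (auto intro: add_pos_nonneg add_nonneg_pos)

text \<open>The Nikolskii inequality is applied to \<open>R * G\<close>, with \<open>R\<close> the
  pullback of \<open>Q\<close> to the circle and \<open>G\<close> a kernel power peaked at the point
  above \<open>x\<close>. At the preimage of \<open>y\<close> the extra factors are bounded below;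
  on the circle \<open>G\<close> supplies the decay.\<close>

lemma polynomial_local_bound:
  fixes Q :: "real poly" and y :: complex
  assumes Q: "degree Q \<le> m" and m: "1 \<le> m" and x: "\<bar>x\<bar> \<le> 1" and p: "0 < p" "p \<le> 1"
    and y: "norm (y - of_real x) \<le> (1 / (4 * (real s + 1)))\<^sup>2 / 16 * rho m x"
  shows "ennreal (norm (poly (cpoly Q) y) powr p) \<le> ennreal (local_const s) *
     (\<integral>\<^sup>+u\<in>{-1..1}. ennreal (\<bar>poly Q u\<bar> powr p * (5 / (1 + \<bar>x - u\<bar> / rho m u)) powr (real s * p) / rho m u) \<partial>lborel)"
proof -
  \<comment> \<open>This choice puts the preimage both within \<open>1 / N\<close> of the circle,
    where \<open>N = 2 * (s + 1) * m\<close> bounds the degree of \<open>R * G\<close>, and within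
    \<open>1 / (4 * m)\<close> of the peak of the kernel.\<close>
  define b where "b = 1 / (4 * (real s + 1))"
  have b: "0 < b" "b \<le> 1/4" by (auto simp: b_def field_simps)
  have m0: "1 \<le> real m" using m by simp
  define \<zeta>0 where "\<zeta>0 = Complex x (phi x)"
  have n0: "norm \<zeta>0 = 1" using phi_sq[OF x] by (simp add: \<zeta>0_def cmod_def)
  have n1: "\<zeta>0 * cnj \<zeta>0 = 1" by (simp add: n0 complex_norm_square[symmetric])
  obtain \<zeta> where \<zeta>: "norm (\<zeta> - \<zeta>0) \<le> b / real m" "\<zeta> \<noteq> 0" "(\<zeta> + 1 / \<zeta>) / 2 = y"
    using exists_joukowski_preimage[OF x m b, of y] y unfolding b_def[symmetric] \<zeta>0_def by blast
  obtain R where R: "degree R \<le> 2 * m" "\<And>z. z \<noteq> 0 \<Longrightarrow> poly R z = z ^ m * poly (cpoly Q) ((z + 1 / z) / 2)"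
    using exists_joukowski_poly[of "cpoly Q" m] Q by (auto simp: degree_cpoly)
  obtain G where G: "degree G \<le> m * (2 * s)"
      "\<And>z. poly G z = ((\<Sum>j<m. (z * cnj \<zeta>0) ^ j) / of_nat m) ^ (2 * s)"
    using exists_kernel_poly[of m "2 * s" "cnj \<zeta>0"] by blast
  define N where "N = 2 * (s + 1) * m"
  have N1: "1 \<le> N" using m by (simp add: N_def)
  have degS: "degree (R * G) \<le> N"
    by (rule order_trans[OF degree_mult_le]) (use R G in \<open>simp add: N_def algebra_simps\<close>)
  have bm: "b / real m \<le> 1 / real N"
  proof -
    have "b / real m = 1 / (4 * (real s + 1) * real m)" by (simp add: b_def)
    also have "\<dots> \<le> 1 / (2 * (real s + 1) * real m)"
      using m0 by (intro divide_left_mono mult_right_mono) auto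
    also have "\<dots> = 1 / real N" by (simp add: N_def algebra_simps)
    finally show ?thesis .
  qed
  have z1: "norm \<zeta> \<le> 1 + 1 / real N"
    using norm_triangle_ineq[of "\<zeta> - \<zeta>0" \<zeta>0] \<zeta>(1) bm n0 by simp
  have "1 - b / real m \<le> norm \<zeta>"
    using norm_triangle_ineq2[of \<zeta>0 "\<zeta>0 - \<zeta>"] \<zeta>(1) n0 by (simp add: norm_minus_commute)
  moreover have "b / real m \<le> 1" using b m0 by (simp add: field_simps)
  ultimately have pm: "(1 - b / real m) ^ m \<le> norm \<zeta> ^ m" by (intro power_mono) auto
  \<comment> \<open>Bernoulli's inequality keeps the factor \<open>\<zeta> ^ m\<close> above
    \<open>1 - b\<close> although \<open>\<zeta>\<close> may lie inside the circle.\<close>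
  have "1 + real m * (- (b / real m)) \<le> (1 + (- (b / real m))) ^ m"
    using \<open>b / real m \<le> 1\<close> by (intro Bernoulli_inequality) simp
  then have "1 - b \<le> (1 - b / real m) ^ m" using m0 by simp
  then have zm: "1 / 2 \<le> norm \<zeta> ^ m" using pm b by linarith
  have "\<zeta> * cnj \<zeta>0 - 1 = (\<zeta> - \<zeta>0) * cnj \<zeta>0" using n1 by (simp add: left_diff_distrib)
  then have "norm (\<zeta> * cnj \<zeta>0 - 1) \<le> b / real m" using \<zeta>(1) n0 by (simp add: norm_mult)
  also have "\<dots> \<le> 1 / (4 * real m)" using b m0 by (simp add: field_simps)
  finally have "1 / 2 \<le> norm ((\<Sum>j<m. (\<zeta> * cnj \<zeta>0) ^ j) / of_nat m)"
    by (rule norm_mean_powers_ge[OF m])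
  then have "(1 / 2) ^ (2 * s) \<le> norm (poly G \<zeta>)"
    unfolding G(2) norm_power by (intro power_mono) auto
  then have zG: "1 / (2 * 2 ^ (2 * s)) \<le> norm \<zeta> ^ m * norm (poly G \<zeta>)"
    using mult_mono[OF zm, of "(1 / 2) ^ (2 * s)" "norm (poly G \<zeta>)"] by (simp add: power_divide)
  let ?q = "norm (poly (cpoly Q) y)" and ?c = "2 * 2 ^ (2 * s) :: real"
  have "?q * 1 \<le> ?q * (?c * (norm \<zeta> ^ m * norm (poly G \<zeta>)))"
    using zG by (intro mult_left_mono) (auto simp: field_simps)
  also have "\<dots> = ?c * norm (poly (R * G) \<zeta>)"
    using R(2)[OF \<zeta>(2)] \<zeta>(3) by (simp add: norm_mult norm_power)
  finally have "?q powr p \<le> (?c * norm (poly (R * G) \<zeta>)) powr p"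
    using p by (intro powr_mono2) auto
  also have "\<dots> = ?c powr p * norm (poly (R * G) \<zeta>) powr p" by (simp add: powr_mult)
  also have "?c powr p \<le> ?c powr 1"
  proof (rule powr_mono)
    show "1 \<le> ?c" using one_le_power[of "2::real" "2 * s"] by linarith
  qed (use p in auto)
  finally have q_le: "?q powr p \<le> ?c * norm (poly (R * G) \<zeta>) powr p"
    by (simp add: mult_right_mono)
  define \<kappa> where "\<kappa> = 1 + 32 * (real s + 1)"
  have \<kappa>: "0 < \<kappa>" by (simp add: \<kappa>_def add_pos_nonneg)
  define F where "F = (\<lambda>u. ennreal (\<bar>poly Q u\<bar> powr p * (5 / (1 + \<bar>x - u\<bar> / rho m u)) powr (real s * p) / rho m u))"
  have [measurable]: "F \<in> borel_measurable borel" unfolding F_def by measurable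
  \<comment> \<open>This is where omitting the arcs pays: on the rest
    \<open>\<bar>sin t\<bar> \<ge> 1 / (16 * N)\<close>, so the term \<open>1 / m^2\<close> of
    \<open>rho m u\<close> is also controlled by \<open>\<bar>sin t\<bar> / m\<close>.\<close>
  have pointwise: "ennreal (norm (poly (R * G) (cis t)) powr p) * ennreal (real m) \<le> ennreal \<kappa> * (F (cos t) * ennreal \<bar>sin t\<bar>)"
    if t: "t \<in> inner_arc (1 / (16 * real N))" for t
  proof -
    define u where "u = cos t"
    have u: "\<bar>u\<bar> \<le> 1" by (simp add: u_def)
    have \<rho>: "0 < rho m u" by (rule rho_pos[OF m u])
    define Y where "Y = \<bar>x - u\<bar> / rho m u"
    have Y: "0 \<le> Y" using \<rho> by (simp add: Y_def)
    have phiu: "phi u = \<bar>sin t\<bar>" by (simp add: u_def phi_def sin_squared_eq[symmetric])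
    have "cis t + 1 / cis t = 2 * of_real u"
      by (simp add: u_def complex_eq_iff flip: inverse_eq_divide)
    then have "poly R (cis t) = cis t ^ m * of_real (poly Q u)"
      using R(2)[of "cis t"] by (simp add: poly_cpoly_of_real)
    then have nR: "norm (poly R (cis t)) = \<bar>poly Q u\<bar>" by (simp add: norm_mult norm_power)
    have "norm (poly G (cis t)) = ((norm ((\<Sum>j<m. (cis t * cnj \<zeta>0) ^ j) / of_nat m))\<^sup>2) ^ s"
      unfolding G(2) norm_power power_mult ..
    also have "\<dots> \<le> (5 / (1 + Y)) ^ s"
      using kernel_decay[OF x m, of t] by (intro power_mono) (auto simp: Y_def u_def \<zeta>0_def)
    finally have nG: "norm (poly G (cis t)) \<le> (5 / (1 + Y)) ^ s" .
    have "norm (poly (R * G) (cis t)) powr p = \<bar>poly Q u\<bar> powr p * norm (poly G (cis t)) powr p"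
      by (simp add: norm_mult nR powr_mult)
    also have "\<dots> \<le> \<bar>poly Q u\<bar> powr p * ((5 / (1 + Y)) ^ s) powr p"
      using nG p by (intro mult_left_mono powr_mono2) auto
    also have "((5 / (1 + Y)) ^ s) powr p = (5 / (1 + Y)) powr (real s * p)"
      using Y by (simp add: powr_powr flip: powr_realpow)
    finally have nS: "norm (poly (R * G) (cis t)) powr p \<le> \<bar>poly Q u\<bar> powr p * (5 / (1 + Y)) powr (real s * p)" .
    have sin_ge: "1 / (16 * real N) \<le> \<bar>sin t\<bar>"
      using N1 by (intro abs_sin_ge_inner_arc[OF t]) (auto simp: field_simps)
    have "1 / real m \<le> 32 * (real s + 1) * \<bar>sin t\<bar>"
    proof -
      have "1 / (32 * (real s + 1) * real m) \<le> \<bar>sin t\<bar>"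
        using sin_ge by (simp add: N_def algebra_simps)
      then have "32 * (real s + 1) * (1 / (32 * (real s + 1) * real m)) \<le> 32 * (real s + 1) * \<bar>sin t\<bar>"
        by (intro mult_left_mono) auto
      then show ?thesis by (simp del: distrib_left_numeral)
    qed
    then have "1 / real m * (1 / real m) \<le> 32 * (real s + 1) * \<bar>sin t\<bar> * (1 / real m)"
      by (intro mult_right_mono) auto
    then have "rho m u \<le> \<kappa> * \<bar>sin t\<bar> / real m"
      unfolding rho_eq_phi phiu \<kappa>_def by (simp add: power2_eq_square add_divide_distrib distrib_right)
    then have mr: "real m \<le> \<kappa> * \<bar>sin t\<bar> / rho m u"
      using \<rho> m0 by (simp add: field_simps)
    define V where "V = \<bar>poly Q u\<bar> powr p * (5 / (1 + Y)) powr (real s * p) / rho m u"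
    have V: "0 \<le> V" using \<rho> by (simp add: V_def)
    have "norm (poly (R * G) (cis t)) powr p * real m
       \<le> (\<bar>poly Q u\<bar> powr p * (5 / (1 + Y)) powr (real s * p)) * (\<kappa> * \<bar>sin t\<bar> / rho m u)"
      using nS mr by (intro mult_mono) auto
    also have "\<dots> = \<kappa> * (V * \<bar>sin t\<bar>)"
      by (simp add: V_def)
    finally have "ennreal (norm (poly (R * G) (cis t)) powr p * real m) \<le> ennreal (\<kappa> * (V * \<bar>sin t\<bar>))"
      by (rule ennreal_leI)
    moreover have "F (cos t) = ennreal V"
      by (simp add: F_def V_def Y_def u_def)
    ultimately show ?thesis
      using \<kappa> V by (simp add: ennreal_mult del: poly_mult)
  qed
  have meas [measurable]: "(\<lambda>t. poly (R * G) (cis t)) \<in> borel_measurable borel"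
    by (intro borel_measurable_continuous_onI continuous_intros)
  have "ennreal (norm (poly (R * G) \<zeta>) powr p) \<le> ennreal (2 * real N) *
     (\<integral>\<^sup>+t\<in>inner_arc (1 / (16 * real N)). ennreal (norm (poly (R * G) (cis t)) powr p) \<partial>lborel)"
    by (rule nikolskii_circle[OF degS N1 z1 p])
  also have "\<dots> = ennreal (4 * (real s + 1)) * (\<integral>\<^sup>+t\<in>inner_arc (1 / (16 * real N)).
      ennreal (norm (poly (R * G) (cis t)) powr p) * ennreal (real m) \<partial>lborel)"
  proof -
    have "2 * real N = (4 * (real s + 1)) * real m" by (simp add: N_def algebra_simps)
    moreover have "ennreal (4 * (real s + 1) * real m) = ennreal (4 * (real s + 1)) * ennreal (real m)"
      by (rule ennreal_mult) auto
    ultimately have "ennreal (2 * real N) = ennreal (4 * (real s + 1)) * ennreal (real m)"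
      by (simp only:)
    moreover have "(\<integral>\<^sup>+t\<in>inner_arc (1 / (16 * real N)). ennreal (norm (poly (R * G) (cis t)) powr p) * ennreal (real m) \<partial>lborel) =
      (\<integral>\<^sup>+t. ennreal (norm (poly (R * G) (cis t)) powr p) * indicator (inner_arc (1 / (16 * real N))) t * ennreal (real m) \<partial>lborel)"
      by (simp only: mult.assoc mult.commute[of "ennreal (real m)"])
    moreover have "\<dots> = (\<integral>\<^sup>+t\<in>inner_arc (1 / (16 * real N)). ennreal (norm (poly (R * G) (cis t)) powr p) \<partial>lborel) * ennreal (real m)"
      by (rule nn_integral_multc) measurable
    ultimately show ?thesis by (simp only: mult_ac)
  qed
  also have "\<dots> \<le> ennreal (4 * (real s + 1)) * (\<integral>\<^sup>+t. ennreal \<kappa> * (F (cos t) * ennreal \<bar>sin t\<bar> * indicator {-pi..pi} t) \<partial>lborel)"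
  proof (intro mult_left_mono nn_integral_mono)
    fix t :: real
    show "ennreal (norm (poly (R * G) (cis t)) powr p) * ennreal (real m) * indicator (inner_arc (1 / (16 * real N))) t
      \<le> ennreal \<kappa> * (F (cos t) * ennreal \<bar>sin t\<bar> * indicator {-pi..pi} t)"
    proof (cases "t \<in> inner_arc (1 / (16 * real N))")
      case True
      moreover have "0 \<le> 1 / (16 * real N)" by simp
      ultimately have "t \<in> {-pi..pi}" unfolding inner_arc_def mem_Collect_eq atLeastAtMost_iff by linarith
      then show ?thesis using pointwise[OF True] True by simp
    qed simp
  qed simp
  also have "\<dots> = ennreal (4 * (real s + 1)) * (ennreal \<kappa> * (\<integral>\<^sup>+t\<in>{-pi..pi}. F (cos t) * ennreal \<bar>sin t\<bar> \<partial>lborel))"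
    by (subst nn_integral_cmult) auto
  also have "\<dots> \<le> ennreal (4 * (real s + 1)) * (ennreal \<kappa> * (2 * (\<integral>\<^sup>+u\<in>{-1..1}. F u \<partial>lborel)))"
    by (intro mult_left_mono nn_integral_cos_sin) auto
  finally have S_le: "ennreal (norm (poly (R * G) \<zeta>) powr p) \<le>
      ennreal (4 * (real s + 1)) * (ennreal \<kappa> * (2 * (\<integral>\<^sup>+u\<in>{-1..1}. F u \<partial>lborel)))" .
  have "ennreal (?q powr p) \<le> ennreal ?c * ennreal (norm (poly (R * G) \<zeta>) powr p)"
    using ennreal_leI[OF q_le] by (subst ennreal_mult[symmetric]) auto
  also have "\<dots> \<le> ennreal ?c * (ennreal (4 * (real s + 1)) * (ennreal \<kappa> * (2 * (\<integral>\<^sup>+u\<in>{-1..1}. F u \<partial>lborel))))"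
    by (intro mult_left_mono S_le) auto
  also have "\<dots> = ennreal (local_const s) * (\<integral>\<^sup>+u\<in>{-1..1}. F u \<partial>lborel)"
  proof -
    have "ennreal (local_const s) = ennreal 2 * ennreal ?c * ennreal (4 * (real s + 1)) * ennreal \<kappa>"
      unfolding local_const_def \<kappa>_def
      by (simp only: ennreal_mult mult_nonneg_nonneg add_nonneg_nonneg zero_le_power zero_le_numeral zero_le_one of_nat_0_le_iff)
    then show ?thesis by (simp add: mult_ac)
  qed
  finally show ?thesis by (simp add: F_def)
qed

section \<open>Averages of doubling weights\<close>

lemma rho_diff_le:
  assumes m: "1 \<le> m" and x: "\<bar>x\<bar> \<le> 1" and u: "\<bar>u\<bar> \<le> 1"
  shows "rho m x \<le> rho m u + sqrt (2 * \<bar>x - u\<bar>) / real m"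
proof -
  have "(phi x)\<^sup>2 \<le> (phi u)\<^sup>2 + 2 * \<bar>x - u\<bar>"
  proof -
    have "(phi x)\<^sup>2 - (phi u)\<^sup>2 = (u - x) * (u + x)"
      using phi_sq[OF x] phi_sq[OF u] by (simp add: algebra_simps power2_eq_square)
    also have "\<dots> \<le> \<bar>u - x\<bar> * \<bar>u + x\<bar>" by (simp only: abs_mult[symmetric] abs_ge_self)
    also have "\<dots> \<le> \<bar>u - x\<bar> * 2" using x u by (intro mult_left_mono) auto
    finally show ?thesis by (simp add: abs_minus_commute)
  qed
  also have "\<dots> \<le> (phi u + sqrt (2 * \<bar>x - u\<bar>))\<^sup>2"
    using phi_nonneg[OF u] by (simp add: power2_sum)
  finally have "phi x \<le> phi u + sqrt (2 * \<bar>x - u\<bar>)"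
    using phi_nonneg[OF u] by (intro power2_le_imp_le[of "phi x"]) auto
  then have "phi x / real m \<le> (phi u + sqrt (2 * \<bar>x - u\<bar>)) / real m"
    by (intro divide_right_mono) auto
  then show ?thesis by (simp add: rho_eq_phi add_divide_distrib)
qed

lemma inverse_square_le_rho:
  assumes "\<bar>x\<bar> \<le> 1" shows "1 / (real m)\<^sup>2 \<le> rho m x"
  using phi_nonneg[OF assms] by (simp add: rho_eq_phi)

text \<open>The square root in \<open>rho_diff_le\<close> is split by the arithmetic-geometric mean
  inequality into \<open>\<bar>x - u\<bar>\<close> and half of \<open>1 / m^2\<close>, the latter
  being at most \<open>rho m u\<close>.\<close>

lemma rho_le_rho_add:
  assumes m: "1 \<le> m" and x: "\<bar>x\<bar> \<le> 1" and u: "\<bar>u\<bar> \<le> 1"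
  shows "rho m x \<le> 2 * rho m u + \<bar>x - u\<bar>"
proof -
  define r where "r = sqrt (2 * \<bar>x - u\<bar>)"
  define b where "b = 1 / real m"
  have "0 \<le> (r - b)\<^sup>2" by simp
  then have "2 * (r * b) \<le> r\<^sup>2 + b\<^sup>2" by (simp add: power2_diff algebra_simps)
  also have "r\<^sup>2 = 2 * \<bar>x - u\<bar>" by (simp add: r_def)
  finally have "r * b \<le> \<bar>x - u\<bar> + b\<^sup>2 / 2" by simp
  moreover have "b\<^sup>2 \<le> rho m u" using inverse_square_le_rho[OF u, of m] by (simp add: b_def power_divide)
  ultimately have "r * b \<le> \<bar>x - u\<bar> + rho m u" using zero_le_power2[of b] by linarith
  then show ?thesis using rho_diff_le[OF m x u] by (simp add: r_def b_def)
qed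

text \<open>Here \<open>\<bar>x - u\<bar>\<close> is measured in units of the quantity to be
  bounded, so the linear estimate above is too weak. If the claim failed, the square-root term would
  carry at least half of \<open>rho m u\<close>; squaring it and using
  \<open>1 / m^2 \<le> rho m x\<close> gives a contradiction.\<close>

lemma rho_ratio_le:
  assumes m: "1 \<le> m" and x: "\<bar>x\<bar> \<le> 1" and u: "\<bar>u\<bar> \<le> 1"
  shows "rho m u \<le> 8 * (1 + \<bar>x - u\<bar> / rho m u) * rho m x"
proof (rule ccontr)
  define A where "A = rho m u"
  define B where "B = rho m x"
  define Y where "Y = \<bar>x - u\<bar> / A"
  have A: "0 < A" and B: "0 < B" unfolding A_def B_def using rho_pos m x u by auto
  have Y: "0 \<le> Y" "\<bar>x - u\<bar> = Y * A" using A by (auto simp: Y_def)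
  assume "\<not> ?thesis"
  then have *: "8 * (1 + Y) * B < A" by (simp add: A_def B_def Y_def)
  have YB: "0 \<le> Y * B" using Y B by simp
  have "A \<le> B + sqrt (2 * \<bar>x - u\<bar>) / real m"
    using rho_diff_le[OF m u x] by (simp add: A_def B_def abs_minus_commute)
  then have "A / 2 \<le> sqrt (2 * \<bar>x - u\<bar>) / real m" using * YB B by (simp add: algebra_simps)
  then have "(A / 2)\<^sup>2 \<le> (sqrt (2 * \<bar>x - u\<bar>) / real m)\<^sup>2" using A by (intro power_mono) auto
  also have "\<dots> = 2 * (Y * A) * (1 / (real m)\<^sup>2)" by (simp add: power_divide Y(2)[symmetric])
  also have "\<dots> \<le> 2 * (Y * A) * B"
    unfolding B_def using inverse_square_le_rho[OF x, of m] Y A by (intro mult_left_mono) auto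
  finally have "A * (A / 4) \<le> A * (2 * Y * B)" by (simp add: power2_eq_square algebra_simps)
  then have "A / 4 \<le> 2 * Y * B" using A by (simp only: mult_le_cancel_left_pos)
  then show False using * B by (simp add: algebra_simps)
qed

lemma rho_antimono:
  assumes "1 \<le> m" "m \<le> n" "\<bar>x\<bar> \<le> 1"
  shows "rho n x \<le> rho m x"
  unfolding rho_eq_phi using assms phi_nonneg[OF assms(3)]
  by (intro add_mono divide_left_mono) (auto intro!: power_mono)

section \<open>Growth of the mass of a doubling weight and of its averages\<close>

definition mass :: "(real \<Rightarrow> real) \<Rightarrow> real \<Rightarrow> real \<Rightarrow> real" where
  "mass w a b = (LINT u:{a..b}|lebesgue. w u)"

lemma wavg_mass: "wavg w n x = mass w (x - rho n x) (x + rho n x) / rho n x"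
  by (simp add: wavg_def mass_def)

lemma doubling_weight_integrable:
  assumes "doubling_weight w L"
  shows "integrable lebesgue w"
proof -
  have "(\<lambda>x. indicator {-1..1} x *\<^sub>R w x) = w"
    using assms by (auto simp: doubling_weight_def indicator_def fun_eq_iff)
  then show ?thesis using assms by (simp add: doubling_weight_def set_integrable_def)
qed

lemma doubling_weight_set_integrable:
  assumes "doubling_weight w L" "A \<in> sets lebesgue"
  shows "set_integrable lebesgue A w"
  using integrable_mult_indicator[OF assms(2) doubling_weight_integrable[OF assms(1)]]
  by (simp add: set_integrable_def)

lemma mass_mono:
  assumes w: "doubling_weight w L" and sub: "{a..b} \<inter> {-1..1} \<subseteq> {c..d}"
  shows "mass w a b \<le> mass w c d"
  unfolding mass_def set_lebesgue_integral_def
proof (rule integral_mono)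
  show "integrable lebesgue (\<lambda>x. indicator {a..b} x *\<^sub>R w x)" "integrable lebesgue (\<lambda>x. indicator {c..d} x *\<^sub>R w x)"
    using doubling_weight_set_integrable[OF w] by (auto simp: set_integrable_def)
  fix x
  show "indicator {a..b} x *\<^sub>R w x \<le> indicator {c..d} x *\<^sub>R w x"
    using w sub by (cases "x \<in> {-1..1}") (auto simp: doubling_weight_def indicator_def)
qed

lemma mass_nonneg:
  assumes w: "doubling_weight w L" shows "0 \<le> mass w a b"
  unfolding mass_def set_lebesgue_integral_def
  by (rule Bochner_Integration.integral_nonneg) (use w in \<open>auto simp: doubling_weight_def\<close>)

lemma mass_double_interval:
  assumes w: "doubling_weight w L" and ab: "-1 \<le> a" "a < b" "b \<le> 1"
  shows "mass w (a - (b - a) / 2) (b + (b - a) / 2) \<le> L * mass w a b"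
proof -
  have "(a + b) / 2 - (b - a) = a - (b - a) / 2" "(a + b) / 2 + (b - a) = b + (b - a) / 2"
    by (simp_all add: field_simps)
  moreover have "(LINT u:{(a + b) / 2 - (b - a)..(a + b) / 2 + (b - a)}|lebesgue. w u) \<le> L * (LINT u:{a..b}|lebesgue. w u)"
    using w ab unfolding doubling_weight_def by blast
  ultimately show ?thesis by (simp only: mass_def)
qed

text \<open>
  Two doublings are needed: the part of \<open>[u - s, u + s]\<close> inside \<open>[-1,1]\<close> need not be centred at \<open>u\<close>.
\<close>

lemma mass_double_ball:
  assumes w: "doubling_weight w L" and L: "1 \<le> L" and u: "\<bar>u\<bar> \<le> 1" and s: "0 < s"
  shows "mass w (u - 2 * s) (u + 2 * s) \<le> L\<^sup>2 * mass w (u - s) (u + s)"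
proof -
  define a where "a = max (-1) (u - s)"
  define b where "b = min 1 (u + s)"
  have ab: "-1 \<le> a" "a < b" "b \<le> 1" using u s by (auto simp: a_def b_def)
  define a1 where "a1 = max (-1) (a - (b - a) / 2)"
  define b1 where "b1 = min 1 (b + (b - a) / 2)"
  have a: "a = -1 \<or> a = u - s" "u - s \<le> a" and b: "b = 1 \<or> b = u + s" "b \<le> u + s"
    unfolding a_def b_def by linarith+
  have a1: "a1 = -1 \<or> a1 = a - (b - a) / 2" "-1 \<le> a1" "a - (b - a) / 2 \<le> a1"
    and b1: "b1 = 1 \<or> b1 = b + (b - a) / 2" "b1 \<le> 1" "b1 \<le> b + (b - a) / 2"
    unfolding a1_def b1_def by linarith+
  have ab1: "a1 \<le> a" "b \<le> b1" using ab by (auto simp: a1_def b1_def)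
  have u': "u \<le> 1" "-1 \<le> u" using u by auto
  \<comment> \<open>If the left end is not cut off at -1, then \<open>b - a \<ge> s\<close> because
    \<open>u \<le> 1\<close>; it moves left by at least \<open>s / 2\<close> and then by at least
    \<open>3 * s / 4\<close>, which passes \<open>u - 2 * s\<close>.\<close>
  have lo: "v \<ge> a1 - (b1 - a1) / 2" if v: "u - 2 * s \<le> v" "-1 \<le> v" for v
  proof (cases "a1 = -1")
    case True
    have "0 \<le> (b1 - a1) / 2" using ab ab1 by simp
    then show ?thesis using True v by linarith
  next
    case False
    then have e: "a1 = a - (b - a) / 2" using a1 by simp
    have "a \<noteq> -1" using e a1(2) ab(2) by argo
    then have "a = u - s" using a by simp
    with e show ?thesis using b v ab ab1 u' s by argo
  qed
  have hi: "v \<le> b1 + (b1 - a1) / 2" if v: "v \<le> u + 2 * s" "v \<le> 1" for v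
  proof (cases "b1 = 1")
    case True
    have "0 \<le> (b1 - a1) / 2" using ab ab1 by simp
    then show ?thesis using True v by linarith
  next
    case False
    then have e: "b1 = b + (b - a) / 2" using b1 by simp
    have "b \<noteq> 1" using e b1(2) ab(2) by argo
    then have "b = u + s" using b by simp
    with e show ?thesis using a v ab ab1 u' s by argo
  qed
  have "mass w (u - 2 * s) (u + 2 * s) \<le> mass w (a1 - (b1 - a1) / 2) (b1 + (b1 - a1) / 2)"
    by (rule mass_mono[OF w]) (use lo hi in auto)
  also have "\<dots> \<le> L * mass w a1 b1" by (rule mass_double_interval[OF w]) (use a1 b1 ab ab1 in linarith)+
  also have "mass w a1 b1 \<le> mass w (a - (b - a) / 2) (b + (b - a) / 2)"
    by (rule mass_mono[OF w]) (auto simp: a1_def b1_def)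
  also have "\<dots> \<le> L * mass w a b" by (rule mass_double_interval[OF w]) (use ab in auto)
  also have "mass w a b \<le> mass w (u - s) (u + s)"
    by (rule mass_mono[OF w]) (auto simp: a_def b_def)
  finally show ?thesis using L by (simp add: power2_eq_square mult.assoc mult_left_mono)
qed

lemma mass_pow_ball:
  assumes w: "doubling_weight w L" and L: "1 \<le> L" and u: "\<bar>u\<bar> \<le> 1" and s: "0 < s"
  shows "mass w (u - 2 ^ j * s) (u + 2 ^ j * s) \<le> (L\<^sup>2) ^ j * mass w (u - s) (u + s)"
proof (induction j)
  case (Suc j)
  have "mass w (u - 2 ^ Suc j * s) (u + 2 ^ Suc j * s) \<le> L\<^sup>2 * mass w (u - 2 ^ j * s) (u + 2 ^ j * s)"
    using mass_double_ball[OF w L u, of "2 ^ j * s"] s by (simp add: mult.assoc)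
  also have "\<dots> \<le> L\<^sup>2 * ((L\<^sup>2) ^ j * mass w (u - s) (u + s))"
    using Suc by (intro mult_left_mono) auto
  finally show ?case by (simp add: mult_ac)
qed simp

lemma exists_power_two_between:
  fixes \<kappa> :: real
  assumes "1 \<le> \<kappa>"
  shows "\<exists>j. \<kappa> \<le> 2 ^ j \<and> 2 ^ j \<le> 2 * \<kappa>"
proof -
  define j where "j = (LEAST j. \<kappa> \<le> 2 ^ j)"
  obtain j0 where "\<kappa> < 2 ^ j0" using real_arch_pow[of 2 \<kappa>] by auto
  then have j: "\<kappa> \<le> 2 ^ j" unfolding j_def by (rule LeastI[of "\<lambda>j. \<kappa> \<le> 2 ^ j" j0, OF less_imp_le])
  have "2 ^ j \<le> 2 * \<kappa>"
  proof (cases j)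
    case (Suc i)
    then have "\<not> \<kappa> \<le> 2 ^ i" using not_less_Least[of i "\<lambda>j. \<kappa> \<le> 2 ^ j"] by (simp add: j_def)
    then show ?thesis using Suc by simp
  qed (use assms in simp)
  with j show ?thesis by blast
qed

text \<open>Iterated doubling becomes polynomial growth through
  \<open>(L^2) ^ j \<le> (2 ^ j) ^ D\<close>; a natural exponent \<open>D\<close> keeps all powers
  elementary.\<close>

lemma mass_ball_growth:
  assumes w: "doubling_weight w L" and L: "1 \<le> L" "L\<^sup>2 \<le> 2 ^ D"
    and u: "\<bar>u\<bar> \<le> 1" and s: "0 < s" and \<kappa>: "1 \<le> \<kappa>"
  shows "mass w (u - \<kappa> * s) (u + \<kappa> * s) \<le> (2 * \<kappa>) ^ D * mass w (u - s) (u + s)"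
proof -
  obtain j where j: "\<kappa> \<le> 2 ^ j" "2 ^ j \<le> 2 * \<kappa>" using exists_power_two_between[OF \<kappa>] by blast
  have "\<kappa> * s \<le> 2 ^ j * s" using j s by (intro mult_right_mono) auto
  then have "mass w (u - \<kappa> * s) (u + \<kappa> * s) \<le> mass w (u - 2 ^ j * s) (u + 2 ^ j * s)"
    by (intro mass_mono[OF w]) auto
  also have "\<dots> \<le> (L\<^sup>2) ^ j * mass w (u - s) (u + s)" by (rule mass_pow_ball[OF w L(1) u s])
  also have "(L\<^sup>2) ^ j \<le> (2 ^ D) ^ j" using L by (intro power_mono) auto
  also have "(2 ^ D) ^ j = ((2::real) ^ j) ^ D" by (simp add: power_mult[symmetric] mult.commute)
  also have "\<dots> \<le> (2 * \<kappa>) ^ D" using j by (intro power_mono) auto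
  finally show ?thesis using mass_nonneg[OF w] by (simp add: mult_right_mono)
qed

lemma wavg_nonneg:
  assumes "doubling_weight w L" "1 \<le> m" "\<bar>x\<bar> \<le> 1"
  shows "0 \<le> wavg w m x"
  unfolding wavg_mass using mass_nonneg[OF assms(1)] rho_pos[OF assms(2,3)] by simp

text \<open>The averaging interval of \<open>x\<close> lies in the one of \<open>u\<close> enlarged
  by \<open>2 * (1 + Y)\<close>, which accounts for the exponent \<open>D\<close>; the quotient of
  the normalising factors adds one.\<close>

lemma wavg_compare:
  assumes w: "doubling_weight w L" and L: "1 \<le> L" "L\<^sup>2 \<le> 2 ^ D"
    and m: "1 \<le> m" and x: "\<bar>x\<bar> \<le> 1" and u: "\<bar>u\<bar> \<le> 1"
  shows "wavg w m x \<le> (8 * (1 + \<bar>x - u\<bar> / rho m u)) ^ (D + 1) * wavg w m u"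
proof -
  define Y where "Y = \<bar>x - u\<bar> / rho m u"
  have \<rho>: "0 < rho m u" "0 < rho m x" using rho_pos m x u by auto
  have Y: "0 \<le> Y" "\<bar>x - u\<bar> = Y * rho m u" using \<rho> by (auto simp: Y_def)
  define M where "M = mass w (u - rho m u) (u + rho m u)"
  have M: "0 \<le> M" unfolding M_def by (rule mass_nonneg[OF w])
  have "rho m x + \<bar>x - u\<bar> \<le> 2 * (1 + Y) * rho m u"
    using rho_le_rho_add[OF m x u] Y(2) by (simp add: algebra_simps)
  then have "mass w (x - rho m x) (x + rho m x) \<le> mass w (u - 2 * (1 + Y) * rho m u) (u + 2 * (1 + Y) * rho m u)"
    by (intro mass_mono[OF w]) auto
  also have "\<dots> \<le> (2 * (2 * (1 + Y))) ^ D * M"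
    unfolding M_def using Y by (intro mass_ball_growth[OF w L u \<rho>(1)]) auto
  also have "\<dots> \<le> (8 * (1 + Y)) ^ D * M"
    using Y M by (intro mult_right_mono power_mono) auto
  finally have "wavg w m x \<le> (8 * (1 + Y)) ^ D * M / rho m x"
    unfolding wavg_mass using \<rho> by (intro divide_right_mono) auto
  also have "\<dots> = (8 * (1 + Y)) ^ D * M * (1 / rho m x)" by simp
  also have "\<dots> \<le> (8 * (1 + Y)) ^ D * M * (8 * (1 + Y) / rho m u)"
  proof (rule mult_left_mono)
    show "1 / rho m x \<le> 8 * (1 + Y) / rho m u"
      using rho_ratio_le[OF m x u] \<rho> unfolding Y_def[symmetric] by (simp add: field_simps)
  qed (use Y M in auto)
  also have "\<dots> = (8 * (1 + Y)) ^ (D + 1) * wavg w m u"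
    by (simp add: wavg_mass M_def)
  finally show ?thesis by (simp only: Y_def)
qed

text \<open>The averaging interval shrinks as the degree grows, so only the normalising factor can
  increase.\<close>

lemma wavg_scale:
  assumes w: "doubling_weight w L" and m: "1 \<le> m" "m \<le> n" and x: "\<bar>x\<bar> \<le> 1"
  shows "wavg w n x \<le> rho m x / rho n x * wavg w m x"
proof -
  have \<rho>: "0 < rho m x" "0 < rho n x" using rho_pos m x by auto
  have "mass w (x - rho n x) (x + rho n x) \<le> mass w (x - rho m x) (x + rho m x)"
    using rho_antimono[OF m x] by (intro mass_mono[OF w]) auto
  then show ?thesis using \<rho> by (simp add: wavg_mass divide_right_mono)
qed

lemma wavg_le_4:
  assumes w: "doubling_weight w L" and m: "1 \<le> m" "m \<le> n" "n \<le> 2 * m" and x: "\<bar>x\<bar> \<le> 1"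
  shows "wavg w n x \<le> 4 * wavg w m x"
proof -
  have \<rho>: "0 < rho m x" "0 < rho n x" using rho_pos m x by auto
  have n: "0 < real n" "real n \<le> 2 * real m" "0 < real m" using m by auto
  have "phi x / real m \<le> 4 * (phi x / real n)"
  proof -
    have "1 / real m \<le> 2 / real n" using n by (simp add: field_simps)
    then have "phi x * (1 / real m) \<le> phi x * (2 / real n)"
      using phi_nonneg[OF x] by (intro mult_left_mono)
    also have "\<dots> \<le> 4 * (phi x / real n)" using phi_nonneg[OF x] n by (simp add: field_simps)
    finally show ?thesis by simp
  qed
  moreover have "1 / (real m)\<^sup>2 \<le> 4 * (1 / (real n)\<^sup>2)"
    using power_mono[OF n(2), of 2] n by (simp add: field_simps power_mult_distrib)
  ultimately have "rho m x \<le> 4 * rho n x" by (simp add: rho_eq_phi)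
  then have "rho m x / rho n x \<le> 4" using \<rho> by (simp add: field_simps)
  then have "rho m x / rho n x * wavg w m x \<le> 4 * wavg w m x"
    using wavg_nonneg[OF w m(1) x] by (rule mult_right_mono)
  with wavg_scale[OF w m(1,2) x] show ?thesis by simp
qed

text \<open>The weight is merely Lebesgue measurable, but its averages are built from the monotone
  distribution function and are Borel. This makes Tonelli's theorem applicable over
  \<open>lborel\<close>.\<close>

lemma borel_measurable_wavg:
  assumes w: "doubling_weight w L"
  shows "wavg w m \<in> borel_measurable borel"
proof -
  define F where "F = (\<lambda>s. LINT u:{..s}|lebesgue. w u)"
  have int: "set_integrable lebesgue A w" if "A \<in> sets lebesgue" for A
    using doubling_weight_set_integrable[OF w that] .
  have "mono F"
    unfolding F_def set_lebesgue_integral_def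
  proof (intro monoI integral_mono)
    fix x y :: real assume "x \<le> y"
    show "integrable lebesgue (\<lambda>u. indicator {..x} u *\<^sub>R w u)" "integrable lebesgue (\<lambda>u. indicator {..y} u *\<^sub>R w u)"
      using int[of "{..x}"] int[of "{..y}"] by (simp_all add: set_integrable_def)
    show "indicator {..x} u *\<^sub>R w u \<le> indicator {..y} u *\<^sub>R w u" for u
      using w \<open>x \<le> y\<close> by (auto simp: doubling_weight_def indicator_def)
  qed
  then have F [measurable]: "F \<in> borel_measurable borel" by (rule borel_measurable_mono)
  have eq: "mass w a b = (if a \<le> b then F b - F a else 0)" for a b
  proof (cases "a \<le> b")
    case True
    have "F b = (LINT u:{..a} \<union> {a<..b}|lebesgue. w u)"
      using True by (simp add: F_def ivl_disj_un)
    also have "\<dots> = F a + (LINT u:{a<..b}|lebesgue. w u)"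
      unfolding F_def by (rule set_integral_Un) (auto intro: int)
    also have "(LINT u:{a<..b}|lebesgue. w u) = mass w a b"
    proof -
      \<comment> \<open>Differences of the distribution function give half-open intervals; the
        missing endpoint is a null set.\<close>
      have "AE u in lebesgue. u \<noteq> a" by (intro AE_completion AE_lborel_singleton)
      then have ae: "AE u in lebesgue. indicator {a<..b} u *\<^sub>R w u = indicator {a..b} u *\<^sub>R w u"
        by eventually_elim (auto simp: indicator_def)
      show ?thesis
        unfolding mass_def set_lebesgue_integral_def
        using int[of "{a<..b}"] int[of "{a..b}"] ae by (intro integral_cong_AE) (auto simp: set_integrable_def)
    qed
    finally show ?thesis using True by simp
  qed (simp add: mass_def set_lebesgue_integral_def)
  show ?thesis unfolding wavg_mass[abs_def] eq by measurable
qed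

section \<open>Differences of polynomials in the weighted quasi-norm\<close>

lemma nn_integral_inverse_square_half:
  "(\<integral>\<^sup>+v\<in>{0..}. ennreal (1 / (1 + \<bar>v\<bar>)\<^sup>2) \<partial>lborel) = 1"
proof -
  have "(\<integral>\<^sup>+v\<in>{0..}. ennreal (1 / (1 + v)\<^sup>2) \<partial>lborel) = ennreal (0 - (- 1 / (1 + 0)))"
  proof (rule nn_integral_FTC_atLeast)
    show "((\<lambda>v. - 1 / (1 + v)) has_real_derivative 1 / (1 + v)\<^sup>2) (at v)" if "0 \<le> v" for v :: real
      using that by (auto intro!: derivative_eq_intros simp: power2_eq_square field_simps)
    show "((\<lambda>v::real. - 1 / (1 + v)) \<longlongrightarrow> 0) at_top"
      by (intro tendsto_divide_0[OF tendsto_const] filterlim_at_top_imp_at_infinity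
            filterlim_tendsto_add_at_top[OF tendsto_const] filterlim_ident)
  qed auto
  moreover have "(\<integral>\<^sup>+v\<in>{0..}. ennreal (1 / (1 + \<bar>v\<bar>)\<^sup>2) \<partial>lborel) = (\<integral>\<^sup>+v\<in>{0..}. ennreal (1 / (1 + v)\<^sup>2) \<partial>lborel)"
    by (intro nn_integral_cong) (auto split: split_indicator)
  ultimately show ?thesis by simp
qed

lemma nn_integral_inverse_square:
  "(\<integral>\<^sup>+v. ennreal (1 / (1 + \<bar>v\<bar>)\<^sup>2) \<partial>lborel) \<le> 2"
proof -
  let ?f = "\<lambda>v::real. ennreal (1 / (1 + \<bar>v\<bar>)\<^sup>2)"
  have "(\<integral>\<^sup>+v. ?f v \<partial>lborel) \<le> (\<integral>\<^sup>+v. ?f v * indicator {0..} v + ?f v * indicator {..0} v \<partial>lborel)"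
    by (intro nn_integral_mono) (auto split: split_indicator)
  also have "\<dots> = (\<integral>\<^sup>+v\<in>{0..}. ?f v \<partial>lborel) + (\<integral>\<^sup>+v\<in>{..0}. ?f v \<partial>lborel)"
    by (subst nn_integral_add) auto
  also have "(\<integral>\<^sup>+v\<in>{..0}. ?f v \<partial>lborel) = (\<integral>\<^sup>+v\<in>{0..}. ?f v \<partial>lborel)"
    by (subst nn_integral_real_affine[where c = "-1" and t = 0])
       (auto intro!: nn_integral_cong split: split_indicator)
  finally show ?thesis by (simp add: nn_integral_inverse_square_half)
qed

lemma nn_integral_inverse_square_scaled:
  assumes "0 < \<rho>"
  shows "(\<integral>\<^sup>+x. ennreal (1 / (1 + \<bar>x - u\<bar> / \<rho>)\<^sup>2 / \<rho>) \<partial>lborel) \<le> 2"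
proof -
  have "(\<integral>\<^sup>+x. ennreal (1 / (1 + \<bar>x - u\<bar> / \<rho>)\<^sup>2 / \<rho>) \<partial>lborel)
      = ennreal \<bar>\<rho>\<bar> * (\<integral>\<^sup>+v. ennreal (1 / (1 + \<bar>u + \<rho> * v - u\<bar> / \<rho>)\<^sup>2 / \<rho>) \<partial>lborel)"
    using assms by (intro nn_integral_real_affine) auto
  also have "\<dots> = (\<integral>\<^sup>+v. ennreal (1 / (1 + \<bar>v\<bar>)\<^sup>2) \<partial>lborel)"
    using assms by (subst nn_integral_cmult[symmetric]) (auto simp: abs_mult ennreal_mult[symmetric] intro!: nn_integral_cong)
  finally show ?thesis using nn_integral_inverse_square by simp
qed

text \<open>Named after Schur's test. The 2 is the integral of
  \<open>1 / (1 + \<bar>v\<bar>)^2\<close> over the line.\<close>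

definition schur_const :: "nat \<Rightarrow> real \<Rightarrow> real" where
  "schur_const D a = 2 * 8 ^ (D + 1) * 5 powr a"

lemma schur_const_pos: "0 < schur_const D a"
  by (simp add: schur_const_def)

text \<open>The weight grows with exponent \<open>D + 1\<close> and the kernel decays with exponent
  \<open>a \<ge> D + 3\<close>, so at least an inverse square remains; its scaled integral is
  bounded independently of \<open>u\<close> and \<open>m\<close>.\<close>

lemma wavg_kernel_integral_le:
  assumes w: "doubling_weight w L" and L: "1 \<le> L" "L\<^sup>2 \<le> 2 ^ D"
    and m: "1 \<le> m" and u: "\<bar>u\<bar> \<le> 1" and a: "real D + 3 \<le> a"
  shows "(\<integral>\<^sup>+x\<in>{-1..1}. ennreal (wavg w m x * ((5 / (1 + \<bar>x - u\<bar> / rho m u)) powr a / rho m u)) \<partial>lborel)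
     \<le> ennreal (schur_const D a * wavg w m u)"
proof -
  define \<rho> where "\<rho> = rho m u"
  have \<rho>: "0 < \<rho>" unfolding \<rho>_def by (rule rho_pos[OF m u])
  define C where "C = 8 ^ (D + 1) * 5 powr a * wavg w m u"
  have W: "0 \<le> wavg w m u" by (rule wavg_nonneg[OF w m u])
  have C: "0 \<le> C" using W by (simp add: C_def)
  have pointwise: "wavg w m x * ((5 / (1 + \<bar>x - u\<bar> / \<rho>)) powr a / \<rho>) \<le> C * (1 / (1 + \<bar>x - u\<bar> / \<rho>)\<^sup>2 / \<rho>)"
    if x: "\<bar>x\<bar> \<le> 1" for x
  proof -
    define Z where "Z = 1 + \<bar>x - u\<bar> / \<rho>"
    have Z: "1 \<le> Z" using \<rho> by (simp add: Z_def)
    have "wavg w m x * ((5 / Z) powr a / \<rho>) \<le> ((8 * Z) ^ (D + 1) * wavg w m u) * ((5 / Z) powr a / \<rho>)"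
      using wavg_compare[OF w L m x u] \<rho> by (intro mult_right_mono) (auto simp: Z_def \<rho>_def)
    also have "\<dots> = C * (Z powr real (D + 1) * Z powr (- a)) / \<rho>"
    proof -
      have "(5 / Z) powr a = 5 powr a * Z powr (- a)"
        using Z by (simp add: powr_divide powr_minus_divide)
      moreover have "(8 * Z) ^ (D + 1) = 8 ^ (D + 1) * Z powr real (D + 1)"
        using Z by (subst powr_realpow) (auto simp only: power_mult_distrib)
      ultimately show ?thesis unfolding C_def by (simp only: times_divide_eq_right mult_ac)
    qed
    also have "Z powr real (D + 1) * Z powr (- a) = Z powr (real (D + 1) - a)"
      by (simp flip: powr_add)
    also have "C * Z powr (real (D + 1) - a) / \<rho> \<le> C * Z powr (- 2) / \<rho>"
      using Z a C \<rho> by (intro divide_right_mono mult_left_mono powr_mono) auto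
    also have "Z powr (- 2) = 1 / Z\<^sup>2" using Z by (simp add: powr_minus_divide powr_numeral)
    finally show ?thesis by (simp add: Z_def)
  qed
  have "(\<integral>\<^sup>+x\<in>{-1..1}. ennreal (wavg w m x * ((5 / (1 + \<bar>x - u\<bar> / rho m u)) powr a / rho m u)) \<partial>lborel)
     \<le> (\<integral>\<^sup>+x. ennreal C * ennreal (1 / (1 + \<bar>x - u\<bar> / \<rho>)\<^sup>2 / \<rho>) \<partial>lborel)"
  proof (intro nn_integral_mono)
    fix x :: real
    show "ennreal (wavg w m x * ((5 / (1 + \<bar>x - u\<bar> / rho m u)) powr a / rho m u)) * indicator {-1..1} x
      \<le> ennreal C * ennreal (1 / (1 + \<bar>x - u\<bar> / \<rho>)\<^sup>2 / \<rho>)"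
    proof (cases "x \<in> {-1..1}")
      case True
      then have "ennreal (wavg w m x * ((5 / (1 + \<bar>x - u\<bar> / \<rho>)) powr a / \<rho>)) \<le> ennreal (C * (1 / (1 + \<bar>x - u\<bar> / \<rho>)\<^sup>2 / \<rho>))"
        by (intro ennreal_leI pointwise) auto
      then show ?thesis using True C \<rho> by (simp add: \<rho>_def ennreal_mult[symmetric])
    qed simp
  qed
  also have "\<dots> = ennreal C * (\<integral>\<^sup>+x. ennreal (1 / (1 + \<bar>x - u\<bar> / \<rho>)\<^sup>2 / \<rho>) \<partial>lborel)"
    by (rule nn_integral_cmult) auto
  also have "\<dots> \<le> ennreal C * 2"
    by (intro mult_left_mono nn_integral_inverse_square_scaled \<rho>) auto
  also have "\<dots> = ennreal (schur_const D a * wavg w m u)"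
  proof -
    have "schur_const D a * wavg w m u = C * 2" by (simp add: schur_const_def C_def)
    then show ?thesis using C by (simp add: ennreal_mult)
  qed
  finally show ?thesis .
qed

text \<open>The radius, in units of \<open>rho m x\<close>, of the disc to which
  \<open>polynomial_local_bound\<close> applies.\<close>

definition step_ratio :: "nat \<Rightarrow> real" where
  "step_ratio s = (1 / (4 * (real s + 1)))\<^sup>2 / 16"

lemma step_ratio_bounds: "0 < step_ratio s" "step_ratio s \<le> 1 / 256"
proof -
  have "0 < 1 / (4 * (real s + 1))" "1 / (4 * (real s + 1)) \<le> 1 / 4" by (auto simp: field_simps)
  then have "(1 / (4 * (real s + 1)))\<^sup>2 \<le> (1 / 4)\<^sup>2" by (intro power_mono) auto
  then show "step_ratio s \<le> 1 / 256" by (simp add: step_ratio_def power2_eq_square)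
  show "0 < step_ratio s" by (simp add: step_ratio_def)
qed

text \<open>
  Passing from \<open>w_n\<close> to \<open>w_m\<close> may cost a factor \<open>(n / m)\<^sup>2\<close> near the endpoints; there the smallness of
  the step \<open>h * phi x\<close> against \<open>rho m x\<close> compensates for it, because \<open>r * p \<ge> 1\<close>.
\<close>

lemma sym_diff_poly_pointwise:
  fixes Q :: "real poly"
  assumes w: "doubling_weight w L" and Q: "degree Q \<le> m" and m: "1 \<le> m" "m \<le> n"
    and p: "0 < p" "p \<le> 1" and r: "1 \<le> r" "1 \<le> real r * p"
    and h: "0 < h" "h \<le> step_ratio s / real r / real n" and x: "\<bar>x\<bar> \<le> 1"
  shows "ennreal (\<bar>sym_diff r (h * phi x) (poly Q) x\<bar> powr p * wavg w n x) \<le>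
     ennreal (2 * 2 ^ r * local_const s * (real m / real n) powr (real r * p - 1)) * (ennreal (wavg w m x) *
     (\<integral>\<^sup>+u\<in>{-1..1}. ennreal (\<bar>poly Q u\<bar> powr p * ((5 / (1 + \<bar>x - u\<bar> / rho m u)) powr (real s * p) / rho m u)) \<partial>lborel))"
    (is "_ \<le> _ * (_ * ?J)")
proof -
  define \<epsilon> where "\<epsilon> = step_ratio s"
  have \<epsilon>: "0 < \<epsilon>" "\<epsilon> \<le> 1 / 256" using step_ratio_bounds by (auto simp: \<epsilon>_def)
  have mn: "0 < real m" "real m \<le> real n" "0 < real n" "0 < real r" using m r by auto
  have \<rho>: "0 < rho m x" "0 < rho n x" using rho_pos m x by auto
  define R where "R = \<epsilon> * rho m x"
  have R: "0 < R" using \<epsilon> \<rho> by (simp add: R_def)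
  let ?D = "cball (of_real x) R :: complex set"
  have "of_real x \<in> ?D" using R by simp
  then have "?D \<noteq> {}" by blast
  then have "\<exists>y\<in>?D. \<forall>z\<in>?D. norm (poly (cpoly Q) z) \<le> norm (poly (cpoly Q) y)"
    by (intro continuous_attains_sup continuous_intros compact_cball)
  then obtain y where y: "norm (y - of_real x) \<le> R"
    and ymax: "\<And>z. norm (z - of_real x) \<le> R \<Longrightarrow> norm (poly (cpoly Q) z) \<le> norm (poly (cpoly Q) y)"
    by (auto simp: dist_norm norm_minus_commute)
  define B where "B = norm (poly (cpoly Q) y)"
  have B0: "0 \<le> B" by (simp add: B_def)
  have BJ: "ennreal (B powr p) \<le> ennreal (local_const s) * ?J"
    using polynomial_local_bound[OF Q m(1) x p, of y s] y
    by (simp add: B_def R_def \<epsilon>_def step_ratio_def)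
  define \<eta> where "\<eta> = h * phi x"
  have \<eta>: "0 \<le> \<eta>" using h phi_nonneg[OF x] by (simp add: \<eta>_def)
  have rh: "real r * h * real n \<le> \<epsilon>" using h mn by (simp add: \<epsilon>_def field_simps)
  \<comment> \<open>This ratio plays three roles: the total step is at most
    \<open>\<tau> * R\<close>, \<tau> is at most \<open>m / n\<close>, and
    \<open>rho m x / rho n x\<close> is at most \<open>1 / \<tau>\<close>.\<close>
  define \<tau> where "\<tau> = phi x / (real n * rho m x)"
  have \<tau>0: "0 \<le> \<tau>" using phi_nonneg[OF x] \<rho> by (simp add: \<tau>_def)
  have "phi x \<le> real m * rho m x" using mn by (simp add: rho_eq_phi field_simps)
  then have \<tau>m: "\<tau> \<le> real m / real n"
    using \<rho> mn by (simp add: \<tau>_def field_simps)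
  have eta_tau: "real r * \<eta> \<le> \<tau> * R"
  proof -
    have "\<tau> * R = \<epsilon> * (phi x / real n)" using \<rho> by (simp add: \<tau>_def R_def)
    moreover have "real r * \<eta> = (real r * h * real n) * (phi x / real n)" using mn by (simp add: \<eta>_def)
    moreover have "(real r * h * real n) * (phi x / real n) \<le> \<epsilon> * (phi x / real n)"
      using rh phi_nonneg[OF x] mn by (intro mult_right_mono) auto
    ultimately show ?thesis by simp
  qed
  have "\<tau> \<le> 1" using \<tau>m mn by (simp add: order_trans[of _ "real m / real n"])
  then have "\<tau> * R \<le> 1 * R" using R by (intro mult_right_mono) auto
  then have r\<eta>: "real r * \<eta> \<le> R" using eta_tau by simp
  have s1: "\<bar>\<Sum>i=0..r. real (r choose i) * (-1)^(r - i) * poly Q (x - real r * \<eta> / 2 + real i * \<eta>)\<bar>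
         \<le> 2 * 2 ^ r * (real r * \<eta> / (2 * R)) ^ r * B"
    using ymax R \<eta> r\<eta> by (intro abs_binomial_diff_poly_le) (auto simp: B_def)
  have "(real r * \<eta> / (2 * R)) ^ r \<le> \<tau> ^ r"
  proof (rule power_mono)
    have "real r * \<eta> / (2 * R) \<le> \<tau> * R / (1 * R)"
      using eta_tau R \<eta> \<tau>0 by (intro frac_le) auto
    then show "real r * \<eta> / (2 * R) \<le> \<tau>" using R by simp
  qed (use \<eta> R in auto)
  then have s2: "2 * 2 ^ r * (real r * \<eta> / (2 * R)) ^ r * B \<le> 2 * 2 ^ r * \<tau> ^ r * B"
    using B0 by (intro mult_right_mono mult_left_mono) auto
  have s3: "0 \<le> 2 * 2 ^ r * \<tau> ^ r * B" using \<tau>0 B0 by simp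
  have "\<bar>sym_diff r \<eta> (poly Q) x\<bar> \<le> 2 * 2 ^ r * \<tau> ^ r * B"
    using order_trans[OF s1 s2] s3 by (simp only: sym_diff_def split: if_split) simp
  then have "\<bar>sym_diff r \<eta> (poly Q) x\<bar> powr p \<le> (2 * 2 ^ r * \<tau> ^ r * B) powr p"
    using p by (intro powr_mono2) auto
  also have "\<dots> = (2 * 2 ^ r) powr p * (\<tau> ^ r) powr p * B powr p"
    using \<tau>0 B0 by (simp add: powr_mult)
  also have "\<dots> \<le> (2 * 2 ^ r) * (\<tau> ^ r) powr p * B powr p"
  proof (intro mult_right_mono)
    have "1 \<le> 2 * (2::real) ^ r" using one_le_power[of "2::real" r] by linarith
    then have "(2 * (2::real) ^ r) powr p \<le> (2 * 2 ^ r) powr 1" using p by (intro powr_mono) auto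
    then show "(2 * (2::real) ^ r) powr p \<le> 2 * 2 ^ r" by simp
  qed auto
  finally have \<Delta>: "\<bar>sym_diff r \<eta> (poly Q) x\<bar> powr p \<le> (2 * 2 ^ r) * (\<tau> ^ r) powr p * B powr p" .
  have Wm: "0 \<le> wavg w m x" by (rule wavg_nonneg[OF w m(1) x])
  have Wn: "0 \<le> wavg w n x" using m by (intro wavg_nonneg[OF w _ x]) simp
  \<comment> \<open>Gain \<open>\<tau> powr (r * p)\<close> against loss \<open>1 / \<tau>\<close>.
    Zeros of \<open>phi\<close>, that is the endpoints, are treated apart because \<tau> vanishes
    there.\<close>
  have key: "(\<tau> ^ r) powr p * wavg w n x \<le> (real m / real n) powr (real r * p - 1) * wavg w m x"
  proof (cases "phi x = 0")
    case True
    then show ?thesis using Wm r by (simp add: \<tau>_def power_0_left)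
  next
    case False
    then have ph: "0 < phi x" using phi_nonneg[OF x] by simp
    then have \<tau>: "0 < \<tau>" using mn \<rho> by (simp add: \<tau>_def)
    have "rho m x / rho n x \<le> rho m x / (phi x / real n)"
      using \<rho> ph mn by (intro divide_left_mono) (auto simp: rho_eq_phi)
    also have "\<dots> = 1 / \<tau>" by (simp add: \<tau>_def)
    finally have "wavg w n x \<le> 1 / \<tau> * wavg w m x"
      using wavg_scale[OF w m x] mult_right_mono[OF _ Wm] by (meson order_trans)
    then have "(\<tau> ^ r) powr p * wavg w n x \<le> (\<tau> ^ r) powr p * (1 / \<tau> * wavg w m x)"
      by (intro mult_left_mono) auto
    also have "\<dots> = \<tau> powr (real r * p - 1) * wavg w m x"
      using \<tau> by (simp add: powr_diff powr_powr flip: powr_realpow)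
    also have "\<dots> \<le> (real m / real n) powr (real r * p - 1) * wavg w m x"
      using \<tau>m \<tau> r Wm by (intro mult_right_mono powr_mono2) auto
    finally show ?thesis .
  qed
  have "\<bar>sym_diff r \<eta> (poly Q) x\<bar> powr p * wavg w n x \<le> (2 * 2 ^ r) * (\<tau> ^ r) powr p * B powr p * wavg w n x"
    using \<Delta> Wn by (rule mult_right_mono)
  also have "\<dots> = (2 * 2 ^ r) * B powr p * ((\<tau> ^ r) powr p * wavg w n x)" by simp
  also have "\<dots> \<le> (2 * 2 ^ r) * B powr p * ((real m / real n) powr (real r * p - 1) * wavg w m x)"
    using key by (intro mult_left_mono) auto
  finally have "ennreal (\<bar>sym_diff r \<eta> (poly Q) x\<bar> powr p * wavg w n x) \<le>
     ennreal ((2 * 2 ^ r) * B powr p * ((real m / real n) powr (real r * p - 1) * wavg w m x))"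
    by (rule ennreal_leI)
  also have "\<dots> = ennreal (2 * 2 ^ r) * ennreal (B powr p) * (ennreal ((real m / real n) powr (real r * p - 1)) * ennreal (wavg w m x))"
    using Wm by (simp only: ennreal_mult powr_ge_zero mult_nonneg_nonneg zero_le_numeral zero_le_power)
  also have "\<dots> \<le> ennreal (2 * 2 ^ r) * (ennreal (local_const s) * ?J) * (ennreal ((real m / real n) powr (real r * p - 1)) * ennreal (wavg w m x))"
    by (intro mult_left_mono mult_right_mono BJ) auto
  also have "\<dots> = ennreal (2 * 2 ^ r * local_const s * (real m / real n) powr (real r * p - 1)) * (ennreal (wavg w m x) * ?J)"
  proof -
    have "ennreal (2 * 2 ^ r * local_const s * (real m / real n) powr (real r * p - 1)) =
      ennreal (2 * 2 ^ r) * ennreal (local_const s) * ennreal ((real m / real n) powr (real r * p - 1))"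
      using local_const_pos[of s]
      by (simp only: ennreal_mult powr_ge_zero mult_nonneg_nonneg zero_le_numeral zero_le_power less_imp_le)
    then show ?thesis by (simp only: mult_ac)
  qed
  finally show ?thesis by (simp only: \<eta>_def)
qed

text \<open>After the exchange of integrals \<open>x\<close> is integrated first: for fixed
  \<open>u\<close> the kernel integrated against \<open>wavg w m\<close> reproduces
  \<open>wavg w m u\<close> up to a constant.\<close>

lemma sym_diff_poly_le:
  fixes Q :: "real poly"
  assumes w: "doubling_weight w L" and L: "1 \<le> L" "L\<^sup>2 \<le> 2 ^ D"
    and Q: "degree Q \<le> m" and m: "1 \<le> m" "m \<le> n"
    and p: "0 < p" "p \<le> 1" and r: "1 \<le> r" "1 \<le> real r * p"
    and s: "real D + 3 \<le> real s * p"
    and h: "0 < h" "h \<le> step_ratio s / real r / real n"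
  shows "(\<integral>\<^sup>+x\<in>{-1..1}. ennreal (\<bar>sym_diff r (h * phi x) (poly Q) x\<bar> powr p * wavg w n x) \<partial>lborel) \<le>
     ennreal (2 * 2 ^ r * local_const s * schur_const D (real s * p) * (real m / real n) powr (real r * p - 1)) *
     (\<integral>\<^sup>+u\<in>{-1..1}. ennreal (\<bar>poly Q u\<bar> powr p * wavg w m u) \<partial>lborel)"
proof -
  define A where "A = 2 * 2 ^ r * local_const s * (real m / real n) powr (real r * p - 1)"
  have A: "0 \<le> A" using local_const_pos[of s] by (simp add: A_def)
  note [measurable] = borel_measurable_wavg[OF w]
  define K where "K = (\<lambda>x u. (5 / (1 + \<bar>x - u\<bar> / rho m u)) powr (real s * p) / rho m u)"
  have [measurable]: "(\<lambda>(x, u). K x u) \<in> borel_measurable (lborel \<Otimes>\<^sub>M lborel)"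
    "\<And>x. K x \<in> borel_measurable borel" "\<And>u. (\<lambda>x. K x u) \<in> borel_measurable borel"
    unfolding K_def by measurable
  define G where "G = (\<lambda>x u. ennreal (wavg w m x) * (ennreal (\<bar>poly Q u\<bar> powr p * K x u) * indicator {-1..1} u) * indicator {-1..1} x)"
  have G [measurable]: "(\<lambda>(x, u). G x u) \<in> borel_measurable (lborel \<Otimes>\<^sub>M lborel)"
    unfolding G_def by measurable
  have "(\<integral>\<^sup>+x\<in>{-1..1}. ennreal (\<bar>sym_diff r (h * phi x) (poly Q) x\<bar> powr p * wavg w n x) \<partial>lborel)
     \<le> (\<integral>\<^sup>+x. ennreal A * (\<integral>\<^sup>+u. G x u \<partial>lborel) \<partial>lborel)"
  proof (intro nn_integral_mono)
    fix x :: real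
    show "ennreal (\<bar>sym_diff r (h * phi x) (poly Q) x\<bar> powr p * wavg w n x) * indicator {-1..1} x
       \<le> ennreal A * (\<integral>\<^sup>+u. G x u \<partial>lborel)"
    proof (cases "x \<in> {-1..1}")
      case True
      then have x: "\<bar>x\<bar> \<le> 1" by auto
      have "(\<integral>\<^sup>+u. G x u \<partial>lborel) = ennreal (wavg w m x) * (\<integral>\<^sup>+u\<in>{-1..1}. ennreal (\<bar>poly Q u\<bar> powr p * K x u) \<partial>lborel)"
        using True unfolding G_def by (simp add: nn_integral_cmult)
      then show ?thesis
        using sym_diff_poly_pointwise[OF w Q m p r h x] True by (simp add: A_def K_def)
    qed simp
  qed
  also have "\<dots> = ennreal A * (\<integral>\<^sup>+x. (\<integral>\<^sup>+u. G x u \<partial>lborel) \<partial>lborel)"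
    by (rule nn_integral_cmult) measurable
  also have "(\<integral>\<^sup>+x. (\<integral>\<^sup>+u. G x u \<partial>lborel) \<partial>lborel) = (\<integral>\<^sup>+u. (\<integral>\<^sup>+x. G x u \<partial>lborel) \<partial>lborel)"
    by (rule lborel_pair.Fubini'[symmetric]) measurable
  also have "\<dots> \<le> (\<integral>\<^sup>+u. ennreal (schur_const D (real s * p)) * (ennreal (\<bar>poly Q u\<bar> powr p * wavg w m u) * indicator {-1..1} u) \<partial>lborel)"
  proof (intro nn_integral_mono)
    fix u :: real
    show "(\<integral>\<^sup>+x. G x u \<partial>lborel) \<le> ennreal (schur_const D (real s * p)) * (ennreal (\<bar>poly Q u\<bar> powr p * wavg w m u) * indicator {-1..1} u)"
    proof (cases "u \<in> {-1..1}")
      case True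
      then have u: "\<bar>u\<bar> \<le> 1" by auto
      have K0: "0 \<le> K x u" for x using rho_pos[OF m(1) u] by (simp add: K_def)
      have "(\<integral>\<^sup>+x. G x u \<partial>lborel) = (\<integral>\<^sup>+x. ennreal (\<bar>poly Q u\<bar> powr p) * (ennreal (wavg w m x * K x u) * indicator {-1..1} x) \<partial>lborel)"
      proof (intro nn_integral_cong)
        fix x :: real
        show "G x u = ennreal (\<bar>poly Q u\<bar> powr p) * (ennreal (wavg w m x * K x u) * indicator {-1..1} x)"
          using True K0[of x] wavg_nonneg[OF w m(1), of x]
          by (auto simp: G_def ennreal_mult mult_ac split: split_indicator)
      qed
      also have "\<dots> = ennreal (\<bar>poly Q u\<bar> powr p) * (\<integral>\<^sup>+x\<in>{-1..1}. ennreal (wavg w m x * K x u) \<partial>lborel)"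
        by (rule nn_integral_cmult) measurable
      also have "\<dots> \<le> ennreal (\<bar>poly Q u\<bar> powr p) * ennreal (schur_const D (real s * p) * wavg w m u)"
        unfolding K_def by (intro mult_left_mono wavg_kernel_integral_le[OF w L m(1) u s]) auto
      also have "\<dots> = ennreal (schur_const D (real s * p)) * (ennreal (\<bar>poly Q u\<bar> powr p * wavg w m u) * indicator {-1..1} u)"
        using True wavg_nonneg[OF w m(1) u] schur_const_pos[of D "real s * p"]
        by (simp add: ennreal_mult mult_ac)
      finally show ?thesis .
    qed (simp add: G_def)
  qed
  also have "\<dots> = ennreal (schur_const D (real s * p)) * (\<integral>\<^sup>+u\<in>{-1..1}. ennreal (\<bar>poly Q u\<bar> powr p * wavg w m u) \<partial>lborel)"
    by (rule nn_integral_cmult) measurable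
  finally have "(\<integral>\<^sup>+x\<in>{-1..1}. ennreal (\<bar>sym_diff r (h * phi x) (poly Q) x\<bar> powr p * wavg w n x) \<partial>lborel)
     \<le> ennreal A * (ennreal (schur_const D (real s * p)) * (\<integral>\<^sup>+u\<in>{-1..1}. ennreal (\<bar>poly Q u\<bar> powr p * wavg w m u) \<partial>lborel))"
    by (simp add: mult_left_mono)
  also have "\<dots> = ennreal (A * schur_const D (real s * p)) * (\<integral>\<^sup>+u\<in>{-1..1}. ennreal (\<bar>poly Q u\<bar> powr p * wavg w m u) \<partial>lborel)"
    using A schur_const_pos[of D "real s * p"] by (simp add: ennreal_mult mult_ac)
  also have "A * schur_const D (real s * p) = 2 * 2 ^ r * local_const s * schur_const D (real s * p) * (real m / real n) powr (real r * p - 1)"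
    by (simp add: A_def)
  finally show ?thesis .
qed

section \<open>Differences of arbitrary functions\<close>

text \<open>
  The points where a symmetric difference of total step \<open>2 * \<kappa> * phi x\<close> is not set to zero. The endpoints,
  at which the step vanishes, are left out.
\<close>

definition shift_domain :: "real \<Rightarrow> real set" where
  "shift_domain \<kappa> = {x. \<bar>x\<bar> < 1 \<and> \<bar>x\<bar> + \<kappa> * phi x \<le> 1}"

lemma shift_domain_borel [measurable]: "shift_domain \<kappa> \<in> sets borel"
  unfolding shift_domain_def by measurable

text \<open>The derivative of the substitution is \<open>1 - c * x / phi x\<close>. On the domain
  \<open>phi x \<ge> \<kappa> * (1 + \<bar>x\<bar>)\<close>, which is at least
  \<open>2 * \<kappa> * \<bar>x\<bar>\<close>, so the subtracted quotient is at most 1/2.\<close>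

lemma shift_nn_integral_le:
  fixes F :: "real \<Rightarrow> ennreal"
  assumes [measurable]: "F \<in> borel_measurable borel"
    and \<kappa>: "0 < \<kappa>" "\<kappa> < 1" and c: "\<bar>c\<bar> \<le> \<kappa>"
  shows "(\<integral>\<^sup>+x\<in>shift_domain \<kappa>. F (x + c * phi x) \<partial>lborel) \<le> 2 * (\<integral>\<^sup>+u\<in>{-1..1}. F u \<partial>lborel)"
proof -
  \<comment> \<open>The solution of \<open>x + \<kappa> * phi x = 1\<close> other than 1: squaring
    \<open>1 - x = \<kappa> * phi x\<close> and cancelling \<open>1 - x\<close> leaves a linear
    equation.\<close>
  define X where "X = (1 - \<kappa>\<^sup>2) / (1 + \<kappa>\<^sup>2)"
  have k2: "0 < 1 + \<kappa>\<^sup>2" "0 < \<kappa>\<^sup>2" "\<kappa>\<^sup>2 < 1"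
    using \<kappa> by (auto simp: add_pos_nonneg power_less_one_iff)
  have "0 < X" unfolding X_def by (rule divide_pos_pos) (use k2 in linarith)+
  moreover have "X < 1" unfolding X_def by (subst pos_divide_less_eq[OF k2(1)], unfold mult_1) (use k2 in linarith)
  ultimately have X: "0 < X" "X < 1" .
  have X_iff: "\<bar>x\<bar> \<le> X \<longleftrightarrow> \<kappa>\<^sup>2 * (1 + \<bar>x\<bar>) \<le> 1 - \<bar>x\<bar>" for x
  proof -
    have "\<bar>x\<bar> * (1 + \<kappa>\<^sup>2) = \<bar>x\<bar> + \<kappa>\<^sup>2 * \<bar>x\<bar>" by (simp add: distrib_left mult.commute)
    moreover have "\<kappa>\<^sup>2 * (1 + \<bar>x\<bar>) = \<kappa>\<^sup>2 + \<kappa>\<^sup>2 * \<bar>x\<bar>" by (simp add: distrib_left)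
    moreover have "a + t \<le> 1 - k \<longleftrightarrow> k + t \<le> 1 - a" for a t k :: real by linarith
    ultimately show ?thesis
      unfolding X_def pos_le_divide_eq[OF k2(1)] by (simp only:)
  qed
  have sub: "\<bar>x\<bar> \<le> X" if "x \<in> shift_domain \<kappa>" for x
  proof -
    have x: "\<bar>x\<bar> < 1" "\<kappa> * phi x \<le> 1 - \<bar>x\<bar>" using that by (auto simp: shift_domain_def)
    then have "(\<kappa> * phi x)\<^sup>2 \<le> (1 - \<bar>x\<bar>)\<^sup>2" using \<kappa> phi_nonneg[of x] by (intro power_mono) auto
    then have "\<kappa>\<^sup>2 * (1 - \<bar>x\<bar>\<^sup>2) \<le> (1 - \<bar>x\<bar>)\<^sup>2" using x by (simp add: power_mult_distrib phi_sq)
    then have "(1 - \<bar>x\<bar>) * (\<kappa>\<^sup>2 * (1 + \<bar>x\<bar>)) \<le> (1 - \<bar>x\<bar>) * (1 - \<bar>x\<bar>)"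
      by (simp add: power2_eq_square algebra_simps)
    then show ?thesis unfolding X_iff using x by simp
  qed
  have one_minus_sq: "1 - x\<^sup>2 = (1 - \<bar>x\<bar>) * (1 + \<bar>x\<bar>)" for x :: real
    by (simp add: power2_eq_square ring_distribs)
  have phi_ge: "\<kappa> * (1 + \<bar>x\<bar>) \<le> phi x" if "\<bar>x\<bar> \<le> X" for x
  proof (rule power2_le_imp_le)
    have x1: "\<bar>x\<bar> \<le> 1" using that X by linarith
    show "0 \<le> phi x" by (rule phi_nonneg[OF x1])
    have "(\<kappa> * (1 + \<bar>x\<bar>))\<^sup>2 = (\<kappa>\<^sup>2 * (1 + \<bar>x\<bar>)) * (1 + \<bar>x\<bar>)"
      by (simp only: power2_eq_square mult_ac)
    also have "\<dots> \<le> (1 - \<bar>x\<bar>) * (1 + \<bar>x\<bar>)"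
      by (rule mult_right_mono[OF that[unfolded X_iff]]) simp
    finally show "(\<kappa> * (1 + \<bar>x\<bar>))\<^sup>2 \<le> (phi x)\<^sup>2" by (simp only: phi_sq[OF x1] one_minus_sq)
  qed
  have phi_pos: "0 < phi x" if "\<bar>x\<bar> \<le> X" for x
  proof -
    have "0 < \<kappa> * (1 + \<bar>x\<bar>)" using \<kappa> by (intro mult_pos_pos add_pos_nonneg) auto
    then show ?thesis using phi_ge[OF that] by linarith
  qed
  have phi_le: "\<kappa> * phi x \<le> 1 - \<bar>x\<bar>" if "\<bar>x\<bar> \<le> X" for x
  proof (rule power2_le_imp_le)
    have x1: "\<bar>x\<bar> \<le> 1" using that X by linarith
    then show "0 \<le> 1 - \<bar>x\<bar>" by linarith
    have "(\<kappa> * phi x)\<^sup>2 = (1 - \<bar>x\<bar>) * (\<kappa>\<^sup>2 * (1 + \<bar>x\<bar>))"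
      by (simp only: power_mult_distrib phi_sq[OF x1] one_minus_sq mult_ac)
    also have "\<dots> \<le> (1 - \<bar>x\<bar>) * (1 - \<bar>x\<bar>)"
      by (rule mult_left_mono[OF that[unfolded X_iff]]) (use x1 in linarith)
    finally show "(\<kappa> * phi x)\<^sup>2 \<le> (1 - \<bar>x\<bar>)\<^sup>2" by (simp only: power2_eq_square)
  qed
  let ?g = "\<lambda>x. x + c * phi x" and ?g' = "\<lambda>x. 1 - c * x / phi x"
  have g'_ge: "1 / 2 \<le> ?g' x" if "\<bar>x\<bar> \<le> X" for x
  proof -
    have "\<bar>c\<bar> * \<bar>x\<bar> \<le> \<kappa> * \<bar>x\<bar>" using c by (intro mult_right_mono) auto
    moreover have "\<bar>x\<bar> \<le> X" "X < 1" using that X by auto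
    then have "2 * (\<kappa> * \<bar>x\<bar>) \<le> \<kappa> * (1 + \<bar>x\<bar>)" using \<kappa> by (simp add: algebra_simps)
    ultimately have "2 * (\<bar>c\<bar> * \<bar>x\<bar>) \<le> phi x" using phi_ge[OF that] by linarith
    moreover have "c * x \<le> \<bar>c\<bar> * \<bar>x\<bar>" by (simp only: abs_mult[symmetric] abs_ge_self)
    ultimately show ?thesis using phi_pos[OF that] by (simp add: field_simps)
  qed
  have g_in: "\<bar>?g x\<bar> \<le> 1" if "\<bar>x\<bar> \<le> X" for x
  proof -
    have "\<bar>c * phi x\<bar> \<le> \<kappa> * phi x"
      using c phi_pos[OF that] by (simp add: abs_mult mult_right_mono)
    then show ?thesis using phi_le[OF that] abs_triangle_ineq[of x "c * phi x"] by linarith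
  qed
  have "(\<integral>\<^sup>+x\<in>shift_domain \<kappa>. F (x + c * phi x) \<partial>lborel) \<le> (\<integral>\<^sup>+x. 2 * (F (?g x) * ennreal (?g' x) * indicator {-X..X} x) \<partial>lborel)"
  proof (intro nn_integral_mono)
    fix x :: real
    show "F (x + c * phi x) * indicator (shift_domain \<kappa>) x \<le> 2 * (F (?g x) * ennreal (?g' x) * indicator {-X..X} x)"
    proof (cases "x \<in> shift_domain \<kappa>")
      case True
      then have x: "\<bar>x\<bar> \<le> X" by (rule sub)
      have "1 = ennreal (2 * (1 / 2))" by simp
      also have "\<dots> \<le> ennreal (2 * ?g' x)" by (intro ennreal_leI mult_left_mono g'_ge[OF x]) simp
      also have "\<dots> = 2 * ennreal (?g' x)" by (subst ennreal_mult) (use order_trans[OF _ g'_ge[OF x], of 0] in auto)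
      finally have "F (?g x) * 1 \<le> F (?g x) * (2 * ennreal (?g' x))" by (rule mult_left_mono) simp
      then show ?thesis using True x by (simp add: mult_ac abs_le_iff)
    qed simp
  qed
  also have "\<dots> = 2 * (\<integral>\<^sup>+x. F (?g x) * ennreal (?g' x) * indicator {-X..X} x \<partial>lborel)"
    by (rule nn_integral_cmult) measurable
  also have "(\<integral>\<^sup>+x. F (?g x) * ennreal (?g' x) * indicator {-X..X} x \<partial>lborel) =
      (\<integral>\<^sup>+u. F u * indicator {?g (-X)..?g X} u \<partial>lborel)"
  proof (rule nn_integral_substitution_aux[symmetric])
    fix x assume "x \<in> {-X..X}"
    then have x: "\<bar>x\<bar> \<le> X" by auto
    show "0 \<le> ?g' x" by (rule order_trans[OF _ g'_ge[OF x]]) simp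
    have "0 < 1 - x\<^sup>2" using phi_pos[OF x] unfolding phi_def real_sqrt_gt_0_iff .
    then have d2: "(sqrt has_real_derivative inverse (sqrt (1 - x\<^sup>2)) / 2) (at (1 - x\<^sup>2))"
      by (rule DERIV_real_sqrt)
    have d1: "((\<lambda>x. 1 - x\<^sup>2) has_real_derivative - (2 * x)) (at x)"
      by (auto intro!: derivative_eq_intros)
    have "((\<lambda>x. sqrt (1 - x\<^sup>2)) has_real_derivative inverse (sqrt (1 - x\<^sup>2)) / 2 * (- (2 * x))) (at x)"
      by (rule DERIV_chain2[OF d2 d1])
    then have "(phi has_real_derivative - x / phi x) (at x)"
      unfolding phi_def[abs_def] by (rule DERIV_cong) (simp add: inverse_eq_divide)
    then have "(?g has_real_derivative 1 + c * (- x / phi x)) (at x)"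
      by (intro DERIV_add[OF DERIV_ident] DERIV_cmult)
    then show "(?g has_real_derivative ?g' x) (at x)" by simp
  next
    show "continuous_on {-X..X} ?g'"
    proof -
      have "continuous_on {-X..X} phi" unfolding phi_def[abs_def] by (intro continuous_intros)
      moreover have "phi x \<noteq> 0" if "x \<in> {-X..X}" for x
        using phi_pos[of x] that by (auto simp: abs_le_iff)
      ultimately show ?thesis by (intro continuous_on_diff continuous_on_divide continuous_on_mult continuous_on_const continuous_on_id) auto
    qed
  qed (use X in auto)
  also have "\<dots> \<le> (\<integral>\<^sup>+u\<in>{-1..1}. F u \<partial>lborel)"
  proof (intro nn_integral_mono mult_left_mono)
    have "-1 \<le> ?g (-X)" "?g X \<le> 1" using g_in[of X] g_in[of "-X"] X by (auto simp: abs_le_iff)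
    then show "indicator {?g (-X)..?g X} u \<le> (indicator {-1..1} u :: ennreal)" for u
      by (auto simp: indicator_def)
  qed simp
  finally show ?thesis by (simp add: mult_left_mono)
qed

text \<open>The substitution pulls null sets back to null sets. Hence differences ignore changes on
  a null set, and a Lebesgue measurable function may be replaced by a Borel one.\<close>

lemma AE_shift_notin:
  assumes N: "N \<in> null_sets lborel" and \<kappa>: "0 < \<kappa>" "\<kappa> < 1" and c: "\<bar>c\<bar> \<le> \<kappa>"
  shows "AE x in lborel. x \<in> shift_domain \<kappa> \<longrightarrow> x + c * phi x \<notin> N"
proof -
  have [measurable]: "N \<in> sets borel" using N by auto
  have "(\<integral>\<^sup>+x\<in>shift_domain \<kappa>. indicator N (x + c * phi x) \<partial>lborel) \<le> 2 * (\<integral>\<^sup>+u\<in>{-1..1}. indicator N u \<partial>lborel)"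
    by (rule shift_nn_integral_le[OF _ \<kappa> c]) measurable
  also have "(\<integral>\<^sup>+u\<in>{-1..1}. indicator N u \<partial>lborel) = 0"
    using AE_not_in[OF N] by (subst nn_integral_0_iff_AE) (auto elim!: eventually_mono)
  finally have "(\<integral>\<^sup>+x\<in>shift_domain \<kappa>. indicator N (x + c * phi x) \<partial>lborel) = 0" by simp
  then have "AE x in lborel. indicator N (x + c * phi x) * indicator (shift_domain \<kappa>) x = (0::ennreal)"
    by (subst (asm) nn_integral_0_iff_AE) measurable
  then show ?thesis by eventually_elim (auto split: split_indicator_asm)
qed

lemma sym_diff_shift:
  assumes "0 < h" and x: "\<bar>x\<bar> < 1"
  shows "sym_diff r (h * phi x) f x =
    (if x \<in> shift_domain (real r * h / 2) then \<Sum>i=0..r. real (r choose i) * (-1)^(r - i) * f (x + (real i - real r / 2) * h * phi x) else 0)"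
proof -
  have "0 \<le> real r * (h * phi x) / 2" using assms phi_nonneg[of x] by simp
  then have cond: "(x - real r * (h * phi x) / 2 \<in> {-1..1} \<and> x + real r * (h * phi x) / 2 \<in> {-1..1}) \<longleftrightarrow>
     \<bar>x\<bar> + real r * (h * phi x) / 2 \<le> 1"
    by (auto simp: abs_le_iff abs_if)
  have arg: "x - real r * (h * phi x) / 2 + real i * (h * phi x) = x + (real i - real r / 2) * h * phi x" for i
    by (simp add: algebra_simps)
  show ?thesis using x unfolding sym_diff_def cond arg shift_domain_def by (simp add: mult.assoc)
qed

text \<open>The power \<open>p\<close> of the quasi-norm. Unlike the quasi-norm it is subadditive
  for \<open>p \<le> 1\<close>, so all estimates are made for it and the root is taken last.\<close>

definition wint :: "real \<Rightarrow> (real \<Rightarrow> real) \<Rightarrow> (real \<Rightarrow> real) \<Rightarrow> ennreal" where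
  "wint p v g = (\<integral>\<^sup>+x\<in>{-1..1}. ennreal (\<bar>g x\<bar> powr p * v x) \<partial>lborel)"

lemma AE_abs_less_1: "AE x in lborel. x \<in> {-1..1} \<longrightarrow> \<bar>x\<bar> < (1::real)"
proof -
  have "AE x in lborel. x \<noteq> (1::real)" "AE x in lborel. x \<noteq> (-1::real)" by (rule AE_lborel_singleton)+
  then show ?thesis by eventually_elim auto
qed

text \<open>Every node \<open>u\<close> satisfies
  \<open>\<bar>x - u\<bar> \<le> 2 * rho n u\<close>, so moving the weight from \<open>x\<close> to
  \<open>u\<close> costs at most \<open>(8 * 3) ^ (D + 1)\<close>. The substitution contributes 2
  and the binomial coefficients sum to \<open>2 ^ r\<close>.\<close>

lemma sym_diff_wint_le:
  assumes w: "doubling_weight w L" and L: "1 \<le> L" "L\<^sup>2 \<le> 2 ^ D"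
    and n: "1 \<le> n" and p: "0 < p" "p \<le> 1" and r: "1 \<le> r"
    and h: "0 < h" "real r * h * real n \<le> 1" and g [measurable]: "g \<in> borel_measurable borel"
  shows "wint p (wavg w n) (\<lambda>x. sym_diff r (h * phi x) g x) \<le> ennreal (2 * 2 ^ r * 24 ^ (D + 1)) * wint p (wavg w n) g"
proof -
  note [measurable] = borel_measurable_wavg[OF w]
  define \<kappa> where "\<kappa> = real r * h / 2"
  have rh: "real r * h \<le> 1"
    using h n mult_left_mono[of 1 "real n" "real r * h"] by simp
  have \<kappa>: "0 < \<kappa>" "\<kappa> < 1" using h r rh by (auto simp: \<kappa>_def)
  define c where "c = (\<lambda>i. (real i - real r / 2) * h)"
  have c: "\<bar>c i\<bar> \<le> \<kappa>" if "i \<le> r" for i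
  proof -
    have "\<bar>real i - real r / 2\<bar> \<le> real r / 2" using that by (auto simp: abs_le_iff field_simps)
    then have "\<bar>real i - real r / 2\<bar> * h \<le> real r / 2 * h" using h by (intro mult_right_mono) auto
    then show ?thesis using h by (simp add: c_def \<kappa>_def abs_mult)
  qed
  define F where "F = (\<lambda>u. ennreal (\<bar>g u\<bar> powr p * wavg w n u))"
  have [measurable]: "F \<in> borel_measurable borel" unfolding F_def by measurable
  define K where "K = (24::real) ^ (D + 1)"
  have pointwise: "ennreal (\<bar>sym_diff r (h * phi x) g x\<bar> powr p * wavg w n x) \<le>
      (\<Sum>i=0..r. ennreal (real (r choose i) * K) * (F (x + c i * phi x) * indicator (shift_domain \<kappa>) x))"
    if x: "\<bar>x\<bar> < 1" for x
  proof (cases "x \<in> shift_domain \<kappa>")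
    case False
    then show ?thesis using x h by (simp add: sym_diff_shift \<kappa>_def)
  next
    case True
    have x1: "\<bar>x\<bar> \<le> 1" using x by simp
    have Wx: "0 \<le> wavg w n x" by (rule wavg_nonneg[OF w n x1])
    have term_le: "\<bar>real (r choose i) * (-1)^(r - i) * g (x + c i * phi x)\<bar> powr p * wavg w n x
        \<le> real (r choose i) * K * (\<bar>g (x + c i * phi x)\<bar> powr p * wavg w n (x + c i * phi x))"
      if i: "i \<le> r" for i
    proof -
      define u where "u = x + c i * phi x"
      have xu: "\<bar>x - u\<bar> \<le> \<kappa> * phi x"
        using c[OF i] phi_nonneg[OF x1] by (simp add: u_def abs_mult mult_right_mono)
      then have u: "\<bar>u\<bar> \<le> 1" using True unfolding shift_domain_def by auto
      have \<rho>: "0 < rho n u" by (rule rho_pos[OF n u])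
      have "\<kappa> * phi x \<le> 1 / 2 * rho n x"
      proof -
        have "\<kappa> * phi x = (real r * h * real n) * (phi x / real n) / 2" using n by (simp add: \<kappa>_def)
        also have "\<dots> \<le> 1 * (phi x / real n) / 2"
          using h phi_nonneg[OF x1] by (intro divide_right_mono mult_right_mono) auto
        also have "\<dots> \<le> 1 / 2 * rho n x" by (simp add: rho_eq_phi)
        finally show ?thesis .
      qed
      then have "\<bar>x - u\<bar> \<le> 2 * rho n u" using xu rho_le_rho_add[OF n x1 u] by linarith
      then have "1 + \<bar>x - u\<bar> / rho n u \<le> 3" using \<rho> by (simp add: field_simps)
      then have "(8 * (1 + \<bar>x - u\<bar> / rho n u)) ^ (D + 1) \<le> K"
        unfolding K_def using \<rho> by (intro power_mono) auto
      then have "(8 * (1 + \<bar>x - u\<bar> / rho n u)) ^ (D + 1) * wavg w n u \<le> K * wavg w n u"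
        by (rule mult_right_mono) (rule wavg_nonneg[OF w n u])
      then have wle: "wavg w n x \<le> K * wavg w n u"
        using wavg_compare[OF w L n x1 u] by linarith
      have "1 \<le> real (r choose i)" using i by (simp add: Suc_le_eq)
      then have "real (r choose i) powr p \<le> real (r choose i) powr 1" using p by (intro powr_mono) auto
      then have "\<bar>real (r choose i) * (-1)^(r - i) * g u\<bar> powr p \<le> real (r choose i) * \<bar>g u\<bar> powr p"
        by (simp add: abs_mult powr_mult mult_right_mono)
      then have "\<bar>real (r choose i) * (-1)^(r - i) * g u\<bar> powr p * wavg w n x
          \<le> (real (r choose i) * \<bar>g u\<bar> powr p) * (K * wavg w n u)"
        using wle Wx by (intro mult_mono) auto
      then show ?thesis by (simp add: u_def mult_ac)
    qed
    have "\<bar>sym_diff r (h * phi x) g x\<bar> powr p * wavg w n x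
       \<le> (\<Sum>i=0..r. \<bar>real (r choose i) * (-1)^(r - i) * g (x + c i * phi x)\<bar> powr p) * wavg w n x"
      using True x h p Wx by (intro mult_right_mono)
        (auto simp: sym_diff_shift \<kappa>_def c_def intro!: powr_abs_sum_le)
    also have "\<dots> \<le> (\<Sum>i=0..r. real (r choose i) * K * (\<bar>g (x + c i * phi x)\<bar> powr p * wavg w n (x + c i * phi x)))"
      unfolding sum_distrib_right by (intro sum_mono term_le) auto
    finally have "ennreal (\<bar>sym_diff r (h * phi x) g x\<bar> powr p * wavg w n x) \<le>
       ennreal (\<Sum>i=0..r. real (r choose i) * K * (\<bar>g (x + c i * phi x)\<bar> powr p * wavg w n (x + c i * phi x)))"
      by (rule ennreal_leI)
    also have "\<dots> = (\<Sum>i=0..r. ennreal (real (r choose i) * K * (\<bar>g (x + c i * phi x)\<bar> powr p * wavg w n (x + c i * phi x))))"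
    proof (rule sum_ennreal[symmetric])
      fix i assume "i \<in> {0..r}"
      then have "\<bar>x - (x + c i * phi x)\<bar> \<le> \<kappa> * phi x"
        using c[of i] phi_nonneg[OF x1] by (simp add: abs_mult mult_right_mono)
      then have "\<bar>x + c i * phi x\<bar> \<le> 1" using True unfolding shift_domain_def by auto
      then show "0 \<le> real (r choose i) * K * (\<bar>g (x + c i * phi x)\<bar> powr p * wavg w n (x + c i * phi x))"
        using wavg_nonneg[OF w n] by (simp add: K_def)
    qed
    also have "\<dots> = (\<Sum>i=0..r. ennreal (real (r choose i) * K) * (F (x + c i * phi x) * indicator (shift_domain \<kappa>) x))"
      using True by (simp add: F_def ennreal_mult' K_def)
    finally show ?thesis .
  qed
  have "wint p (wavg w n) (\<lambda>x. sym_diff r (h * phi x) g x) \<le>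
     (\<integral>\<^sup>+x. (\<Sum>i=0..r. ennreal (real (r choose i) * K) * (F (x + c i * phi x) * indicator (shift_domain \<kappa>) x)) \<partial>lborel)"
    unfolding wint_def
  proof (rule nn_integral_mono_AE)
    show "AE x in lborel. ennreal (\<bar>sym_diff r (h * phi x) g x\<bar> powr p * wavg w n x) * indicator {-1..1} x \<le>
      (\<Sum>i=0..r. ennreal (real (r choose i) * K) * (F (x + c i * phi x) * indicator (shift_domain \<kappa>) x))"
      using AE_abs_less_1 by eventually_elim (use pointwise in \<open>auto split: split_indicator\<close>)
  qed
  also have "\<dots> = (\<Sum>i=0..r. ennreal (real (r choose i) * K) * (\<integral>\<^sup>+x\<in>shift_domain \<kappa>. F (x + c i * phi x) \<partial>lborel))"
    by (subst nn_integral_sum) (auto simp: nn_integral_cmult)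
  also have "\<dots> \<le> (\<Sum>i=0..r. ennreal (real (r choose i) * K) * (2 * (\<integral>\<^sup>+u\<in>{-1..1}. F u \<partial>lborel)))"
    using c by (intro sum_mono mult_left_mono shift_nn_integral_le[OF _ \<kappa>]) auto
  also have "\<dots> = (\<Sum>i=0..r. ennreal (real (r choose i) * K)) * (2 * wint p (wavg w n) g)"
    by (simp add: sum_distrib_right wint_def F_def)
  also have "(\<Sum>i=0..r. ennreal (real (r choose i) * K)) = ennreal (2 ^ r * K)"
  proof -
    have "(\<Sum>i=0..r. ennreal (real (r choose i) * K)) = ennreal (\<Sum>i=0..r. real (r choose i) * K)"
      by (rule sum_ennreal) (simp add: K_def)
    also have "(\<Sum>i=0..r. real (r choose i) * K) = 2 ^ r * K"
      using choose_row_sum[of r] unfolding sum_distrib_right[symmetric]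
      by (metis atLeast0AtMost of_nat_sum of_nat_power of_nat_numeral)
    finally show ?thesis .
  qed
  also have "ennreal (2 ^ r * K) * (2 * wint p (wavg w n) g) = ennreal (2 * 2 ^ r * 24 ^ (D + 1)) * wint p (wavg w n) g"
  proof -
    have "ennreal (2 * 2 ^ r * 24 ^ (D + 1)) = 2 * ennreal (2 ^ r * K)"
      unfolding K_def mult.assoc by (subst ennreal_mult) auto
    then show ?thesis by (simp add: mult_ac)
  qed
  finally show ?thesis .
qed

lemma sym_diff_AE_cong:
  assumes N: "N \<in> null_sets lborel" and eq: "\<And>x. x \<in> {-1..1} - N \<Longrightarrow> f x = g x"
    and r: "1 \<le> r" and h: "0 < h" "real r * h \<le> 1"
  shows "AE x in lborel. x \<in> {-1..1} \<longrightarrow> sym_diff r (h * phi x) f x = sym_diff r (h * phi x) g x"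
proof -
  define \<kappa> where "\<kappa> = real r * h / 2"
  have \<kappa>: "0 < \<kappa>" "\<kappa> < 1" using h r by (auto simp: \<kappa>_def)
  define c where "c = (\<lambda>i. (real i - real r / 2) * h)"
  have c: "\<bar>c i\<bar> \<le> \<kappa>" if "i \<le> r" for i
  proof -
    have "\<bar>real i - real r / 2\<bar> \<le> real r / 2" using that by (auto simp: abs_le_iff field_simps)
    then have "\<bar>real i - real r / 2\<bar> * h \<le> real r / 2 * h" using h by (intro mult_right_mono) auto
    then show ?thesis using h by (simp add: c_def \<kappa>_def abs_mult)
  qed
  have "AE x in lborel. \<forall>i\<in>{0..r}. x \<in> shift_domain \<kappa> \<longrightarrow> x + c i * phi x \<notin> N"
    using AE_shift_notin[OF N \<kappa>] c by (subst AE_finite_all) auto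
  with AE_abs_less_1 show ?thesis
  proof eventually_elim
    case (elim x)
    show ?case
    proof
      assume "x \<in> {-1..1}"
      then have x: "\<bar>x\<bar> < 1" using elim by blast
      have "f (x + (real i - real r / 2) * h * phi x) = g (x + (real i - real r / 2) * h * phi x)"
        if "x \<in> shift_domain \<kappa>" "i \<in> {0..r}" for i
      proof -
        have "\<bar>c i * phi x\<bar> \<le> \<kappa> * phi x"
          using c[of i] that phi_nonneg[of x] x by (simp add: abs_mult mult_right_mono)
        then have "\<bar>x + c i * phi x\<bar> \<le> 1"
          using that abs_triangle_ineq[of x "c i * phi x"] unfolding shift_domain_def by auto
        then show ?thesis using that elim by (auto simp: c_def abs_le_iff intro!: eq)
      qed
      then show "sym_diff r (h * phi x) f x = sym_diff r (h * phi x) g x"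
        using x h by (simp add: sym_diff_shift \<kappa>_def[symmetric])
    qed
  qed
qed

section \<open>Dyadic decomposition\<close>

lemma wint_eq_lebesgue_on:
  "(\<integral>\<^sup>+x. ennreal (\<bar>g x\<bar> powr p * v x) \<partial>lebesgue_on {-1..1}) = wint p v g"
  unfolding wint_def by (subst nn_integral_restrict_space) (auto simp: nn_integral_completion)

lemma wint_AE_cong:
  assumes "AE x in lborel. x \<in> {-1..1} \<longrightarrow> f x = g x"
  shows "wint p v f = wint p v g"
  unfolding wint_def using assms
  by (intro nn_integral_cong_AE) (auto elim!: eventually_mono split: split_indicator)

lemma wint_add_le:
  assumes p: "0 < p" "p \<le> 1" and v: "\<And>x. \<bar>x\<bar> \<le> 1 \<Longrightarrow> 0 \<le> v x"
    and [measurable]: "f \<in> borel_measurable borel" "g \<in> borel_measurable borel" "v \<in> borel_measurable borel"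
    and le: "\<And>x. \<bar>x\<bar> \<le> 1 \<Longrightarrow> \<bar>k x\<bar> \<le> \<bar>f x\<bar> + \<bar>g x\<bar>"
  shows "wint p v k \<le> wint p v f + wint p v g"
proof -
  have "wint p v k \<le> (\<integral>\<^sup>+x. ennreal (\<bar>f x\<bar> powr p * v x) * indicator {-1..1} x + ennreal (\<bar>g x\<bar> powr p * v x) * indicator {-1..1} x \<partial>lborel)"
    unfolding wint_def
  proof (intro nn_integral_mono)
    fix x :: real
    show "ennreal (\<bar>k x\<bar> powr p * v x) * indicator {-1..1} x \<le>
      ennreal (\<bar>f x\<bar> powr p * v x) * indicator {-1..1} x + ennreal (\<bar>g x\<bar> powr p * v x) * indicator {-1..1} x"
    proof (cases "x \<in> {-1..1}")
      case True
      then have x: "\<bar>x\<bar> \<le> 1" by auto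
      have "\<bar>k x\<bar> powr p \<le> (\<bar>f x\<bar> + \<bar>g x\<bar>) powr p" using le[OF x] p by (intro powr_mono2) auto
      also have "\<dots> \<le> \<bar>f x\<bar> powr p + \<bar>g x\<bar> powr p" using p by (intro powr_add_le_add_powr) auto
      finally have "\<bar>k x\<bar> powr p * v x \<le> \<bar>f x\<bar> powr p * v x + \<bar>g x\<bar> powr p * v x"
        using v[OF x] by (simp add: mult_right_mono distrib_right[symmetric])
      then have "ennreal (\<bar>k x\<bar> powr p * v x) \<le> ennreal (\<bar>f x\<bar> powr p * v x + \<bar>g x\<bar> powr p * v x)"
        by (rule ennreal_leI)
      then show ?thesis using True v[OF x] by (simp add: ennreal_plus)
    qed simp
  qed
  also have "\<dots> = wint p v f + wint p v g"
    unfolding wint_def by (rule nn_integral_add) measurable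
  finally show ?thesis .
qed

lemma wint_le_4:
  assumes w: "doubling_weight w L" and m: "1 \<le> m" "m \<le> n" "n \<le> 2 * m"
    and [measurable]: "g \<in> borel_measurable borel"
  shows "wint p (wavg w n) g \<le> 4 * wint p (wavg w m) g"
proof -
  note [measurable] = borel_measurable_wavg[OF w]
  have "wint p (wavg w n) g \<le> (\<integral>\<^sup>+x. 4 * (ennreal (\<bar>g x\<bar> powr p * wavg w m x) * indicator {-1..1} x) \<partial>lborel)"
    unfolding wint_def
  proof (intro nn_integral_mono)
    fix x :: real
    show "ennreal (\<bar>g x\<bar> powr p * wavg w n x) * indicator {-1..1} x
      \<le> 4 * (ennreal (\<bar>g x\<bar> powr p * wavg w m x) * indicator {-1..1} x)"
    proof (cases "x \<in> {-1..1}")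
      case True
      then have x: "\<bar>x\<bar> \<le> 1" by auto
      have "\<bar>g x\<bar> powr p * wavg w n x \<le> \<bar>g x\<bar> powr p * (4 * wavg w m x)"
        by (intro mult_left_mono wavg_le_4[OF w m x]) simp
      also have "\<dots> = 4 * (\<bar>g x\<bar> powr p * wavg w m x)" by simp
      finally have "ennreal (\<bar>g x\<bar> powr p * wavg w n x) \<le> ennreal (4 * (\<bar>g x\<bar> powr p * wavg w m x))"
        by (rule ennreal_leI)
      also have "\<dots> = 4 * ennreal (\<bar>g x\<bar> powr p * wavg w m x)"
        using wavg_nonneg[OF w m(1) x] by (subst ennreal_mult) auto
      finally show ?thesis using True by simp
    qed simp
  qed
  also have "\<dots> = 4 * wint p (wavg w m) g"
    unfolding wint_def by (rule nn_integral_cmult) measurable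
  finally show ?thesis .
qed

lemma sym_diff_add:
  assumes "\<And>x. k x = f x + g x"
  shows "sym_diff r h k x = sym_diff r h f x + sym_diff r h g x"
  by (simp add: sym_diff_def assms sum.distrib distrib_left)

lemma sym_diff_const:
  assumes "1 \<le> r" shows "sym_diff r h (\<lambda>x. a) x = 0"
proof -
  have "(\<Sum>i=0..r. of_nat (r choose i) * (-1)^(r - i) * poly [:a:] (0 + of_nat i * 0)) = 0"
    by (rule binomial_diff_poly_eq_0) (use assms in auto)
  then show ?thesis by (simp add: sym_diff_def)
qed

lemma borel_measurable_sym_diff [measurable]:
  assumes [measurable]: "f \<in> borel_measurable borel"
  shows "(\<lambda>x. sym_diff r (h * phi x) f x) \<in> borel_measurable borel"
  unfolding sym_diff_def by measurable

definition poly_const :: "real \<Rightarrow> nat \<Rightarrow> nat \<Rightarrow> nat \<Rightarrow> real" where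
  "poly_const p D r s = 2 * 2 ^ r * local_const s * schur_const D (real s * p)"

lemma poly_const_nonneg: "0 \<le> poly_const p D r s"
  using local_const_pos[of s] schur_const_pos[of D "real s * p"] by (simp add: poly_const_def)

definition dyadic_const :: "real \<Rightarrow> nat \<Rightarrow> nat \<Rightarrow> nat \<Rightarrow> real" where
  "dyadic_const p D r s = 2 * 2 ^ r * 24 ^ (D + 1) * (4 * 2 powr (real r * p - 1)) +
     poly_const p D r s * (1 + 4 * 2 powr (real r * p - 1))"

lemma dyadic_const_pos: "0 < dyadic_const p D r s"
  unfolding dyadic_const_def using poly_const_nonneg by (intro add_pos_nonneg mult_nonneg_nonneg) auto

context
  fixes w :: "real \<Rightarrow> real" and L p :: real and D r s n :: nat and h :: real
  assumes w: "doubling_weight w L" and L: "1 \<le> L" "L\<^sup>2 \<le> 2 ^ D"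
    and p: "0 < p" "p \<le> 1" and r: "1 \<le> r" "1 \<le> real r * p"
    and s: "real D + 3 \<le> real s * p"
    and h: "0 < h" "h \<le> step_ratio s / real r / real n"
begin

text \<open>A block \<open>P (Suc J) - P J\<close> is bounded by the errors of both polynomials,
  measured with the weight of the higher level. Returning the lower error to its own level costs 4
  for the weight and \<open>2 powr \<beta>\<close> for the index, whence the second sum.\<close>

lemma wint_sym_diff_dyadic_poly:
  fixes P :: "nat \<Rightarrow> real poly"
  assumes P: "\<And>j. j \<le> J \<Longrightarrow> degree (P j) \<le> 2 ^ j - 1" and f: "f \<in> borel_measurable borel" and J: "2 ^ J \<le> n"
  defines "\<beta> \<equiv> real r * p - 1"
  shows "wint p (wavg w n) (\<lambda>x. sym_diff r (h * phi x) (poly (P J)) x) \<le>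
     ennreal (poly_const p D r s / real n powr \<beta>) *
      ((\<Sum>j\<le>J. ennreal (real (2 ^ j) powr \<beta>) * wint p (wavg w (2 ^ j)) (\<lambda>x. f x - poly (P j) x)) +
       ennreal (4 * 2 powr \<beta>) * (\<Sum>j<J. ennreal (real (2 ^ j) powr \<beta>) * wint p (wavg w (2 ^ j)) (\<lambda>x. f x - poly (P j) x)))"
  using P J
proof (induction J)
  case 0
  \<comment> \<open>The telescoping ends at degree 0, where all differences of order
    \<open>r \<ge> 1\<close> vanish.\<close>
  then obtain a where a: "P 0 = [:a:]" using degree_eq_zeroE[of "P 0"] by auto
  then have e: "poly (P 0) = (\<lambda>x. a)" by (simp add: fun_eq_iff)
  have "wint p (wavg w n) (\<lambda>x. sym_diff r (h * phi x) (poly (P 0)) x) = 0"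
    unfolding e sym_diff_const[OF r(1)] wint_def by simp
  then show ?case by simp
next
  case (Suc J)
  note [measurable] = borel_measurable_wavg[OF w] f
  define a where "a = (\<lambda>j. wint p (wavg w (2 ^ j)) (\<lambda>x. f x - poly (P j) x))"
  define c where "c = (\<lambda>j::nat. ennreal (real (2 ^ j) powr \<beta>))"
  define C where "C = ennreal (poly_const p D r s / real n powr \<beta>)"
  have n: "1 \<le> n" using Suc.prems(2) by (metis Suc_leI nat_zero_less_power_iff order_less_le_trans zero_less_numeral One_nat_def)
  have Jn: "2 ^ J \<le> n" using Suc.prems(2) by simp
  define Q where "Q = P (Suc J) - P J"
  have "degree Q \<le> 2 ^ Suc J"
    unfolding Q_def using Suc.prems(1)[of J] Suc.prems(1)[of "Suc J"]
    by (intro degree_diff_le) auto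
  then have "wint p (wavg w n) (\<lambda>x. sym_diff r (h * phi x) (poly Q) x) \<le>
      ennreal (poly_const p D r s * (real (2 ^ Suc J) / real n) powr \<beta>) * wint p (wavg w (2 ^ Suc J)) (poly Q)"
    unfolding wint_def poly_const_def \<beta>_def
    using Suc.prems(2) by (intro sym_diff_poly_le[OF w L _ _ _ p r s h]) auto
  also have "ennreal (poly_const p D r s * (real (2 ^ Suc J) / real n) powr \<beta>) = C * c (Suc J)"
    unfolding C_def c_def using poly_const_nonneg
    by (subst ennreal_mult[symmetric]) (auto simp: powr_divide)
  also have "wint p (wavg w (2 ^ Suc J)) (poly Q) \<le> a (Suc J) + wint p (wavg w (2 ^ Suc J)) (\<lambda>x. f x - poly (P J) x)"
    unfolding a_def using p wavg_nonneg[OF w]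
    by (intro wint_add_le) (auto simp: Q_def)
  also have "wint p (wavg w (2 ^ Suc J)) (\<lambda>x. f x - poly (P J) x) \<le> 4 * a J"
    unfolding a_def by (intro wint_le_4[OF w]) auto
  finally have Q_le: "wint p (wavg w n) (\<lambda>x. sym_diff r (h * phi x) (poly Q) x) \<le> C * c (Suc J) * (a (Suc J) + 4 * a J)"
    by (simp add: mult_left_mono add_left_mono)
  have "wint p (wavg w n) (\<lambda>x. sym_diff r (h * phi x) (poly (P (Suc J))) x) \<le>
     wint p (wavg w n) (\<lambda>x. sym_diff r (h * phi x) (poly (P J)) x) + wint p (wavg w n) (\<lambda>x. sym_diff r (h * phi x) (poly Q) x)"
  proof (rule wint_add_le[OF p])
    fix x :: real assume "\<bar>x\<bar> \<le> 1"
    have "sym_diff r (h * phi x) (poly (P (Suc J))) x = sym_diff r (h * phi x) (poly (P J)) x + sym_diff r (h * phi x) (poly Q) x"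
      by (rule sym_diff_add) (simp add: Q_def)
    then show "\<bar>sym_diff r (h * phi x) (poly (P (Suc J))) x\<bar> \<le> \<bar>sym_diff r (h * phi x) (poly (P J)) x\<bar> + \<bar>sym_diff r (h * phi x) (poly Q) x\<bar>"
      by simp
  qed (use wavg_nonneg[OF w n] in auto)
  also have "\<dots> \<le> C * ((\<Sum>j\<le>J. c j * a j) + ennreal (4 * 2 powr \<beta>) * (\<Sum>j<J. c j * a j)) + C * c (Suc J) * (a (Suc J) + 4 * a J)"
    using Suc.IH[OF Suc.prems(1) Jn] Q_le unfolding a_def c_def C_def by (intro add_mono) auto
  also have "\<dots> = C * ((\<Sum>j\<le>Suc J. c j * a j) + ennreal (4 * 2 powr \<beta>) * (\<Sum>j<Suc J. c j * a j))"
  proof -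
    have "c (Suc J) * (4 * a J) = ennreal (4 * 2 powr \<beta>) * (c J * a J)"
    proof -
      have "real (2 ^ Suc J) powr \<beta> * 4 = 4 * 2 powr \<beta> * real (2 ^ J) powr \<beta>"
        by (simp add: powr_mult)
      then have "c (Suc J) * 4 = ennreal (4 * 2 powr \<beta>) * c J"
        unfolding c_def by (metis ennreal_mult'' ennreal_numeral powr_ge_zero zero_le_numeral)
      then show ?thesis by (simp add: mult.assoc[symmetric])
    qed
    then show ?thesis by (simp add: algebra_simps)
  qed
  finally show ?case unfolding a_def c_def C_def .
qed

lemma wint_sym_diff_dyadic:
  fixes P :: "nat \<Rightarrow> real poly"
  assumes P: "\<And>j. j \<le> J \<Longrightarrow> degree (P j) \<le> 2 ^ j - 1" and f: "f \<in> borel_measurable borel"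
    and J: "2 ^ J \<le> n" "n < 2 ^ Suc J"
  defines "\<beta> \<equiv> real r * p - 1"
  shows "wint p (wavg w n) (\<lambda>x. sym_diff r (h * phi x) f x) \<le>
     ennreal (dyadic_const p D r s / real n powr \<beta>) *
      (\<Sum>j\<le>J. ennreal (real (2 ^ j) powr \<beta>) * wint p (wavg w (2 ^ j)) (\<lambda>x. f x - poly (P j) x))"
proof -
  note [measurable] = borel_measurable_wavg[OF w] f
  define a where "a = (\<lambda>j. wint p (wavg w (2 ^ j)) (\<lambda>x. f x - poly (P j) x))"
  define c where "c = (\<lambda>j::nat. ennreal (real (2 ^ j) powr \<beta>))"
  define S where "S = (\<Sum>j\<le>J. c j * a j)"
  define C where "C = (2::real) * 2 ^ r * 24 ^ (D + 1)"
  have n: "1 \<le> n" using J(1) by (metis Suc_leI nat_zero_less_power_iff order_less_le_trans zero_less_numeral One_nat_def)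
  have rhn: "real r * h * real n \<le> 1"
  proof -
    have "real r * h * real n \<le> step_ratio s" using h(2) n r(1) by (simp add: field_simps)
    then show ?thesis using step_ratio_bounds(2)[of s] by linarith
  qed
  have "wint p (wavg w n) (\<lambda>x. sym_diff r (h * phi x) f x) \<le>
     wint p (wavg w n) (\<lambda>x. sym_diff r (h * phi x) (\<lambda>x. f x - poly (P J) x) x) +
     wint p (wavg w n) (\<lambda>x. sym_diff r (h * phi x) (poly (P J)) x)"
  proof (rule wint_add_le[OF p])
    fix x :: real assume "\<bar>x\<bar> \<le> 1"
    have "sym_diff r (h * phi x) f x =
        sym_diff r (h * phi x) (\<lambda>x. f x - poly (P J) x) x + sym_diff r (h * phi x) (poly (P J)) x"
      by (rule sym_diff_add) simp
    then show "\<bar>sym_diff r (h * phi x) f x\<bar> \<le>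
        \<bar>sym_diff r (h * phi x) (\<lambda>x. f x - poly (P J) x) x\<bar> + \<bar>sym_diff r (h * phi x) (poly (P J)) x\<bar>"
      by simp
  qed (use wavg_nonneg[OF w n] in auto)
  also have "wint p (wavg w n) (\<lambda>x. sym_diff r (h * phi x) (\<lambda>x. f x - poly (P J) x) x)
      \<le> ennreal (C * (4 * 2 powr \<beta>) / real n powr \<beta>) * S"
  proof -
    have "wint p (wavg w n) (\<lambda>x. sym_diff r (h * phi x) (\<lambda>x. f x - poly (P J) x) x)
        \<le> ennreal C * wint p (wavg w n) (\<lambda>x. f x - poly (P J) x)"
      unfolding C_def by (rule sym_diff_wint_le[OF w L n p r(1) h(1) rhn]) measurable
    also have "wint p (wavg w n) (\<lambda>x. f x - poly (P J) x) \<le> 4 * a J"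
      unfolding a_def using J by (intro wint_le_4[OF w]) auto
    \<comment> \<open>Since \<open>n < 2 ^ Suc J\<close>, the factor inserted here is at least 1; it
      turns the error at the top level into a summand of \<open>S\<close>.\<close>
    also have "a J \<le> ennreal (2 powr \<beta> / real n powr \<beta>) * (c J * a J)"
    proof -
      have "real n \<le> real (2 * 2 ^ J)" using J(2) unfolding of_nat_le_iff by simp
      then have "real n powr \<beta> \<le> (2 * real (2 ^ J)) powr \<beta>"
        using r by (intro powr_mono2) (auto simp: \<beta>_def)
      then have "1 \<le> 2 powr \<beta> / real n powr \<beta> * real (2 ^ J) powr \<beta>"
        using n by (simp add: powr_mult field_simps)
      then have "ennreal 1 \<le> ennreal (2 powr \<beta> / real n powr \<beta> * real (2 ^ J) powr \<beta>)" by (rule ennreal_leI)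
      also have "\<dots> = ennreal (2 powr \<beta> / real n powr \<beta>) * c J"
        unfolding c_def by (rule ennreal_mult) auto
      finally have "1 * a J \<le> ennreal (2 powr \<beta> / real n powr \<beta>) * c J * a J"
        by (intro mult_right_mono) auto
      then show ?thesis by (simp add: mult.assoc)
    qed
    also have "c J * a J \<le> S" unfolding S_def by (rule member_le_sum) auto
    finally have "wint p (wavg w n) (\<lambda>x. sym_diff r (h * phi x) (\<lambda>x. f x - poly (P J) x) x)
        \<le> ennreal C * (4 * (ennreal (2 powr \<beta> / real n powr \<beta>) * S))"
      by (simp add: mult_left_mono)
    also have "\<dots> = ennreal (C * (4 * 2 powr \<beta>) / real n powr \<beta>) * S"
    proof -
      have "C * (4 * 2 powr \<beta>) / real n powr \<beta> = C * (4 * (2 powr \<beta> / real n powr \<beta>))" by simp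
      moreover have "ennreal \<dots> = ennreal C * (4 * ennreal (2 powr \<beta> / real n powr \<beta>))"
        by (subst ennreal_mult, simp add: C_def, simp, subst ennreal_mult) auto
      ultimately show ?thesis by (simp only: mult.assoc)
    qed
    finally show ?thesis .
  qed
  also have "wint p (wavg w n) (\<lambda>x. sym_diff r (h * phi x) (poly (P J)) x) \<le>
     ennreal (poly_const p D r s * (1 + 4 * 2 powr \<beta>) / real n powr \<beta>) * S"
  proof -
    have "(\<Sum>j<J. c j * a j) \<le> S" unfolding S_def by (intro sum_mono2) auto
    then have "ennreal (poly_const p D r s / real n powr \<beta>) * (S + ennreal (4 * 2 powr \<beta>) * (\<Sum>j<J. c j * a j)) \<le>
       ennreal (poly_const p D r s / real n powr \<beta>) * (S + ennreal (4 * 2 powr \<beta>) * S)"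
      by (intro mult_left_mono add_left_mono) auto
    also have "\<dots> = ennreal (poly_const p D r s * (1 + 4 * 2 powr \<beta>) / real n powr \<beta>) * S"
    proof -
      have "poly_const p D r s * (1 + 4 * 2 powr \<beta>) / real n powr \<beta> = poly_const p D r s / real n powr \<beta> * (1 + 4 * 2 powr \<beta>)" by simp
      moreover have "ennreal \<dots> = ennreal (poly_const p D r s / real n powr \<beta>) * (1 + ennreal (4 * 2 powr \<beta>))"
        using poly_const_nonneg by (subst ennreal_mult, simp, simp, subst ennreal_plus) auto
      ultimately show ?thesis by (simp only: mult.assoc distrib_right mult_1)
    qed
    finally show ?thesis
      using wint_sym_diff_dyadic_poly[OF P f J(1)] unfolding S_def a_def c_def \<beta>_def by (rule order_trans[rotated])
  qed
  also have "ennreal (C * (4 * 2 powr \<beta>) / real n powr \<beta>) * S + ennreal (poly_const p D r s * (1 + 4 * 2 powr \<beta>) / real n powr \<beta>) * S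
    = ennreal (dyadic_const p D r s / real n powr \<beta>) * S"
  proof -
    have "dyadic_const p D r s / real n powr \<beta> = C * (4 * 2 powr \<beta>) / real n powr \<beta> + poly_const p D r s * (1 + 4 * 2 powr \<beta>) / real n powr \<beta>"
      by (simp only: dyadic_const_def C_def \<beta>_def add_divide_distrib)
    moreover have "ennreal \<dots> = ennreal (C * (4 * 2 powr \<beta>) / real n powr \<beta>) + ennreal (poly_const p D r s * (1 + 4 * 2 powr \<beta>) / real n powr \<beta>)"
      using poly_const_nonneg by (intro ennreal_plus) (auto simp: C_def)
    ultimately show ?thesis by (simp only: distrib_right)
  qed
  finally show ?thesis unfolding S_def a_def c_def by simp
qed

end

section \<open>Passage to infima and from dyadic levels to all degrees\<close>

lemma le_sum_INF_ennreal:
  fixes a :: "nat \<Rightarrow> 'b \<Rightarrow> ennreal" and \<gamma> :: "nat \<Rightarrow> real"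
  assumes k: "0 \<le> k" and \<gamma>: "\<And>j. 0 \<le> \<gamma> j" and ne: "\<And>j. A j \<noteq> {}"
    and le: "\<And>P. (\<And>j. P j \<in> A j) \<Longrightarrow> Z \<le> ennreal k * (\<Sum>j\<le>J. ennreal (\<gamma> j) * a j (P j))"
  shows "Z \<le> ennreal k * (\<Sum>j\<le>J. ennreal (\<gamma> j) * (INF P\<in>A j. a j P))"
proof (rule ennreal_le_epsilon)
  fix \<epsilon> :: real assume \<epsilon>: "0 < \<epsilon>"
  define \<Gamma> where "\<Gamma> = (\<Sum>j\<le>J. \<gamma> j)"
  have \<Gamma>: "0 \<le> \<Gamma>" unfolding \<Gamma>_def by (intro sum_nonneg \<gamma>)
  \<comment> \<open>One tolerance serves all levels; the added 1 guards against a vanishing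
    denominator. An infinite infimum is met by any element.\<close>
  define \<delta> where "\<delta> = \<epsilon> / (k * \<Gamma> + 1)"
  have k\<Gamma>: "0 < k * \<Gamma> + 1" using k \<Gamma> by (intro add_nonneg_pos) auto
  have \<delta>: "0 < \<delta>" using \<epsilon> k\<Gamma> by (simp add: \<delta>_def)
  have "k * \<Gamma> * \<delta> \<le> (k * \<Gamma> + 1) * \<delta>" using \<delta> by (intro mult_right_mono) auto
  also have "\<dots> = \<epsilon>" using k\<Gamma> by (simp add: \<delta>_def)
  finally have k\<delta>: "k * \<Gamma> * \<delta> \<le> \<epsilon>" .
  have "\<exists>P. P \<in> A j \<and> a j P \<le> (INF P\<in>A j. a j P) + ennreal \<delta>" for j
  proof (cases "(INF P\<in>A j. a j P) = \<infinity>")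
    case True
    then show ?thesis using ne[of j] by auto
  next
    case False
    then have "(INF P\<in>A j. a j P) < (INF P\<in>A j. a j P) + ennreal \<delta>"
      using \<delta> by (simp add: ennreal_add_left_cancel_less less_top)
    then show ?thesis by (auto simp: INF_less_iff intro: less_imp_le)
  qed
  then obtain P where P: "\<And>j. P j \<in> A j" "\<And>j. a j (P j) \<le> (INF P\<in>A j. a j P) + ennreal \<delta>"
    by metis
  have "Z \<le> ennreal k * (\<Sum>j\<le>J. ennreal (\<gamma> j) * a j (P j))" by (rule le) (rule P)
  also have "\<dots> \<le> ennreal k * (\<Sum>j\<le>J. ennreal (\<gamma> j) * ((INF P\<in>A j. a j P) + ennreal \<delta>))"
    by (intro mult_left_mono sum_mono P) auto
  also have "\<dots> = ennreal k * (\<Sum>j\<le>J. ennreal (\<gamma> j) * (INF P\<in>A j. a j P)) + ennreal k * (ennreal \<Gamma> * ennreal \<delta>)"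
    unfolding \<Gamma>_def using \<gamma> by (simp add: distrib_left sum.distrib sum_distrib_right[symmetric])
  also have "ennreal k * (ennreal \<Gamma> * ennreal \<delta>) = ennreal (k * \<Gamma> * \<delta>)"
    using k \<Gamma> \<delta> by (simp add: ennreal_mult mult.assoc)
  also have "\<dots> \<le> ennreal \<epsilon>" using k\<delta> by (rule ennreal_leI)
  finally show "Z \<le> ennreal k * (\<Sum>j\<le>J. ennreal (\<gamma> j) * (INF P\<in>A j. a j P)) + ennreal \<epsilon>"
    by (simp add: add_left_mono)
qed

text \<open>The term at \<open>N = 2 ^ Suc J\<close> is spread over the \<open>N / 2\<close> indices
  above \<open>2 ^ J\<close>: the count gives 2, the hypothesis 4. The absolute value in the
  exponent covers both signs of \<alpha>. Monotonicity of \<open>e\<close> holds only up to 4 since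
  the weight changes with the degree.\<close>

lemma dyadic_sum_le:
  fixes e :: "nat \<Rightarrow> ennreal" and \<alpha> :: real
  assumes e: "\<And>k m. \<lbrakk>1 \<le> k; k \<le> m; m \<le> 2 * k\<rbrakk> \<Longrightarrow> e m \<le> 4 * e k"
  shows "(\<Sum>j\<le>J. ennreal (real (2 ^ j) powr (\<alpha> + 1)) * e (2 ^ j)) \<le>
     ennreal (8 * 2 powr \<bar>\<alpha>\<bar>) * (\<Sum>k=1..2 ^ J. ennreal (real k powr \<alpha>) * e k)"
proof (induction J)
  case 0
  have "1 \<le> 8 * 2 powr \<bar>\<alpha>\<bar>" using ge_one_powr_ge_zero[of 2 "\<bar>\<alpha>\<bar>"] by linarith
  then have "ennreal 1 * e 1 \<le> ennreal (8 * 2 powr \<bar>\<alpha>\<bar>) * e 1" by (intro mult_right_mono ennreal_leI) auto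
  then show ?case by simp
next
  case (Suc J)
  define N :: nat where "N = 2 ^ Suc J"
  define M where "M = 2 powr \<bar>\<alpha>\<bar>"
  have N: "N = 2 ^ J + 2 ^ J" by (simp add: N_def)
  have pointwise: "ennreal (real N powr \<alpha>) * e N \<le> ennreal (4 * M) * (ennreal (real k powr \<alpha>) * e k)"
    if k: "k \<in> {2 ^ J + 1..N}" for k
  proof -
    have k1: "1 \<le> k" "k \<le> N" "N \<le> 2 * k" using k N by auto
    have kN: "0 < real k" "real k \<le> real N" "real N \<le> 2 * real k" using k1 by auto
    have "real N powr \<alpha> \<le> M * real k powr \<alpha>"
    proof (cases "0 \<le> \<alpha>")
      case True
      have "real N powr \<alpha> \<le> (2 * real k) powr \<alpha>" using True kN by (intro powr_mono2) auto
      then show ?thesis using True kN by (simp add: M_def powr_mult)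
    next
      case False
      have "real N powr \<alpha> \<le> 1 * real k powr \<alpha>" using False kN by (simp add: powr_mono2')
      also have "\<dots> \<le> M * real k powr \<alpha>"
        unfolding M_def by (intro mult_right_mono ge_one_powr_ge_zero) auto
      finally show ?thesis .
    qed
    then have "ennreal (real N powr \<alpha>) * e N \<le> ennreal (M * real k powr \<alpha>) * (4 * e k)"
      using k1 by (intro mult_mono ennreal_leI e) auto
    also have "\<dots> = ennreal (4 * M) * (ennreal (real k powr \<alpha>) * e k)"
    proof -
      have "ennreal (M * real k powr \<alpha>) = ennreal M * ennreal (real k powr \<alpha>)" "ennreal (4 * M) = 4 * ennreal M"
        unfolding M_def by (subst ennreal_mult; simp)+
      then show ?thesis by (simp only: mult_ac)
    qed
    finally show ?thesis .
  qed
  have "ennreal (real N powr (\<alpha> + 1)) * e N = 2 * (\<Sum>k\<in>{2 ^ J + 1..N}. ennreal (real N powr \<alpha>) * e N)"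
  proof -
    have "real N powr (\<alpha> + 1) = 2 * real (2 ^ J) * real N powr \<alpha>"
      by (simp add: powr_add N_def)
    then have "ennreal (real N powr (\<alpha> + 1)) = 2 * of_nat (2 ^ J) * ennreal (real N powr \<alpha>)"
      by (simp add: ennreal_mult ennreal_of_nat_eq_real_of_nat)
    then show ?thesis by (simp add: N mult.assoc)
  qed
  also have "\<dots> \<le> 2 * (\<Sum>k\<in>{2 ^ J + 1..N}. ennreal (4 * M) * (ennreal (real k powr \<alpha>) * e k))"
    by (intro mult_left_mono sum_mono pointwise) auto
  also have "\<dots> = ennreal (8 * M) * (\<Sum>k\<in>{2 ^ J + 1..N}. ennreal (real k powr \<alpha>) * e k)"
  proof -
    have "ennreal (8 * M) = 2 * ennreal (4 * M)" unfolding M_def by (subst (1 2) ennreal_mult) auto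
    then show ?thesis by (simp only: sum_distrib_left mult.assoc)
  qed
  finally have new: "ennreal (real N powr (\<alpha> + 1)) * e N \<le> ennreal (8 * M) * (\<Sum>k\<in>{2 ^ J + 1..N}. ennreal (real k powr \<alpha>) * e k)" .
  have "(\<Sum>k=1..N. ennreal (real k powr \<alpha>) * e k) =
      (\<Sum>k=1..2 ^ J. ennreal (real k powr \<alpha>) * e k) + (\<Sum>k\<in>{2 ^ J + 1..N}. ennreal (real k powr \<alpha>) * e k)"
    unfolding N by (rule sum.ub_add_nat) simp
  then show ?case
    using add_mono[OF Suc.IH new] by (simp add: N_def M_def distrib_left)
qed

section \<open>Powers of extended nonnegative numbers\<close>

lemma ennpowr_mono: "\<lbrakk>x \<le> y; 0 < a\<rbrakk> \<Longrightarrow> ennpowr x a \<le> ennpowr y a"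
  unfolding ennpowr_def
  by (auto simp: top_unique less_top intro!: ennreal_leI powr_mono2 enn2real_mono)

lemma ennpowr_inverse:
  assumes "0 < a" shows "ennpowr (ennpowr x (1 / a)) a = x"
  using assms by (cases x) (auto simp: ennpowr_def powr_powr)

lemma ennpowr_cmult:
  assumes "0 < c" shows "ennpowr (ennreal c * x) a = ennreal (c powr a) * ennpowr x a"
  using assms by (cases x) (auto simp: ennpowr_def ennreal_mult_top ennreal_mult[symmetric] powr_mult)

lemma INF_le_ennpowr_INF:
  assumes a: "0 < a"
  shows "(INF P\<in>A. X P) \<le> ennpowr (INF P\<in>A. ennpowr (X P) (1 / a)) a"
proof (rule ccontr)
  let ?B = "INF P\<in>A. ennpowr (X P) (1 / a)"
  assume "\<not> ?thesis"
  \<comment> \<open>A value strictly between the two sides lets monotonicity and inversion of the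
    power replace its continuity.\<close>
  then obtain y where y: "ennpowr ?B a < y" "y < (INF P\<in>A. X P)" using dense not_le by metis
  have "ennpowr y (1 / a) \<le> ?B"
  proof (rule INF_greatest)
    fix P assume "P \<in> A"
    then have "y \<le> X P" using y(2) by (meson INF_lower less_imp_le order_trans)
    then show "ennpowr y (1 / a) \<le> ennpowr (X P) (1 / a)" using a by (intro ennpowr_mono) auto
  qed
  then have "ennpowr (ennpowr y (1 / a)) a \<le> ennpowr ?B a" using a by (rule ennpowr_mono)
  then show False using y(1) ennpowr_inverse[OF a, of y] by simp
qed

lemma exists_borel_version:
  fixes f :: "real \<Rightarrow> real"
  assumes "f \<in> borel_measurable (lebesgue_on {-1..1})"
  shows "\<exists>g N. g \<in> borel_measurable borel \<and> N \<in> null_sets lborel \<and> (\<forall>x\<in>{-1..1} - N. f x = g x)"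
proof -
  have "(\<lambda>x. if x \<in> {-1..1} then f x else 0) \<in> borel_measurable lebesgue"
    using assms by (rule borel_measurable_if_I) (intro sets_completionI_sets, simp add: borel_closed)
  then obtain g where g: "g \<in> borel_measurable lborel" "AE x in lborel. (if x \<in> {-1..1} then f x else 0) = g x"
    using completion_ex_borel_measurable_real by blast
  from g(2) obtain N where N: "{x \<in> space lborel. \<not> ((if x \<in> {-1..1} then f x else 0) = g x)} \<subseteq> N" "N \<in> null_sets lborel"
    by (auto elim!: AE_E simp: null_sets_def)
  have "\<forall>x\<in>{-1..1} - N. f x = g x"
  proof
    fix x assume x: "x \<in> {-1..1} - N"
    then have "x \<notin> {x \<in> space lborel. \<not> ((if x \<in> {-1..1} then f x else 0) = g x)}" using N(1) by blast
    then show "f x = g x" using x by simp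
  qed
  with g(1) N(2) show ?thesis by auto
qed

text \<open>Allows the doubling constant to be raised to at least 1, as the growth estimates
  require.\<close>

lemma doubling_weight_mono:
  assumes "doubling_weight w L" "L \<le> L'"
  shows "doubling_weight w L'"
proof -
  have "0 \<le> (LINT u:{a..b}|lebesgue. w u)" for a b
    using mass_nonneg[OF assms(1), of a b] by (simp add: mass_def)
  then have "L * (LINT u:{a..b}|lebesgue. w u) \<le> L' * (LINT u:{a..b}|lebesgue. w u)" for a b
    using assms(2) by (intro mult_right_mono) auto
  then show ?thesis using assms(1) unfolding doubling_weight_def by (meson order_trans)
qed

lemma wint_sym_diff_le:
  assumes w: "doubling_weight w L" and L: "1 \<le> L" "L\<^sup>2 \<le> 2 ^ D"
    and p: "0 < p" "p \<le> 1" and r: "1 \<le> r" "1 \<le> real r * p"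
    and s: "real D + 3 \<le> real s * p"
    and n: "1 \<le> n" and h: "0 < h" "h \<le> step_ratio s / real r / real n"
    and f: "f \<in> borel_measurable (lebesgue_on {-1..1})"
  shows "wint p (wavg w n) (\<lambda>x. sym_diff r (h * phi x) f x) \<le>
     ennreal (dyadic_const p D r s * (8 * 2 powr \<bar>real r * p - 2\<bar>) / real n powr (real r * p - 1)) *
      (\<Sum>k=1..n. ennreal (real k powr (real r * p - 2)) *
        (INF P\<in>{P. degree P \<le> k - 1}. wint p (wavg w k) (\<lambda>x. f x - poly P x)))"
proof -
  define \<beta> where "\<beta> = real r * p - 1"
  define C where "C = dyadic_const p D r s"
  have C: "0 < C" unfolding C_def by (rule dyadic_const_pos)
  obtain g N where g: "g \<in> borel_measurable borel" "N \<in> null_sets lborel" "\<And>x. x \<in> {-1..1} - N \<Longrightarrow> f x = g x"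
    using exists_borel_version[OF f] by blast
  have rh: "real r * h \<le> 1"
  proof -
    have "real r * h * real n \<le> step_ratio s" using h(2) n r(1) by (simp add: field_simps)
    then have "real r * h * real n \<le> 1" using step_ratio_bounds(2)[of s] by linarith
    moreover have "real r * h * 1 \<le> real r * h * real n" using n h(1) by (intro mult_left_mono) auto
    ultimately show ?thesis by simp
  qed
  have AEN: "AE x in lborel. x \<notin> N" using g(2) by (rule AE_not_in)
  define e where "e = (\<lambda>k. INF P\<in>{P. degree P \<le> k - 1}. wint p (wavg w k) (\<lambda>x. f x - poly P x))"
  have e: "e k = (INF P\<in>{P. degree P \<le> k - 1}. wint p (wavg w k) (\<lambda>x. g x - poly P x))" for k
    unfolding e_def
  proof (intro INF_cong refl wint_AE_cong)
    fix P
    show "AE x in lborel. x \<in> {-1..1} \<longrightarrow> f x - poly P x = g x - poly P x"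
      using AEN by eventually_elim (auto simp: g(3))
  qed
  \<comment> \<open>Raising the degree enlarges the set of polynomials, while the weight within one
    octave grows at most fourfold.\<close>
  have e4: "e m \<le> 4 * e k" if km: "1 \<le> k" "k \<le> m" "m \<le> 2 * k" for k m
  proof -
    have "e m \<le> 4 * wint p (wavg w k) (\<lambda>x. g x - poly P x)" if P: "degree P \<le> k - 1" for P
    proof -
      have "e m \<le> wint p (wavg w m) (\<lambda>x. g x - poly P x)"
        unfolding e using P km by (intro INF_lower) auto
      also have "\<dots> \<le> 4 * wint p (wavg w k) (\<lambda>x. g x - poly P x)"
        using g(1) by (intro wint_le_4[OF w km]) auto
      finally show ?thesis .
    qed
    then have "e m / 4 \<le> e k"
      unfolding e[of k] by (intro INF_greatest) (auto simp: divide_le_posI_ennreal)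
    then have "4 * (e m / 4) \<le> 4 * e k" by (rule mult_left_mono) simp
    then show ?thesis
      using mult_divide_eq_ennreal[of 4 "e m"] by (simp add: ennreal_times_divide mult.commute)
  qed
  obtain J where J: "2 ^ J \<le> n" "n < 2 ^ Suc J"
    using ex_power_ivl1[of 2 n] n by auto
  have "wint p (wavg w n) (\<lambda>x. sym_diff r (h * phi x) f x) = wint p (wavg w n) (\<lambda>x. sym_diff r (h * phi x) g x)"
    by (intro wint_AE_cong sym_diff_AE_cong[OF g(2) g(3) r(1) h(1) rh])
  also have "\<dots> \<le> ennreal (C / real n powr \<beta>) * (\<Sum>j\<le>J. ennreal (real (2 ^ j) powr \<beta>) *
      (INF P\<in>{P. degree P \<le> 2 ^ j - 1}. wint p (wavg w (2 ^ j)) (\<lambda>x. g x - poly P x)))"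
  proof (rule le_sum_INF_ennreal)
    fix P :: "nat \<Rightarrow> real poly" assume P: "\<And>j. P j \<in> {P. degree P \<le> 2 ^ j - 1}"
    show "wint p (wavg w n) (\<lambda>x. sym_diff r (h * phi x) g x) \<le> ennreal (C / real n powr \<beta>) *
       (\<Sum>j\<le>J. ennreal (real (2 ^ j) powr \<beta>) * wint p (wavg w (2 ^ j)) (\<lambda>x. g x - poly (P j) x))"
      unfolding C_def \<beta>_def using P by (intro wint_sym_diff_dyadic[OF w L p r s h _ g(1) J]) auto
  next
    show "{P :: real poly. degree P \<le> 2 ^ j - 1} \<noteq> {}" for j :: nat
      by (auto intro!: exI[of _ 0])
  qed (use C in auto)
  also have "\<dots> = ennreal (C / real n powr \<beta>) * (\<Sum>j\<le>J. ennreal (real (2 ^ j) powr (real r * p - 2 + 1)) * e (2 ^ j))"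
    by (simp add: e \<beta>_def)
  also have "\<dots> \<le> ennreal (C / real n powr \<beta>) * (ennreal (8 * 2 powr \<bar>real r * p - 2\<bar>) *
      (\<Sum>k=1..2 ^ J. ennreal (real k powr (real r * p - 2)) * e k))"
    by (intro mult_left_mono dyadic_sum_le e4) auto
  also have "\<dots> \<le> ennreal (C / real n powr \<beta>) * (ennreal (8 * 2 powr \<bar>real r * p - 2\<bar>) *
      (\<Sum>k=1..n. ennreal (real k powr (real r * p - 2)) * e k))"
    using J by (intro mult_left_mono sum_mono2) auto
  also have "\<dots> = ennreal (C * (8 * 2 powr \<bar>real r * p - 2\<bar>) / real n powr \<beta>) *
      (\<Sum>k=1..n. ennreal (real k powr (real r * p - 2)) * e k)"
  proof -
    have "C * (8 * 2 powr \<bar>real r * p - 2\<bar>) / real n powr \<beta> = C / real n powr \<beta> * (8 * 2 powr \<bar>real r * p - 2\<bar>)"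
      by simp
    moreover have "ennreal \<dots> = ennreal (C / real n powr \<beta>) * ennreal (8 * 2 powr \<bar>real r * p - 2\<bar>)"
      using C by (intro ennreal_mult) auto
    ultimately show ?thesis by (simp only: mult.assoc)
  qed
  finally show ?thesis by (simp only: C_def \<beta>_def e_def)
qed

theorem corollary7p10:
  fixes p L :: real and r :: nat
  assumes "0 < p" and "p < 1" and "real r > 1 / p"
  shows "\<exists>\<theta>>0. \<exists>c>0. \<forall>w. doubling_weight w L \<longrightarrow>
           (\<forall>f. in_Lp p f \<longrightarrow> (\<forall>n\<ge>1.
              modulus r f (\<theta> / real n) p (wavg w n)
                \<le> ennreal (c / real n powr (real r - 1 / p)) *
                  ennpowr (\<Sum>k=1..n. ennreal (real k powr (real r * p - 2)) *
                              ennpowr (best_approx k p (wavg w k) f) p) (1 / p)))"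
proof -
  \<comment> \<open>\<open>L\<close> is an arbitrary real. All parameters are fixed from
    \<open>p\<close>, \<open>r\<close> and \<open>L\<close> before the weight, the function and
    \<open>n\<close> appear, so the constants are uniform in these.\<close>
  define L' where "L' = max 1 L"
  have L': "1 \<le> L'" "L \<le> L'" by (auto simp: L'_def)
  \<comment> \<open>The square reflects the two applications of doubling needed for one doubled
    ball.\<close>
  obtain D where D: "L'\<^sup>2 \<le> 2 ^ D" using real_arch_pow[of 2 "L'\<^sup>2"] by (auto intro: less_imp_le)
  obtain s :: nat where s: "real D + 3 \<le> real s * p"
    using reals_Archimedean3[OF assms(1)] by (meson less_imp_le)
  have p: "0 < p" "p \<le> 1" using assms by auto
  have rp: "1 < real r * p" using assms by (simp add: field_simps)
  have r: "1 \<le> r" using rp by (cases r) auto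
  define C where "C = dyadic_const p D r s * (8 * 2 powr \<bar>real r * p - 2\<bar>)"
  have C: "0 < C" using dyadic_const_pos[of p D r s] by (simp add: C_def)
  \<comment> \<open>With this step the nodes, spread over \<open>r * h * phi x\<close>, stay in the
    disc of radius \<open>step_ratio s * rho m x\<close> at every level
    \<open>m \<le> n\<close>.\<close>
  define \<theta> where "\<theta> = step_ratio s / real r"
  have \<theta>: "0 < \<theta>" using step_ratio_bounds(1) r by (simp add: \<theta>_def)
  have main: "modulus r f (\<theta> / real n) p (wavg w n)
                \<le> ennreal (C powr (1 / p) / real n powr (real r - 1 / p)) *
                  ennpowr (\<Sum>k=1..n. ennreal (real k powr (real r * p - 2)) *
                              ennpowr (best_approx k p (wavg w k) f) p) (1 / p)"
    if w0: "doubling_weight w L" and f: "in_Lp p f" and n: "1 \<le> n" for w f n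
  proof -
    have w: "doubling_weight w L'" using w0 L'(2) by (rule doubling_weight_mono)
    have f': "f \<in> borel_measurable (lebesgue_on {-1..1})" using f by (simp add: in_Lp_def)
    have n0: "0 < real n" using n by simp
    define S where "S = (\<Sum>k=1..n. ennreal (real k powr (real r * p - 2)) * ennpowr (best_approx k p (wavg w k) f) p)"
    have best: "(INF P\<in>{P. degree P \<le> k - 1}. wint p (wavg w k) (\<lambda>x. f x - poly P x)) \<le> ennpowr (best_approx k p (wavg w k) f) p" for k
      unfolding best_approx_def wnorm_def wint_eq_lebesgue_on by (rule INF_le_ennpowr_INF[OF p(1)])
    show ?thesis
      unfolding modulus_def S_def[symmetric]
    proof (rule SUP_least)
      fix h assume "h \<in> {0<..\<theta> / real n}"
      then have h: "0 < h" "h \<le> step_ratio s / real r / real n" by (auto simp: \<theta>_def)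
      have "wint p (wavg w n) (\<lambda>x. sym_diff r (h * phi x) f x) \<le> ennreal (C / real n powr (real r * p - 1)) * S"
        unfolding C_def S_def
        by (rule order_trans[OF wint_sym_diff_le[OF w L'(1) D p r less_imp_le[OF rp] s n h f']])
           (intro mult_left_mono sum_mono best; simp)
      then have "wnorm p (wavg w n) (\<lambda>x. sym_diff r (h * phi x) f x) \<le> ennpowr (ennreal (C / real n powr (real r * p - 1)) * S) (1 / p)"
        unfolding wnorm_def wint_eq_lebesgue_on using p by (intro ennpowr_mono) auto
      also have "\<dots> = ennreal ((C / real n powr (real r * p - 1)) powr (1 / p)) * ennpowr S (1 / p)"
        using C n0 by (intro ennpowr_cmult) simp
      also have "(C / real n powr (real r * p - 1)) powr (1 / p) = C powr (1 / p) / real n powr (real r - 1 / p)"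
        using C n0 p by (simp add: powr_divide powr_powr diff_divide_distrib left_diff_distrib)
      finally show "wnorm p (wavg w n) (\<lambda>x. sym_diff r (h * phi x) f x) \<le> ennreal (C powr (1 / p) / real n powr (real r - 1 / p)) * ennpowr S (1 / p)" .
    qed
  qed
  show ?thesis
    using \<theta> C main by (intro exI[of _ \<theta>] conjI exI[of _ "C powr (1 / p)"] allI impI) auto
qed

end
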